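(* Let $\{x_k^\delta\}_{k\ge0}$ be the (r)SVRG iterates defined in the context, with constant step size $c_0>0$ (independent of $\delta$) satisfying $c_0\le L^{-1}$, $L=\max_{1\le i\le n}\|A_i\|^2$, and with $A$ obtained from $A_\dag$ by the truncation rule in the context with constants $a\ge0$ and $b$. Let $e_k^\delta=x_k^\delta-x_\dag$. (No source condition on $x_\dag-x_0$ is assumed.) (i) (rSVRG) Let $a>0$ and $b\in(0,1)$. If $c_0<\overline{C_0}$, then rSVRG is regularizing in expectation: for every $\varepsilon>0$ there exist $k_1\in\mathbb N$ and $\delta_1>0$ such that $\mathbb E[\|e_k^\delta\|^2]^{\frac12}<\varepsilon$ for all $k\ge k_1$ and all $\delta\in(0,\delta_1]$. If $c_0<C_0$, then rSVRG is regularizing in the uniform sense: for every $\varepsilon>0$ there exist $k_1\in\mathbb N$ and $\delta_1>0$ such that, for every realization of the random indices, $\|e_k^\delta\|<\varepsilon$ for all $k\ge k_1$ and all $\delta\in(0,\delta_1]$. (ii) (SVRG) Let $a=0$ and let the stopping index $k(\delta)$ satisfy $$\lim_{\delta\to0^+}k(\delta)=\infty\quad\text{and}\quad\lim_{\delta\to0^+}\sqrt{k(\delta)}\,\delta=0.$$ If $c_0<\overline{C_0}$, then SVRG is regularizing in expectation: $\lim_{\delta\to0^+}\mathbb E[\|e_{k(\delta)}^\delta\|^2]^{\frac12}=0$. If $c_0<C_0$, then SVRG is regularizing in the uniform sense: $\lim_{\delta\to0^+}\|e_{k(\delta)}^\delta\|=0$, uniformly over all realizations of the random indices.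
   Context: Setting. $X,Y_1,\dots,Y_n$ are Hilbert spaces and $Y=Y_1\times\cdots\times Y_n$ with $\|y\|^2=\sum_{i=1}^n\|y_i\|^2$. $A_\dag=(A_{\dag,1},\dots,A_{\dag,n})^T:X\to Y$ with each $A_{\dag,i}:X\to Y_i$ bounded linear. $x_0\in X$ is an initial guess, $y_\dag\in Y$ is exact data in the range of $A_\dag$, and $x_\dag=\arg\min\{\|x-x_0\|: x\in X,\ A_\dag x=y_\dag\}$. The noisy data is $y^\delta=y_\dag+\xi$ with $\xi\in Y$ and noise level $\delta=\|\xi\|<1$. Truncation rule (constants $a\ge0$, $b>0$). If $a=0$, then $A=A_\dag$. If $a>0$, then $A_\dag$ is compact with singular value decomposition $A_\dag(\cdot)=\sum_{j=1}^\infty\sigma_j\langle\varphi_j,\cdot\rangle\psi_j$, where $\{\sigma_j\}\subset[0,\infty)$, $\sigma_j\ge\sigma_{j'}\ge a\delta^b>0$ for all $j\le j'\le J$, and $\sigma_j<a\delta^b$ for all $j>J$; and $A(\cdot)=\sum_{j=1}^J\sigma_j\langle\varphi_j,\cdot\rangle\psi_j$. Write $A=(A_1,\dots,A_n)^T$ with $A_i:X\to Y_i$. (r)SVRG with constant step size $c_0$ and frequency $M\in\mathbb N$, $M\ge1$: $x_0^\delta=x_0$, and for $K=0,1,\dots$ and $t=0,\dots,M-1$, $$x_{KM+t+1}^\delta=x_{KM+t}^\delta-c_0\Big(A_{i_{KM+t}}^*A_{i_{KM+t}}(x_{KM+t}^\delta-x_{KM}^\delta)+g_K\Big),\qquad g_K=\tfrac1nA^*(Ax_{KM}^\delta-y^\delta),$$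 where the indices $i_k$ are drawn i.i.d. uniformly from $\{1,\dots,n\}$. The case $a=0$ is called SVRG and the case $a>0$ rSVRG. $\mathbb E$ is the expectation over the random indices. Constants: $$\overline{C_0}=\max\Big(3^{-1}\|A\|^{-1}(5Ln^{-1}M)^{-\frac12},\ 9^{-1}L^{-1}(15+7\ln M)^{-1}\Big),$$ $$C_0=\Big(14^2\sqrt L\,M\|A\|\ln\big(2e^2n\sqrt L\|A\|^{-1}\big)\Big)^{-1}.$$ *)

theory Defs
  imports "HOL-Probability.Probability"
begin

definition compact_operator :: "('a::real_normed_vector \<Rightarrow> 'b::real_normed_vector) \<Rightarrow> bool" where
  "compact_operator f \<longleftrightarrow>
     bounded_linear f \<and> (\<forall>S. bounded S \<longrightarrow> compact (closure (f ` S)))"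

text \<open>
  Singular values are indexed from \<open>0\<close>. Orthonormality is only required where the singular value is
  positive: the remaining vectors do not contribute to the sum, and in this way operators of finite
  rank, in particular on finite-dimensional spaces, also have a singular value decomposition
  indexed by all of \<open>nat\<close>.
\<close>
definition singular_value_decomposition ::
    "('a::real_inner \<Rightarrow> 'b::real_inner) \<Rightarrow> (nat \<Rightarrow> real) \<Rightarrow> (nat \<Rightarrow> 'a) \<Rightarrow> (nat \<Rightarrow> 'b) \<Rightarrow> bool" where
  "singular_value_decomposition f \<sigma> \<phi> \<psi> \<longleftrightarrow>
     (\<forall>j. 0 \<le> \<sigma> j) \<and>
     (\<forall>i j. 0 < \<sigma> i \<longrightarrow> 0 < \<sigma> j \<longrightarrow>
        \<phi> i \<bullet> \<phi> j = (if i = j then 1 else 0) \<and> \<psi> i \<bullet> \<psi> j = (if i = j then 1 else 0)) \<and>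
     (\<forall>x. (\<lambda>j. (\<sigma> j * (\<phi> j \<bullet> x)) *\<^sub>R \<psi> j) sums f x)"

text \<open>
  \<open>truncation a b \<delta> Adag A\<close>: the operator \<open>A\<close> is obtained from \<open>Adag\<close> at noise level \<open>\<delta>\<close>. For \<open>a > 0\<close>
  the result \<open>A\<close> does not depend on the choice of the singular value decomposition.
\<close>
definition truncation ::
    "real \<Rightarrow> real \<Rightarrow> real \<Rightarrow> ('a::real_inner \<Rightarrow> 'b::real_inner) \<Rightarrow> ('a \<Rightarrow> 'b) \<Rightarrow> bool" where
  "truncation a b \<delta> Adag A \<longleftrightarrow>
     (if a = 0 then A = Adag
      else compact_operator Adag \<and>
        (\<exists>\<sigma> \<phi> \<psi> J. singular_value_decomposition Adag \<sigma> \<phi> \<psi> \<and>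
           (\<forall>j j'. j \<le> j' \<and> j' < J \<longrightarrow> \<sigma> j \<ge> \<sigma> j' \<and> \<sigma> j' \<ge> a * \<delta> powr b) \<and>
           (\<forall>j\<ge>J. \<sigma> j < a * \<delta> powr b) \<and>
           A = (\<lambda>x. \<Sum>j<J. (\<sigma> j * (\<phi> j \<bullet> x)) *\<^sub>R \<psi> j)))"

text \<open>
  The component \<open>A\<^sub>i\<close> of \<open>A\<close> is \<open>\<lambda>x. A x $ i\<close>. Iteration \<open>k = K * M + t\<close> with \<open>t < M\<close> uses the
  anchor \<open>x\<^bsub>K * M\<^esub>\<close>, where \<open>K = k div M\<close>; \<open>idx\<close> is the sequence of drawn indices.
\<close>
function svrg ::
    "('a::real_inner \<Rightarrow> ('b::real_inner)^('n::finite)) \<Rightarrow> 'b^'n \<Rightarrow> real \<Rightarrow> nat \<Rightarrow> 'a \<Rightarrow>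
     (nat \<Rightarrow> 'n) \<Rightarrow> nat \<Rightarrow> 'a" where
  "svrg A y c M x0 idx 0 = x0"
| "svrg A y c M x0 idx (Suc k) =
     (let x = svrg A y c M x0 idx k;
          z = svrg A y c M x0 idx ((k div M) * M);
          g = (1 / real CARD('n)) *\<^sub>R adjoint A (A z - y)
      in x - c *\<^sub>R (adjoint (\<lambda>u. A u $ idx k) (A (x - z) $ idx k) + g))"
  by pat_completeness auto
termination
  by (relation "inv_image less_than (\<lambda>(A, y, c, M, x0, idx, k). k)") (auto simp: less_Suc_eq_le)

definition L_const :: "('a::real_normed_vector \<Rightarrow> ('b::real_normed_vector)^('n::finite)) \<Rightarrow> real" where
  "L_const A = Max (range (\<lambda>i. (onorm (\<lambda>x. A x $ i))\<^sup>2))"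

text \<open>
  The operator is understood to be nonzero in the following two constants, as in the bound
  \<open>c \<le> 1 / L_const A\<close>.
\<close>
definition C0_bar :: "('a::real_inner \<Rightarrow> ('b::real_inner)^('n::finite)) \<Rightarrow> nat \<Rightarrow> real" where
  "C0_bar A M =
     max (1 / (3 * onorm A * sqrt (5 * L_const A / real CARD('n) * real M)))
         (1 / (9 * L_const A * (15 + 7 * ln (real M))))"

definition C0 :: "('a::real_inner \<Rightarrow> ('b::real_inner)^('n::finite)) \<Rightarrow> nat \<Rightarrow> real" where
  "C0 A M =
     1 / (14\<^sup>2 * sqrt (L_const A) * real M * onorm A *
          ln (2 * (exp 1)\<^sup>2 * real CARD('n) * sqrt (L_const A) / onorm A))"

end

theory Submission
  imports Defs
begin

text \<open>
The error \<open>x\<^sub>k - x\<^sub>\<dagger>\<close> obeys the same linear recursion as the iterate, driven by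
\<open>A\<^sup>* \<xi>\<close> instead of \<open>A\<^sup>* y\<^sup>\<delta>\<close>, and it is additive in initial error and noise. So the proof has to
show that the noise-free error tends to zero, at a speed that is uniform in the operator
\<open>A\<close>, and that the error caused by the noise alone is small. Write \<open>n\<close> for the number of blocks,
\<open>B = A\<^sup>* A / n\<close>, \<open>T = I - c B\<close>, \<open>U = I - c A A\<^sup>* / n\<close>, \<open>N\<^sub>i = A\<^sub>i\<^sup>* A\<^sub>i - B\<close>, and \<open>d\<^sub>k\<close> for the
displacement of the iterate from its anchor. No convergence rates and no spectral calculus are needed;
everything rests on the following energy estimates.

\<^item> In mean square. A step is \<open>x \<mapsto> T x + (c / n) A\<^sup>* y - c N\<^sub>i d\<close>, and the noise \<open>N\<^sub>i d\<close> has mean zero, so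
  that squared norms expand without cross terms (\<open>mean_expansion\<close>). The residual \<open>r = A x - y\<close> satisfies the closed recursion
  \<open>r \<mapsto> U r - c A N\<^sub>i d\<close>, and \<open>A d\<close> is the displacement of \<open>r\<close>. The variance that \<open>r\<close> collects during one
  epoch of \<open>M\<close> steps is at most \<open>\<Sum>\<^sub>m c\<^sup>2 (L / n) \<parallel>A T\<^sup>m\<parallel>\<^sup>2\<close> (over \<open>m < M\<close>) times the largest \<open>E \<parallel>A d\<parallel>\<^sup>2\<close>,
  and the bound on the step size makes this sum at most a third (\<open>noise_weights_exist\<close>): one alternative in the bound uses
  \<open>\<parallel>A T\<^sup>m\<parallel> \<le> \<parallel>A\<parallel>\<close>, the other \<open>\<parallel>A T\<^sup>m\<parallel>\<^sup>2 \<le> n / (c (2 m + 1))\<close> and a harmonic sum. Since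
  \<open>\<parallel>U\<^sup>M r\<parallel>\<^sup>2 + \<parallel>r - U\<^sup>M r\<parallel>\<^sup>2 \<le> \<parallel>r\<parallel>\<^sup>2\<close>, the mean square of \<open>r\<close> decreases in every epoch by a multiple of
  the largest \<open>E \<parallel>A d\<parallel>\<^sup>2\<close> (\<open>epoch\<close>), and so \<open>E \<parallel>A d\<parallel>\<^sup>2\<close> is summable (\<open>sum_D\<close>). This gives
  \<open>E \<parallel>x\<^sub>k\<parallel>\<^sup>2 \<le> \<parallel>T\<^sup>k x\<^sub>0\<parallel>\<^sup>2 + O(1 / k)\<close> without noise (\<open>mean_error_exact\<close>), and \<open>O((k + M) \<delta>\<^sup>2)\<close> for the noise
  alone (\<open>mean_error_noise\<close>).

\<^item> Pathwise. For a small step size the squared norm decreases in every epoch by a multiple of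
  \<open>\<parallel>r\<parallel>\<^sup>2\<close>, up to \<open>O(M \<delta>\<^sup>2)\<close>, whatever indices are drawn (\<open>epoch_energy\<close>). Without noise and for
  \<open>x\<^sub>0 = A\<^sup>* w\<^sub>0\<close> let \<open>s\<^sub>K = \<parallel>A x\<parallel>\<close> at the \<open>K\<close>-th anchor. Then \<open>\<Sum> s\<^sub>K\<^sup>2\<close> is bounded, the anchor is
  \<open>A\<^sup>* w\<^sub>K\<close> with \<open>\<parallel>w\<^sub>K\<parallel> \<le> \<parallel>w\<^sub>0\<parallel> + C \<Sum>\<^sub>j\<^sub><\<^sub>K s\<^sub>j = O(\<surd>K)\<close>, and its squared norm is at most
  \<open>s\<^sub>K \<parallel>w\<^sub>K\<parallel>\<close>. If it stayed above \<open>\<epsilon>\<^sup>2\<close>, then \<open>s\<^sub>K\<^sup>2\<close> would be at least of order \<open>1 / K\<close>, and the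
  harmonic series would diverge against the bound (\<open>divergence_by_harmonic_sum\<close>, \<open>pathwise_exact\<close>).

Minimality of \<open>x\<^sub>\<dagger>\<close> makes \<open>x\<^sub>0 - x\<^sub>\<dagger>\<close> orthogonal to the kernel of \<open>A\<^sub>\<dagger>\<close>, so it is a limit of
vectors \<open>A\<^sub>\<dagger>\<^sup>* w\<close> (\<open>approximation_by_range_adjoint\<close>), and the part that is left over is not
amplified. Without truncation the noise contributes \<open>O(\<surd>k \<delta>)\<close>. With truncation,
\<open>A\<^sup>* \<xi> = A\<^sup>* A u\<close> for some \<open>u\<close> with \<open>\<parallel>u\<parallel> \<le> \<delta>\<^sup>1\<^sup>-\<^sup>b / a\<close>; shifting by \<open>u\<close> removes the noise for all
\<open>k\<close> at once, and \<open>\<parallel>A\<^sub>\<dagger> - A\<parallel> \<le> a \<delta>\<^sup>b\<close> lets the same \<open>w\<close> serve for all small \<open>\<delta>\<close>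
(\<open>truncation_properties\<close>, \<open>rsvrg_reduction\<close>).
\<close>

section \<open>Hilbert space preliminaries\<close>

lemma norm_add_sq: "(norm (x + y))\<^sup>2 = (norm x)\<^sup>2 + 2 * (x \<bullet> y) + (norm (y::'a::real_inner))\<^sup>2"
  by (simp add: power2_norm_eq_inner inner_add_left inner_add_right inner_commute)

lemma norm_diff_sq: "(norm (x - y))\<^sup>2 = (norm x)\<^sup>2 - 2 * (x \<bullet> y) + (norm (y::'a::real_inner))\<^sup>2"
  by (simp add: power2_norm_eq_inner inner_diff_left inner_diff_right inner_commute)

lemma parallelogram:
  fixes u v :: "'a::real_inner"
  shows "(norm (u - v))\<^sup>2 = 2 * (norm u)\<^sup>2 + 2 * (norm v)\<^sup>2 - 4 * (norm ((1/2) *\<^sub>R (u + v)))\<^sup>2"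
proof -
  have "(norm ((1/2) *\<^sub>R (u + v)))\<^sup>2 = (norm (u + v))\<^sup>2 / 4" by (simp add: power_divide)
  thus ?thesis by (simp add: norm_add_sq norm_diff_sq)
qed

text \<open>
The point \<open>p\<close> of the closure of \<open>S\<close> nearest to \<open>x\<close>; completeness is needed of the whole space only, and
\<open>S\<close> need not be closed.
\<close>
lemma subspace_projection:
  fixes S :: "'a::{real_inner,complete_space} set"
  assumes S: "subspace S"
  obtains p where "p \<in> closure S" "\<And>s. s \<in> S \<Longrightarrow> (x - p) \<bullet> s = 0"
proof -
  define D where "D = (INF s\<in>S. (norm (x - s))\<^sup>2)"
  have bdd: "bdd_below ((\<lambda>s. (norm (x - s))\<^sup>2) ` S)"
    by (intro bdd_belowI[of _ 0]) auto
  have ne: "S \<noteq> {}" using subspace_0[OF S] by auto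
  have low: "D \<le> (norm (x - s))\<^sup>2" if "s \<in> S" for s
    unfolding D_def by (rule cINF_lower[OF bdd that])
  have "\<exists>s\<in>S. (norm (x - s))\<^sup>2 < D + 1 / real (Suc k)" for k
  proof (rule ccontr)
    assume "\<not> ?thesis"
    hence "D + 1 / real (Suc k) \<le> D"
      unfolding D_def using ne by (intro cINF_greatest) (auto simp: not_less D_def)
    thus False by simp
  qed
  then obtain s where s: "\<And>k. s k \<in> S" "\<And>k. (norm (x - s k))\<^sup>2 < D + 1 / real (Suc k)"
    by metis
  have diff: "(norm (s j - s k))\<^sup>2 \<le> 2 / real (Suc j) + 2 / real (Suc k)" for j k
  proof -
    have "(1/2) *\<^sub>R (s j + s k) \<in> S"
      using s(1) S by (simp add: subspace_add subspace_scale)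
    hence "D \<le> (norm (x - (1/2) *\<^sub>R (s j + s k)))\<^sup>2" by (rule low)
    also have "x - (1/2) *\<^sub>R (s j + s k) = (1/2) *\<^sub>R ((x - s k) + (x - s j))"
      by (simp add: algebra_simps flip: scaleR_add_left)
    finally have "4 * D \<le> 4 * (norm ((1/2) *\<^sub>R ((x - s k) + (x - s j))))\<^sup>2" by simp
    moreover have "(norm (s j - s k))\<^sup>2 = 2 * (norm (x - s k))\<^sup>2 + 2 * (norm (x - s j))\<^sup>2
        - 4 * (norm ((1/2) *\<^sub>R ((x - s k) + (x - s j))))\<^sup>2"
      using parallelogram[of "x - s k" "x - s j"] by simp
    ultimately show ?thesis using s(2)[of j] s(2)[of k] by simp
  qed
  have "Cauchy s"
  proof (rule metric_CauchyI)
    fix e :: real assume "0 < e"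
    then obtain n where n: "4 / e\<^sup>2 < real n" using reals_Archimedean2 by blast
    have "dist (s j) (s k) < e" if "j \<ge> n" "k \<ge> n" for j k
    proof -
      have "0 < n" using n \<open>0 < e\<close> by (metis divide_pos_pos gr0I not_less_iff_gr_or_eq of_nat_0 order_less_trans zero_less_numeral zero_less_power)
      have "2 / real (Suc j) \<le> 2 / n" "2 / real (Suc k) \<le> 2 / n"
        using that \<open>0 < n\<close> by (auto intro!: divide_left_mono)
      hence "(norm (s j - s k))\<^sup>2 \<le> 4 / n" using diff[of j k] by simp
      also have "\<dots> < e\<^sup>2" using n \<open>0 < e\<close> \<open>0 < n\<close> by (simp add: field_simps)
      finally show ?thesis using \<open>0 < e\<close> by (simp add: dist_norm power2_less_imp_less)
    qed
    thus "\<exists>M. \<forall>m\<ge>M. \<forall>n\<ge>M. dist (s m) (s n) < e" by blast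
  qed
  then obtain p where p: "s \<longlonglongrightarrow> p" using Cauchy_convergent_iff convergent_def by blast
  have "p \<in> closure S" using p s(1) closure_sequential by blast
  have upper: "(norm (x - p))\<^sup>2 \<le> D"
  proof (rule LIMSEQ_le)
    show "(\<lambda>k. (norm (x - s k))\<^sup>2) \<longlonglongrightarrow> (norm (x - p))\<^sup>2"
      by (intro tendsto_intros p)
    show "(\<lambda>k. D + 1 / real (Suc k)) \<longlonglongrightarrow> D"
      using tendsto_add[OF tendsto_const[of D] lim_inverse_n'[THEN LIMSEQ_Suc]] by simp
  qed (use s(2) less_imp_le in blast)
  \<comment> \<open>Moving \<open>p\<close> along \<open>v \<in> S\<close> does not decrease the distance; \<open>t\<close> below is the optimal step.\<close>
  have "(x - p) \<bullet> v = 0" if "v \<in> S" for v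
  proof -
    have D_le: "D \<le> (norm (x - p - t *\<^sub>R v))\<^sup>2" for t
    proof (rule LIMSEQ_le_const)
      show "(\<lambda>k. (norm (x - s k - t *\<^sub>R v))\<^sup>2) \<longlonglongrightarrow> (norm (x - p - t *\<^sub>R v))\<^sup>2"
        by (intro tendsto_intros p)
      have "D \<le> (norm (x - (s k + t *\<^sub>R v)))\<^sup>2" for k
        using s(1) that S by (intro low) (simp add: subspace_add subspace_scale)
      thus "\<exists>N. \<forall>k\<ge>N. D \<le> (norm (x - s k - t *\<^sub>R v))\<^sup>2" by (simp add: diff_diff_eq)
    qed
    have *: "0 \<le> t\<^sup>2 * (norm v)\<^sup>2 - 2 * t * ((x - p) \<bullet> v)" for t
    proof -
      have "(norm (x - p - t *\<^sub>R v))\<^sup>2 = (norm (x - p))\<^sup>2 - 2 * t * ((x - p) \<bullet> v) + t\<^sup>2 * (norm v)\<^sup>2"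
        by (simp add: norm_diff_sq[of "x - p"] power_mult_distrib)
      thus ?thesis using upper D_le[of t] by linarith
    qed
    show ?thesis
    proof (cases "v = 0")
      case False
      define t where "t = ((x - p) \<bullet> v) / (norm v)\<^sup>2"
      have "t\<^sup>2 * (norm v)\<^sup>2 = t * ((x - p) \<bullet> v)"
        using False by (simp add: t_def power2_eq_square)
      hence "t * ((x - p) \<bullet> v) \<le> 0" using *[of t] by simp
      hence "((x - p) \<bullet> v)\<^sup>2 / (norm v)\<^sup>2 \<le> 0" by (simp add: t_def power2_eq_square)
      thus ?thesis using False by (simp add: divide_le_0_iff)
    qed simp
  qed
  thus ?thesis using that \<open>p \<in> closure S\<close> by blast
qed

lemma riesz_representation:
  fixes f :: "'a::{real_inner,complete_space} \<Rightarrow> real"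
  assumes f: "bounded_linear f"
  obtains w where "\<And>x. f x = x \<bullet> w"
proof (cases "\<forall>x. f x = 0")
  case True
  thus ?thesis using that[of 0] by simp
next
  case False
  interpret f: bounded_linear f by (rule f)
  obtain x where x: "f x \<noteq> 0" using False by blast
  let ?K = "{z. f z = 0}"
  have K: "subspace ?K"
    by (simp add: subspace_def f.add f.scaleR f.zero)
  have "closed ?K"
    by (rule closed_Collect_eq) (auto intro!: continuous_intros linear_continuous_on f)
  obtain p where p: "p \<in> closure ?K" "\<And>s. s \<in> ?K \<Longrightarrow> (x - p) \<bullet> s = 0"
    using subspace_projection[OF K] by blast
  define u where "u = x - p"
  have "f p = 0" using p(1) \<open>closed ?K\<close> by (simp add: closure_closed)
  hence fu: "f u \<noteq> 0" using x by (simp add: u_def f.diff)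
  hence "u \<noteq> 0" using f.zero by auto
  have "f z = z \<bullet> ((f u / (norm u)\<^sup>2) *\<^sub>R u)" for z
  proof -
    have "z - (f z / f u) *\<^sub>R u \<in> ?K"
      using fu by (simp add: f.diff f.scaleR)
    hence "u \<bullet> (z - (f z / f u) *\<^sub>R u) = 0" using p(2) by (simp add: u_def)
    hence "u \<bullet> z = (f z / f u) * (norm u)\<^sup>2" by (simp add: inner_diff_right power2_norm_eq_inner)
    thus ?thesis using fu \<open>u \<noteq> 0\<close> by (simp add: inner_commute)
  qed
  thus ?thesis by (rule that)
qed

text \<open>
The constant \<^const>\<open>adjoint\<close> chooses a map that satisfies this equation, if there is one. On a Hilbert
space the Riesz representation provides it for every bounded operator.
\<close>
lemma inner_adjoint:
  fixes f :: "'a::{real_inner,complete_space} \<Rightarrow> 'b::real_inner"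
  assumes f: "bounded_linear f"
  shows "f x \<bullet> y = x \<bullet> adjoint f y"
proof -
  have "\<exists>w. \<forall>x. f x \<bullet> y = x \<bullet> w" for y
  proof -
    have "bounded_linear (\<lambda>x. f x \<bullet> y)"
      using bounded_linear_compose[OF bounded_linear_inner_left f] .
    thus ?thesis using riesz_representation by metis
  qed
  hence "\<exists>f'. \<forall>x y. f x \<bullet> y = x \<bullet> f' y" by metis
  hence "\<forall>x y. f x \<bullet> y = x \<bullet> adjoint f y" unfolding adjoint_def by (rule someI_ex)
  thus ?thesis by blast
qed

lemma adjointI:
  fixes f :: "'a::{real_inner,complete_space} \<Rightarrow> 'b::real_inner"
  assumes "bounded_linear f" "\<And>x. f x \<bullet> y = x \<bullet> w"
  shows "adjoint f y = w"
  using assms inner_adjoint[OF assms(1)] by (metis vector_eq_ldot)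

lemma linear_adjoint:
  fixes f :: "'a::{real_inner,complete_space} \<Rightarrow> 'b::real_inner"
  assumes f: "bounded_linear f"
  shows "linear (adjoint f)"
  by (rule linearI; rule adjointI[OF f])
     (simp_all add: inner_add_right inner_adjoint[OF f])

lemma approximation_by_range_adjoint:
  fixes f :: "'a::{real_inner,complete_space} \<Rightarrow> 'b::real_inner"
  assumes f: "bounded_linear f" and e: "\<And>z. f z = 0 \<Longrightarrow> e \<bullet> z = 0" and "0 < \<epsilon>"
  obtains w where "norm (e - adjoint f w) < \<epsilon>"
proof -
  have sub: "subspace (range (adjoint f))"
    using linear_subspace_image[OF linear_adjoint[OF f] subspace_UNIV] .
  obtain p where p: "p \<in> closure (range (adjoint f))" "\<And>s. s \<in> range (adjoint f) \<Longrightarrow> (e - p) \<bullet> s = 0"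
    using subspace_projection[OF sub] by blast
  have "f (e - p) \<bullet> f (e - p) = 0"
    using p(2) by (simp add: inner_adjoint[OF f])
  hence ker: "f (e - p) = 0" by simp
  have "(e - p) \<bullet> p = 0"
  proof -
    have "(\<lambda>s. (e - p) \<bullet> s) ` closure (range (adjoint f)) \<subseteq> closure ((\<lambda>s. (e - p) \<bullet> s) ` range (adjoint f))"
      by (intro image_closure_subset continuous_intros closure_subset closed_closure)
    also have "\<dots> \<subseteq> {0}" using p(2) by (intro closure_minimal) auto
    finally show ?thesis using p(1) by blast
  qed
  hence "(e - p) \<bullet> (e - p) = 0"
    using e[OF ker] by (simp add: inner_diff_right inner_commute)
  hence "e \<in> closure (range (adjoint f))" using p(1) by simp
  then obtain w where "dist (adjoint f w) e < \<epsilon>"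
    using \<open>0 < \<epsilon>\<close> by (metis closure_approachable rangeE)
  thus ?thesis using that by (simp add: dist_norm norm_minus_commute)
qed

section \<open>Symmetric operators between zero and the identity\<close>

text \<open>
For a symmetric linear operator the inequality \<open>\<parallel>S x\<parallel>\<^sup>2 \<le> \<langle>S x, x\<rangle>\<close> says that \<open>0 \<le> S \<le> I\<close>. The
estimates below are read off from the moments \<open>\<langle>S\<^sup>m x, x\<rangle>\<close>, which are nonnegative, decreasing and
convex in \<open>m\<close>.
\<close>
locale symmetric_contraction =
  fixes S :: "'a::real_inner \<Rightarrow> 'a"
  assumes lin: "linear S" and sym: "S x \<bullet> y = x \<bullet> S y" and contr: "(norm (S x))\<^sup>2 \<le> S x \<bullet> x"
begin

lemma linear_pow: "linear (S ^^ m)"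
proof (induction m)
  case (Suc m)
  thus ?case using linear_compose[OF Suc lin] by (simp add: o_def)
qed (auto simp: id_def[symmetric] linear_id)

lemma sym_pow: "(S ^^ m) x \<bullet> y = x \<bullet> (S ^^ m) y"
  by (induction m arbitrary: x y) (simp_all add: sym funpow_swap1)

lemma norm_le: "norm (S x) \<le> norm x"
proof (cases "norm (S x) = 0")
  case False
  have "norm (S x) * norm (S x) \<le> norm (S x) * norm x"
    using contr[of x] norm_cauchy_schwarz[of "S x" x] by (simp add: power2_eq_square)
  thus ?thesis using False by (simp add: mult_le_cancel_left)
qed simp

lemma norm_pow_le: "norm ((S ^^ m) x) \<le> norm x"
  by (induction m) (auto intro: order_trans[OF norm_le])

lemma moment_split: "(S ^^ (i + j)) x \<bullet> x = (S ^^ i) x \<bullet> (S ^^ j) x"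
  by (simp add: funpow_add sym_pow inner_commute)

lemma moment_nonneg: "0 \<le> (S ^^ m) x \<bullet> x"
proof (cases "even m")
  case True
  then obtain l where "m = l + l" by (metis evenE mult_2)
  thus ?thesis using moment_split[of l l x] by simp
next
  case False
  then obtain l where "m = Suc l + l" by (metis oddE add_Suc mult_2 Suc_eq_plus1)
  thus ?thesis using moment_split[of "Suc l" l x] contr[of "(S ^^ l) x"]
    by (simp add: order_trans[OF zero_le_power2])
qed

lemma moment_Suc_le: "(S ^^ Suc m) x \<bullet> x \<le> (S ^^ m) x \<bullet> x"
proof (cases "even m")
  case True
  then obtain l where l: "m = l + l" by (metis evenE mult_2)
  have "(S ^^ Suc m) x \<bullet> x = S ((S ^^ l) x) \<bullet> (S ^^ l) x"
    using moment_split[of "Suc l" l x] l by simp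
  also have "\<dots> \<le> norm (S ((S ^^ l) x)) * norm ((S ^^ l) x)" by (rule norm_cauchy_schwarz)
  also have "\<dots> \<le> norm ((S ^^ l) x) * norm ((S ^^ l) x)" by (intro mult_right_mono norm_le) simp
  also have "\<dots> = (S ^^ m) x \<bullet> x"
    using moment_split[of l l x] l by (simp add: norm_eq_sqrt_inner)
  finally show ?thesis .
next
  case False
  then obtain l where l: "m = Suc l + l" by (metis oddE add_Suc mult_2 Suc_eq_plus1)
  show ?thesis
    using moment_split[of "Suc l" l x] moment_split[of "Suc l" "Suc l" x] contr[of "(S ^^ l) x"] l
    by (simp add: power2_norm_eq_inner)
qed

lemma moment_mono: "i \<le> j \<Longrightarrow> (S ^^ j) x \<bullet> x \<le> (S ^^ i) x \<bullet> x"
  using lift_Suc_antimono_le[of "\<lambda>m. (S ^^ m) x \<bullet> x"] moment_Suc_le by blast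

lemma pythagoras_le: "(norm ((S ^^ m) x))\<^sup>2 + (norm (x - (S ^^ m) x))\<^sup>2 \<le> (norm x)\<^sup>2"
proof -
  have "(norm ((S ^^ m) x))\<^sup>2 = (S ^^ (m + m)) x \<bullet> x"
    by (simp add: moment_split power2_norm_eq_inner)
  also have "\<dots> \<le> (S ^^ m) x \<bullet> x" by (rule moment_mono) simp
  finally show ?thesis by (simp add: norm_diff_sq inner_commute)
qed

lemma decrement_decreasing:
  assumes "i \<le> j"
  shows "(S ^^ j) x \<bullet> x - (S ^^ Suc j) x \<bullet> x \<le> (S ^^ i) x \<bullet> x - (S ^^ Suc i) x \<bullet> x"
proof -
  define \<nu> where "\<nu> = (\<lambda>m. (S ^^ m) x \<bullet> x - (S ^^ Suc m) x \<bullet> x)"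
  have "\<nu> (Suc m) \<le> \<nu> m" for m
  proof -
    interpret L: linear "S ^^ m" by (rule linear_pow)
    \<comment> \<open>The second difference of the moments is the moment of \<open>x - S x\<close>.\<close>
    have 1: "(S ^^ m) (S x) \<bullet> x = (S ^^ Suc m) x \<bullet> x" by (simp add: funpow_swap1)
    have 2: "(S ^^ m) (S x) \<bullet> S x = (S ^^ Suc (Suc m)) x \<bullet> x"
      by (simp add: funpow_swap1 flip: sym)
    have 3: "(S ^^ m) x \<bullet> S x = (S ^^ Suc m) x \<bullet> x" by (simp flip: sym)
    have "0 \<le> (S ^^ m) (x - S x) \<bullet> (x - S x)" by (rule moment_nonneg)
    also have "\<dots> = \<nu> m - \<nu> (Suc m)"
      using 1 2 3 by (simp add: L.diff inner_diff_left inner_diff_right \<nu>_def)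
    finally show ?thesis by simp
  qed
  from lift_Suc_antimono_le[of \<nu>, OF this assms] show ?thesis by (simp add: \<nu>_def)
qed

text \<open>
The decrements \<open>\<langle>S\<^sup>j x, x\<rangle> - \<langle>S\<^sup>j\<^sup>+\<^sup>1 x, x\<rangle>\<close> decrease in \<open>j\<close> and sum up to at most \<open>\<parallel>x\<parallel>\<^sup>2\<close>, so that
each is at most the average of those up to it. For \<open>S = I - c A\<^sup>* A / n\<close> the decrement with
\<open>j = 2 m\<close> is \<open>(c / n) \<parallel>A S\<^sup>m x\<parallel>\<^sup>2\<close>.
\<close>
lemma decrement_bound:
  "real (2 * m + 1) * ((S ^^ m) x \<bullet> ((S ^^ m) x - S ((S ^^ m) x))) \<le> (norm x)\<^sup>2"
proof -
  define \<nu> where "\<nu> = (\<lambda>m. (S ^^ m) x \<bullet> x - (S ^^ Suc m) x \<bullet> x)"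
  have e: "(S ^^ m) x \<bullet> ((S ^^ m) x - S ((S ^^ m) x)) = \<nu> (2 * m)"
    using moment_split[of m m x] moment_split[of m "Suc m" x]
    by (simp add: \<nu>_def inner_diff_right mult_2)
  have "real (2 * m + 1) * \<nu> (2 * m) = (\<Sum>j<2 * m + 1. \<nu> (2 * m))" by simp
  also have "\<dots> \<le> (\<Sum>j<2 * m + 1. \<nu> j)"
    unfolding \<nu>_def by (intro sum_mono decrement_decreasing) auto
  also have "\<dots> = (S ^^ 0) x \<bullet> x - (S ^^ (2 * m + 1)) x \<bullet> x"
    unfolding \<nu>_def by (rule sum_lessThan_telescope')
  also have "\<dots> \<le> (norm x)\<^sup>2"
    using moment_nonneg[of "2 * m + 1" x] by (simp add: power2_norm_eq_inner)
  finally show ?thesis unfolding e .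
qed

lemma displacement_mono:
  assumes "s \<le> m"
  shows "norm (x - (S ^^ s) x) \<le> norm (x - (S ^^ m) x)"
proof -
  have "norm (x - (S ^^ s) x) \<le> norm (x - (S ^^ Suc s) x)" for s
  proof -
    define w where "w = x - S x"
    have step: "(S ^^ j) x - (S ^^ Suc j) x = (S ^^ j) w" for j
      using linear_diff[OF linear_pow[of j], of x "S x"] by (simp add: w_def funpow_swap1)
    have tel: "x - (S ^^ s) x = (\<Sum>j<s. (S ^^ j) w)"
      using sum_lessThan_telescope'[of "\<lambda>j. (S ^^ j) x" s] by (simp add: step del: funpow.simps(2))
    have "(x - (S ^^ s) x) \<bullet> (S ^^ s) w = (\<Sum>j<s. (S ^^ (j + s)) w \<bullet> w)"
      unfolding tel by (simp add: inner_sum_left moment_split)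
    also have "\<dots> \<ge> 0" by (intro sum_nonneg moment_nonneg)
    finally have "0 \<le> (x - (S ^^ s) x) \<bullet> (S ^^ s) w" .
    moreover have "x - (S ^^ Suc s) x = (x - (S ^^ s) x) + (S ^^ s) w"
      using step[of s] by (simp add: algebra_simps)
    ultimately have "(norm (x - (S ^^ s) x))\<^sup>2 \<le> (norm (x - (S ^^ Suc s) x))\<^sup>2"
      by (simp only: norm_add_sq) simp
    thus ?thesis by (rule power2_le_imp_le) simp
  qed
  thus ?thesis using lift_Suc_mono_le[of "\<lambda>s. norm (x - (S ^^ s) x)"] assms by blast
qed

end

section \<open>Means over random index sequences\<close>

text \<open>
A function of an infinite index sequence that only reads the first \<open>k\<close> indices.
\<close>
definition depends_on_prefix :: "nat \<Rightarrow> ((nat \<Rightarrow> 'i) \<Rightarrow> 'r) \<Rightarrow> bool" where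
  "depends_on_prefix k g \<longleftrightarrow> (\<forall>idx idx'. (\<forall>j<k. idx j = idx' j) \<longrightarrow> g idx = g idx')"

text \<open>
\<open>seq_mean k g\<close> is the mean of \<open>g\<close> when the first \<open>k\<close> indices are independent and uniformly
distributed; the later ones keep an arbitrary value, so the mean is meaningful for a \<open>g\<close> that depends on the first \<open>k\<close>
indices only. The recursion averages over the last index first, which is the conditional
expectation given the earlier ones.
\<close>
primrec seq_mean :: "nat \<Rightarrow> ((nat \<Rightarrow> 'i::finite) \<Rightarrow> real) \<Rightarrow> real" where
  "seq_mean 0 g = g (\<lambda>_. undefined)"
| "seq_mean (Suc k) g = seq_mean k (\<lambda>idx. (\<Sum>i\<in>UNIV. g (idx(k := i))) / real CARD('i))"

lemma depends_on_prefixD: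
  "depends_on_prefix k g \<Longrightarrow> (\<And>j. j < k \<Longrightarrow> idx j = idx' j) \<Longrightarrow> g idx = g idx'"
  unfolding depends_on_prefix_def by blast

lemma depends_on_prefix_upd: "depends_on_prefix k g \<Longrightarrow> k \<le> j \<Longrightarrow> g (idx(j := i)) = g idx"
  by (rule depends_on_prefixD) auto

lemma seq_mean_add: "seq_mean k (\<lambda>idx. f idx + g idx) = seq_mean k f + seq_mean k g"
  by (induction k arbitrary: f g) (simp_all add: sum.distrib add_divide_distrib)

lemma seq_mean_cmult: "seq_mean k (\<lambda>idx. a * f idx) = a * seq_mean k f"
proof (induction k arbitrary: f)
  case (Suc k)
  have "seq_mean (Suc k) (\<lambda>idx. a * f idx)
      = seq_mean k (\<lambda>idx. a * ((\<Sum>i\<in>UNIV. f (idx(k := i))) / real CARD('a)))"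
    by (simp flip: sum_distrib_left)
  thus ?case unfolding Suc by simp
qed simp

lemma seq_mean_const: "seq_mean k (\<lambda>idx. a) = a"
  by (induction k) simp_all

lemma seq_mean_diff: "seq_mean k (\<lambda>idx. f idx - g idx) = seq_mean k f - seq_mean k g"
  using seq_mean_add[of k f "\<lambda>idx. (-1) * g idx"] seq_mean_cmult[of k "-1" g] by simp

lemma seq_mean_mono: "(\<And>idx. f idx \<le> g idx) \<Longrightarrow> seq_mean k f \<le> seq_mean k g"
proof (induction k arbitrary: f g)
  case (Suc k)
  show ?case unfolding seq_mean.simps
    by (rule Suc.IH) (auto intro!: divide_right_mono sum_mono Suc.prems)
qed simp

lemma seq_mean_nonneg: "(\<And>idx. 0 \<le> f idx) \<Longrightarrow> 0 \<le> seq_mean k f"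
  using seq_mean_mono[of "\<lambda>_. 0" f k] by (simp add: seq_mean_const)

lemma depends_on_prefix_mono: "depends_on_prefix k g \<Longrightarrow> k \<le> l \<Longrightarrow> depends_on_prefix l g"
  unfolding depends_on_prefix_def by (meson order_less_le_trans)

lemma seq_mean_eq_sum:
  fixes g :: "(nat \<Rightarrow> 'i::finite) \<Rightarrow> real"
  shows "seq_mean k g = (\<Sum>f\<in>{..<k} \<rightarrow>\<^sub>E UNIV. g f) / real CARD('i) ^ k"
proof (induction k arbitrary: g)
  case (Suc k)
  let ?h = "\<lambda>(i, f). f(k := i)"
  have inj: "inj_on ?h (UNIV \<times> ({..<k} \<rightarrow>\<^sub>E UNIV))"
    by (rule inj_combinator) simp
  have "(\<Sum>f\<in>{..<Suc k} \<rightarrow>\<^sub>E UNIV. g f) = (\<Sum>(i, f)\<in>UNIV \<times> ({..<k} \<rightarrow>\<^sub>E UNIV). g (f(k := i)))"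
    unfolding lessThan_Suc PiE_insert_eq
    by (subst sum.reindex[OF inj]) (simp add: case_prod_unfold comp_def)
  also have "\<dots> = (\<Sum>i\<in>UNIV. \<Sum>f\<in>{..<k} \<rightarrow>\<^sub>E UNIV. g (f(k := i)))"
    by (rule sum.cartesian_product[symmetric])
  also have "\<dots> = (\<Sum>f\<in>{..<k} \<rightarrow>\<^sub>E UNIV. \<Sum>i\<in>UNIV. g (f(k := i)))"
    by (rule sum.swap)
  finally show ?case by (simp add: Suc sum_divide_distrib[symmetric])
qed simp

lemma expectation_eq_seq_mean:
  fixes I :: "nat \<Rightarrow> 'w \<Rightarrow> 'i::finite" and g :: "(nat \<Rightarrow> 'i) \<Rightarrow> real"
  assumes P: "prob_space P"
    and indep: "prob_space.indep_vars P (\<lambda>_. count_space UNIV) I UNIV"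
    and unif: "\<And>k. distr P (count_space UNIV) (I k) = uniform_count_measure UNIV"
    and g: "depends_on_prefix k g"
  shows "prob_space.expectation P (\<lambda>\<omega>. g (\<lambda>j. I j \<omega>)) = seq_mean k g"
proof -
  interpret prob_space P by (rule P)
  have meas: "I j \<in> measurable P (count_space UNIV)" for j
    using indep unfolding indep_vars_def by auto
  have single: "prob (I j -` {i} \<inter> space P) = 1 / real CARD('i)" for j i
  proof -
    have "prob (I j -` {i} \<inter> space P) = measure (distr P (count_space UNIV) (I j)) {i}"
      by (rule measure_distr[symmetric, OF meas]) simp
    also have "\<dots> = 1 / real CARD('i)"
      unfolding unif by (subst measure_uniform_count_measure) auto
    finally show ?thesis .
  qed
  \<comment> \<open>The cylinder of outcomes whose first \<open>k\<close> indices are those of \<open>f\<close>.\<close>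
  define C where "C f = (\<Inter>j\<in>{..<k}. I j -` {f j} \<inter> space P) \<inter> space P" for f :: "nat \<Rightarrow> 'i"
  have C_sets: "C f \<in> events" for f
  proof (cases "k = 0")
    case False
    have "(\<Inter>j\<in>{..<k}. I j -` {f j} \<inter> space P) \<in> events"
      using False by (intro sets.finite_INT measurable_sets[OF meas]) auto
    thus ?thesis unfolding C_def by blast
  qed (simp add: C_def)
  have C_prob: "prob (C f) = (1 / real CARD('i)) ^ k" for f
  proof (cases "k = 0")
    case True
    thus ?thesis by (simp add: C_def prob_space)
  next
    case False
    have "prob (\<Inter>j\<in>{..<k}. I j -` {f j} \<inter> space P) = (\<Prod>j\<in>{..<k}. prob (I j -` {f j} \<inter> space P))"
      using False by (intro indep_varsD[OF indep]) auto
    moreover have "C f = (\<Inter>j\<in>{..<k}. I j -` {f j} \<inter> space P)"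
      using False by (auto simp: C_def)
    ultimately show ?thesis by (simp add: single)
  qed
  have fin: "finite ({..<k} \<rightarrow>\<^sub>E (UNIV :: 'i set))" by (intro finite_PiE) auto
  have split: "g (\<lambda>j. I j \<omega>) = (\<Sum>f\<in>{..<k} \<rightarrow>\<^sub>E UNIV. g f * indicator (C f) \<omega>)" if "\<omega> \<in> space P" for \<omega>
  proof -
    define f0 where "f0 = restrict (\<lambda>j. I j \<omega>) {..<k}"
    have f0: "f0 \<in> {..<k} \<rightarrow>\<^sub>E UNIV" by (auto simp: f0_def)
    have "indicator (C f) \<omega> = (if f = f0 then 1 else 0 :: real)" if "f \<in> {..<k} \<rightarrow>\<^sub>E UNIV" for f
      using that \<open>\<omega> \<in> space P\<close> 
      by (auto simp: C_def f0_def indicator_def PiE_def extensional_def fun_eq_iff)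
    hence "(\<Sum>f\<in>{..<k} \<rightarrow>\<^sub>E UNIV. g f * indicator (C f) \<omega>)
        = (\<Sum>f\<in>{..<k} \<rightarrow>\<^sub>E UNIV. if f = f0 then g f else 0)"
      by (intro sum.cong) auto
    also have "\<dots> = g f0" using fin f0 by simp
    also have "\<dots> = g (\<lambda>j. I j \<omega>)" by (rule depends_on_prefixD[OF g]) (simp add: f0_def)
    finally show ?thesis by simp
  qed
  have "expectation (\<lambda>\<omega>. g (\<lambda>j. I j \<omega>))
      = expectation (\<lambda>\<omega>. \<Sum>f\<in>{..<k} \<rightarrow>\<^sub>E UNIV. g f * indicator (C f) \<omega>)"
    by (intro Bochner_Integration.integral_cong refl split)
  also have "\<dots> = (\<Sum>f\<in>{..<k} \<rightarrow>\<^sub>E UNIV. expectation (\<lambda>\<omega>. g f * indicator (C f) \<omega>))"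
    by (intro Bochner_Integration.integral_sum integrable_mult_right integrable_real_indicator C_sets)
       (simp add: emeasure_eq_measure)
  also have "\<dots> = (\<Sum>f\<in>{..<k} \<rightarrow>\<^sub>E UNIV. g f * (1 / real CARD('i)) ^ k)"
    using C_sets[THEN sets.sets_into_space] by (simp add: C_prob Int_absorb1 Int_absorb2)
  also have "\<dots> = seq_mean k g"
    by (simp add: seq_mean_eq_sum power_divide sum_divide_distrib)
  finally show ?thesis .
qed

section \<open>Block operators and the variance of a step\<close>

lemma adjoint_norm_bound:
  fixes f :: "'a::{real_inner,complete_space} \<Rightarrow> 'b::real_inner"
  assumes f: "bounded_linear f" and "0 \<le> K" and K: "\<And>x. (norm (f x))\<^sup>2 \<le> K * (norm x)\<^sup>2"
  shows "(norm (adjoint f y))\<^sup>2 \<le> K * (norm y)\<^sup>2"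
proof (cases "adjoint f y = 0")
  case True
  thus ?thesis using \<open>0 \<le> K\<close> by simp
next
  case False
  define w where "w = adjoint f y"
  have "(norm w)\<^sup>2 = f w \<bullet> y" by (simp add: inner_adjoint[OF f] w_def power2_norm_eq_inner)
  also have "\<dots> \<le> norm (f w) * norm y" by (rule norm_cauchy_schwarz)
  finally have "((norm w)\<^sup>2)\<^sup>2 \<le> (norm (f w))\<^sup>2 * (norm y)\<^sup>2"
    by (metis power_mono power_mult_distrib zero_le_power2)
  also have "\<dots> \<le> (K * (norm w)\<^sup>2) * (norm y)\<^sup>2" by (intro mult_right_mono K) simp
  finally have "(norm w)\<^sup>2 * (norm w)\<^sup>2 \<le> (norm w)\<^sup>2 * (K * (norm y)\<^sup>2)"
    by (simp add: power2_eq_square mult_ac)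
  moreover have "0 < (norm w)\<^sup>2" using False by (simp add: w_def)
  ultimately show ?thesis unfolding w_def[symmetric] by (rule mult_left_le_imp_le)
qed

lemma norm_vec_sq: "(norm (x :: ('b::real_inner)^'n::finite))\<^sup>2 = (\<Sum>i\<in>UNIV. (norm (x $ i))\<^sup>2)"
  by (simp add: power2_norm_eq_inner inner_vec_def)

lemma norm_component_le: "norm (x $ i) \<le> norm (x :: ('b::real_inner)^'n::finite)"
  by (rule power2_le_imp_le) (simp_all add: norm_vec_sq member_le_sum[of i UNIV "\<lambda>i. (norm (x $ i))\<^sup>2"])

text \<open>
Vectors that sum to zero contribute no cross term to the mean square of \<open>u - t v\<^sub>i\<close>.
\<close>
lemma sum_centered_sq:
  fixes v :: "'i::finite \<Rightarrow> 'h::real_inner"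
  assumes "(\<Sum>i\<in>UNIV. v i) = 0"
  shows "(\<Sum>i\<in>UNIV. (norm (u - t *\<^sub>R v i))\<^sup>2) / real CARD('i)
     = (norm u)\<^sup>2 + t\<^sup>2 * ((\<Sum>i\<in>UNIV. (norm (v i))\<^sup>2) / real CARD('i))"
proof -
  have "(\<Sum>i\<in>UNIV. (norm (u - t *\<^sub>R v i))\<^sup>2)
      = (\<Sum>i\<in>(UNIV::'i set). (norm u)\<^sup>2) - 2 * t * (u \<bullet> (\<Sum>i\<in>UNIV. v i)) + t\<^sup>2 * (\<Sum>i\<in>UNIV. (norm (v i))\<^sup>2)"
    by (simp add: norm_diff_sq sum.distrib sum_subtractf inner_sum_right sum_distrib_left power_mult_distrib mult.assoc)
  thus ?thesis using assms by (simp add: add_divide_distrib)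
qed

text \<open>
A bounded operator \<open>A = (A\<^sub>1, \<dots>, A\<^sub>n)\<close> into a product of \<open>n\<close> spaces, a bound \<open>L\<close> for all
\<open>\<parallel>A\<^sub>i\<parallel>\<^sup>2\<close>, and a step size \<open>c \<le> 1 / L\<close>.
\<close>
locale block_operator =
  fixes A :: "'a::{real_inner,complete_space} \<Rightarrow> ('b::real_inner)^('n::finite)" and c L :: real
  assumes A: "bounded_linear A" and c_pos: "0 < c" and L_nonneg: "0 \<le> L" and cL: "c * L \<le> 1"
    and L_bound: "(norm (A x $ i))\<^sup>2 \<le> L * (norm x)\<^sup>2"
begin

text \<open>
\<open>As\<close> and \<open>Ais i\<close> are the adjoints of \<open>A\<close> and of its \<open>i\<close>-th component; \<open>B\<close> is the mean of
\<open>A\<^sub>i\<^sup>* A\<^sub>i\<close> over \<open>i\<close>, and \<open>N i\<close> the deviation of \<open>A\<^sub>i\<^sup>* A\<^sub>i\<close> from that mean. \<open>T\<close> is the gradient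
step on the domain, and \<open>U\<close> the corresponding step on residuals.
\<close>
definition As :: "'b^'n \<Rightarrow> 'a" where "As = adjoint A"
definition Ais :: "'n \<Rightarrow> 'b \<Rightarrow> 'a" where "Ais i = adjoint (\<lambda>u. A u $ i)"
definition B :: "'a \<Rightarrow> 'a" where "B x = (1 / real CARD('n)) *\<^sub>R As (A x)"
definition N :: "'n \<Rightarrow> 'a \<Rightarrow> 'a" where "N i v = Ais i (A v $ i) - B v"
definition T :: "'a \<Rightarrow> 'a" where "T x = x - c *\<^sub>R B x"
definition U :: "'b^'n \<Rightarrow> 'b^'n" where "U y = y - (c / real CARD('n)) *\<^sub>R A (As y)"

sublocale A: bounded_linear A by (rule A)

lemma Ai: "bounded_linear (\<lambda>u. A u $ i)"
  using bounded_linear_compose[OF bounded_linear_vec_nth A] by simp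

sublocale As: linear As unfolding As_def by (rule linear_adjoint[OF A])

lemma linear_Ais: "linear (Ais i)" unfolding Ais_def by (rule linear_adjoint[OF Ai])

lemma inner_As: "A x \<bullet> y = x \<bullet> As y" unfolding As_def by (rule inner_adjoint[OF A])
lemma inner_Ais: "(A x $ i) \<bullet> y = x \<bullet> Ais i y" unfolding Ais_def by (rule inner_adjoint[OF Ai])

lemma n_pos: "0 < real CARD('n)" and n_ge_1: "1 \<le> real CARD('n)" by (simp_all add: Suc_leI)

lemma A_bound: "(norm (A x))\<^sup>2 \<le> real CARD('n) * L * (norm x)\<^sup>2"
  using sum_mono[of UNIV "\<lambda>i. (norm (A x $ i))\<^sup>2" "\<lambda>i. L * (norm x)\<^sup>2"] L_bound
  by (simp add: norm_vec_sq)

lemma As_bound: "(norm (As y))\<^sup>2 \<le> real CARD('n) * L * (norm y)\<^sup>2"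
  unfolding As_def by (rule adjoint_norm_bound[OF A _ A_bound]) (simp add: L_nonneg)

lemma Ais_bound: "(norm (Ais i y))\<^sup>2 \<le> L * (norm y)\<^sup>2"
  unfolding Ais_def by (rule adjoint_norm_bound[OF Ai L_nonneg L_bound])

lemma As_eq_sum: "As y = (\<Sum>i\<in>UNIV. Ais i (y $ i))"
  unfolding As_def
  by (rule adjointI[OF A]) (simp add: inner_vec_def inner_sum_right inner_Ais)

lemma linear_B: "linear B"
  by (rule linearI) (simp_all add: B_def A.add A.scaleR As.add As.scaleR algebra_simps)

lemma sum_N: "(\<Sum>i\<in>UNIV. N i v) = 0"
  by (simp add: N_def sum_subtractf flip: As_eq_sum) (simp add: B_def sum_constant_scaleR)

lemma inner_B: "x \<bullet> B y = A x \<bullet> A y / real CARD('n)"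
  by (simp add: B_def inner_As)

lemma sum_N_bound: "(\<Sum>i\<in>UNIV. (norm (N i v))\<^sup>2) \<le> L * (norm (A v))\<^sup>2"
proof -
  have "(\<Sum>i\<in>UNIV. (norm (Ais i (A v $ i)))\<^sup>2) = (\<Sum>i\<in>UNIV. (norm (B v - (-1) *\<^sub>R N i v))\<^sup>2)"
    by (simp add: N_def)
  also have "\<dots> / real CARD('n) = (norm (B v))\<^sup>2 + (\<Sum>i\<in>UNIV. (norm (N i v))\<^sup>2) / real CARD('n)"
    using sum_centered_sq[OF sum_N, of "B v" "-1" v] by simp
  finally have "(\<Sum>i\<in>UNIV. (norm (N i v))\<^sup>2) / real CARD('n) \<le> (\<Sum>i\<in>UNIV. (norm (Ais i (A v $ i)))\<^sup>2) / real CARD('n)"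
    by simp
  hence "(\<Sum>i\<in>UNIV. (norm (N i v))\<^sup>2) \<le> (\<Sum>i\<in>UNIV. (norm (Ais i (A v $ i)))\<^sup>2)"
    using n_pos by (simp add: divide_le_cancel)
  also have "\<dots> \<le> (\<Sum>i\<in>UNIV. L * (norm (A v $ i))\<^sup>2)" by (intro sum_mono Ais_bound)
  also have "\<dots> = L * (norm (A v))\<^sup>2" by (simp add: norm_vec_sq sum_distrib_left)
  finally show ?thesis .
qed

lemma c_As_bound: "c / real CARD('n) * (norm (As y))\<^sup>2 \<le> (norm y)\<^sup>2"
proof -
  have "c / real CARD('n) * (norm (As y))\<^sup>2 \<le> c / real CARD('n) * (real CARD('n) * L * (norm y)\<^sup>2)"
    using c_pos n_pos by (intro mult_left_mono As_bound) simp
  also have "\<dots> = (c * L) * (norm y)\<^sup>2" by simp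
  also have "\<dots> \<le> (norm y)\<^sup>2" using cL L_nonneg c_pos by (intro mult_left_le_one_le) auto
  finally show ?thesis .
qed

lemma c_A_bound: "c / real CARD('n) * (norm (A x))\<^sup>2 \<le> (norm x)\<^sup>2"
proof -
  have "c / real CARD('n) * (norm (A x))\<^sup>2 \<le> c / real CARD('n) * (real CARD('n) * L * (norm x)\<^sup>2)"
    using c_pos n_pos by (intro mult_left_mono A_bound) simp
  also have "\<dots> = (c * L) * (norm x)\<^sup>2" by simp
  also have "\<dots> \<le> (norm x)\<^sup>2" using cL L_nonneg c_pos by (intro mult_left_le_one_le) auto
  finally show ?thesis .
qed

sublocale T: symmetric_contraction T
proof (rule symmetric_contraction.intro)
  show "linear T"
    using linear_add[OF linear_B] linear_scale[OF linear_B]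
    by (intro linearI) (simp_all add: T_def algebra_simps)
  show "T x \<bullet> y = x \<bullet> T y" for x y
    using inner_B[of x y] inner_B[of y x]
    by (simp add: T_def inner_diff_left inner_diff_right inner_commute)
  show "(norm (T x))\<^sup>2 \<le> T x \<bullet> x" for x
  proof -
    have "T x \<bullet> x - (norm (T x))\<^sup>2 = c * (T x \<bullet> B x)"
      by (simp add: T_def power2_norm_eq_inner inner_diff_left inner_diff_right inner_commute algebra_simps)
    moreover have "T x \<bullet> B x = (1 / real CARD('n)) * ((norm (A x))\<^sup>2 - c / real CARD('n) * (norm (As (A x)))\<^sup>2)"
      by (simp add: T_def inner_diff_left inner_B[of x x]) (simp add: B_def power2_norm_eq_inner field_simps)
    moreover have "0 \<le> (1 / real CARD('n)) * ((norm (A x))\<^sup>2 - c / real CARD('n) * (norm (As (A x)))\<^sup>2)"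
      using c_As_bound[of "A x"] by simp
    ultimately show ?thesis using c_pos by (metis diff_ge_0_iff_ge mult_nonneg_nonneg less_imp_le)
  qed
qed

sublocale U: symmetric_contraction U
proof (rule symmetric_contraction.intro)
  show "linear U"
    by (intro linearI) (simp_all add: U_def As.add As.scaleR A.add A.scaleR algebra_simps)
  show "U x \<bullet> y = x \<bullet> U y" for x y
    using inner_As[of "As x" y] inner_As[of "As y" x]
    by (simp add: U_def inner_diff_left inner_diff_right inner_commute)
  show "(norm (U y))\<^sup>2 \<le> U y \<bullet> y" for y
  proof -
    have "U y \<bullet> y - (norm (U y))\<^sup>2 = (c / real CARD('n)) * (U y \<bullet> A (As y))"
      by (simp add: U_def power2_norm_eq_inner inner_diff_left inner_diff_right inner_commute algebra_simps)
    moreover have "U y \<bullet> A (As y) = (norm (As y))\<^sup>2 - c / real CARD('n) * (norm (A (As y)))\<^sup>2"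
      using inner_As[of "As y" y]
      by (simp add: U_def inner_diff_left inner_diff_right power2_norm_eq_inner inner_commute)
    moreover have "0 \<le> (norm (As y))\<^sup>2 - c / real CARD('n) * (norm (A (As y)))\<^sup>2"
      using c_A_bound[of "As y"] by simp
    ultimately show ?thesis using c_pos n_pos 
      by (metis diff_ge_0_iff_ge mult_nonneg_nonneg less_imp_le divide_pos_pos)
  qed
qed

lemma A_T: "A (T x) = U (A x)"
  by (simp add: T_def U_def B_def A.diff A.scaleR)

lemma A_T_pow: "A ((T ^^ m) x) = (U ^^ m) (A x)"
  by (induction m) (simp_all add: A_T)

lemma As_U: "As (U y) = T (As y)"
  by (simp add: T_def U_def B_def As.diff As.scaleR)

lemma As_U_pow: "As ((U ^^ m) y) = (T ^^ m) (As y)"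
  by (induction m) (simp_all add: As_U)

lemma A_T_pow_bound: "(norm (A ((T ^^ m) x)))\<^sup>2 \<le> real CARD('n) / (c * real (2 * m + 1)) * (norm x)\<^sup>2"
proof -
  let ?z = "(T ^^ m) x"
  define k where "k = real (2 * m + 1)"
  have "0 < k" by (simp add: k_def)
  have "?z \<bullet> (?z - T ?z) = (c / real CARD('n)) * (norm (A ?z))\<^sup>2"
    by (simp add: T_def inner_B power2_norm_eq_inner)
  hence "k * ((c / real CARD('n)) * (norm (A ?z))\<^sup>2) \<le> (norm x)\<^sup>2"
    using T.decrement_bound[of m x] by (simp add: k_def)
  hence "(norm (A ?z))\<^sup>2 \<le> real CARD('n) / (c * k) * (norm x)\<^sup>2"
    using c_pos n_pos \<open>0 < k\<close> by (simp add: field_simps)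
  thus ?thesis by (simp only: k_def)
qed

lemma T_pow_As_bound: "(norm ((T ^^ m) (As y)))\<^sup>2 \<le> real CARD('n) / (c * real (2 * m + 1)) * (norm y)\<^sup>2"
proof -
  let ?z = "(U ^^ m) y"
  define k where "k = real (2 * m + 1)"
  have "0 < k" by (simp add: k_def)
  have "?z \<bullet> (?z - U ?z) = (c / real CARD('n)) * (norm (As ?z))\<^sup>2"
    using inner_As[of "As ?z" ?z] by (simp add: U_def power2_norm_eq_inner inner_commute)
  hence "k * ((c / real CARD('n)) * (norm (As ?z))\<^sup>2) \<le> (norm y)\<^sup>2"
    using U.decrement_bound[of m y] by (simp add: k_def)
  hence "(norm (As ?z))\<^sup>2 \<le> real CARD('n) / (c * k) * (norm y)\<^sup>2"
    using c_pos n_pos \<open>0 < k\<close> by (simp add: field_simps)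
  thus ?thesis by (simp only: k_def As_U_pow)
qed

text \<open>
\<open>N\<^sub>i v = A\<^sup>* Z\<^sub>i\<close>, where \<open>Z\<^sub>i\<close> is the \<open>i\<close>-th block of \<open>A v\<close> minus the mean of all blocks, each block being
viewed as a vector of the product space. So the decay of \<open>\<parallel>T\<^sup>m A\<^sup>*\<parallel>\<close> in \<open>m\<close> applies.
\<close>
lemma mean_T_pow_N_decay:
  "(\<Sum>i\<in>UNIV. (norm ((T ^^ m) (N i v)))\<^sup>2) / real CARD('n) \<le> 1 / (c * real (2 * m + 1)) * (norm (A v))\<^sup>2"
proof -
  define Y where "Y i = (\<chi> j. if j = i then A v $ j else 0)" for i
  have As_Y: "As (Y i) = Ais i (A v $ i)" for i
  proof -
    have "As (Y i) = (\<Sum>j\<in>UNIV. if j = i then Ais i (A v $ i) else 0)"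
      unfolding As_eq_sum by (intro sum.cong) (auto simp: Y_def linear_0[OF linear_Ais])
    thus ?thesis by simp
  qed
  have norm_Y: "(norm (Y i))\<^sup>2 = (norm (A v $ i))\<^sup>2" for i
  proof -
    have "(norm (Y i))\<^sup>2 = (\<Sum>j\<in>UNIV. if j = i then (norm (A v $ i))\<^sup>2 else 0)"
      unfolding norm_vec_sq by (intro sum.cong) (auto simp: Y_def)
    thus ?thesis by simp
  qed
  have sum_Y: "(\<Sum>i\<in>UNIV. Y i) = A v"
    by (simp add: vec_eq_iff Y_def)
  define Z where "Z i = Y i - (1 / real CARD('n)) *\<^sub>R A v" for i
  have N_eq: "N i v = As (Z i)" for i
    by (simp add: N_def B_def Z_def As.diff As.scaleR As_Y)
  have "(\<Sum>i\<in>UNIV. Z i) = 0"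
    by (simp add: Z_def sum_subtractf sum_Y sum_constant_scaleR)
  from sum_centered_sq[OF this, of "(1 / real CARD('n)) *\<^sub>R A v" "-1"]
  have "(\<Sum>i\<in>UNIV. (norm (Z i))\<^sup>2) / real CARD('n) \<le> (\<Sum>i\<in>UNIV. (norm (Y i))\<^sup>2) / real CARD('n)"
    by (simp add: Z_def)
  also have "\<dots> = (norm (A v))\<^sup>2 / real CARD('n)" by (simp add: norm_Y norm_vec_sq[of "A v"])
  finally have Z: "(\<Sum>i\<in>UNIV. (norm (Z i))\<^sup>2) \<le> (norm (A v))\<^sup>2"
    using n_pos by (simp add: divide_le_cancel)
  have "(\<Sum>i\<in>UNIV. (norm ((T ^^ m) (N i v)))\<^sup>2)
      \<le> (\<Sum>i\<in>UNIV. real CARD('n) / (c * real (2 * m + 1)) * (norm (Z i))\<^sup>2)"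
    unfolding N_eq by (intro sum_mono T_pow_As_bound)
  also have "\<dots> = real CARD('n) / (c * real (2 * m + 1)) * (\<Sum>i\<in>UNIV. (norm (Z i))\<^sup>2)"
    by (simp add: sum_distrib_left)
  also have "\<dots> \<le> real CARD('n) / (c * real (2 * m + 1)) * (norm (A v))\<^sup>2"
    using c_pos by (intro mult_left_mono Z) simp
  finally show ?thesis using n_pos by (simp add: field_simps)
qed

lemma mean_T_pow_N_bound:
  "(\<Sum>i\<in>UNIV. (norm ((T ^^ m) (N i v)))\<^sup>2) / real CARD('n) \<le> L / real CARD('n) * (norm (A v))\<^sup>2"
proof -
  have "(\<Sum>i\<in>UNIV. (norm ((T ^^ m) (N i v)))\<^sup>2) \<le> (\<Sum>i\<in>UNIV. (norm (N i v))\<^sup>2)"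
    by (intro sum_mono power_mono T.norm_pow_le) simp
  also note sum_N_bound
  finally show ?thesis by (simp add: divide_right_mono)
qed

lemma mean_A_T_pow_N_bound:
  assumes "\<And>x. (norm (A ((T ^^ m) x)))\<^sup>2 \<le> \<beta> * (norm x)\<^sup>2" "0 \<le> \<beta>"
  shows "(\<Sum>i\<in>UNIV. (norm (A ((T ^^ m) (N i v))))\<^sup>2) / real CARD('n) \<le> \<beta> * L / real CARD('n) * (norm (A v))\<^sup>2"
proof -
  have "(\<Sum>i\<in>UNIV. (norm (A ((T ^^ m) (N i v))))\<^sup>2) \<le> \<beta> * (\<Sum>i\<in>UNIV. (norm (N i v))\<^sup>2)"
    unfolding sum_distrib_left by (intro sum_mono assms)
  also have "\<dots> \<le> \<beta> * (L * (norm (A v))\<^sup>2)" by (intro mult_left_mono sum_N_bound assms)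
  finally show ?thesis by (simp add: divide_right_mono mult.assoc)
qed

lemma norm_T_sq: "(norm (T x))\<^sup>2 \<le> (norm x)\<^sup>2 - c / real CARD('n) * (norm (A x))\<^sup>2"
proof -
  have "(norm (T x))\<^sup>2 \<le> T x \<bullet> x" by (rule T.contr)
  also have "\<dots> = (norm x)\<^sup>2 - c / real CARD('n) * (norm (A x))\<^sup>2"
    by (simp add: T_def inner_diff_left inner_commute[of "B x"] inner_B power2_norm_eq_inner)
  finally show ?thesis .
qed

end

section \<open>Mean-square analysis of the iteration\<close>

lemma sum_lessThan_add:
  fixes p q :: nat
  shows "(\<Sum>s<p + q. f s) = (\<Sum>s<p. f s) + (\<Sum>s<q. f (p + s) :: real)"
  by (induction q) simp_all

lemma svrg_prefix:
  "depends_on_prefix k (\<lambda>idx. svrg A y c M x0 idx k)"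
proof -
  have "(\<forall>j<k. idx j = idx' j) \<longrightarrow> svrg A y c M x0 idx k = svrg A y c M x0 idx' k" for idx idx'
  proof (induction k rule: less_induct)
    case (less k)
    show ?case
    proof (cases k)
      case (Suc k')
      have "k' div M * M < Suc k'" by (simp add: less_Suc_eq_le)
      thus ?thesis using less Suc by (auto simp: Let_def)
    qed simp
  qed
  thus ?thesis unfolding depends_on_prefix_def by blast
qed

lemma depends_on_prefix_comp: "depends_on_prefix k f \<Longrightarrow> depends_on_prefix k (\<lambda>idx. h (f idx))"
  unfolding depends_on_prefix_def by metis

lemma depends_on_prefix_comp2:
  "depends_on_prefix k f \<Longrightarrow> depends_on_prefix k g \<Longrightarrow> depends_on_prefix k (\<lambda>idx. h (f idx) (g idx))"
  unfolding depends_on_prefix_def by metis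

text \<open>
The iteration with data \<open>y\<close> and initial value \<open>x0\<close>. Below, \<open>x k\<close> is the \<open>k\<close>-th iterate, \<open>d k\<close> its
displacement from its anchor, \<open>r k\<close> its residual, and \<open>D k\<close> the mean of \<open>\<parallel>A d\<parallel>\<^sup>2\<close>, which governs
the variance of the \<open>k\<close>-th step.
\<close>
locale svrg_process = block_operator A c L
  for A :: "'a::{real_inner,complete_space} \<Rightarrow> ('b::real_inner)^('n::finite)" and c L :: real +
  fixes y :: "'b^'n" and x0 :: 'a and M :: nat
  assumes M_pos: "0 < M"
begin

definition x :: "nat \<Rightarrow> (nat \<Rightarrow> 'n) \<Rightarrow> 'a" where "x k idx = svrg A y c M x0 idx k"
definition d :: "nat \<Rightarrow> (nat \<Rightarrow> 'n) \<Rightarrow> 'a" where "d k idx = x k idx - x (k div M * M) idx"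
definition r :: "nat \<Rightarrow> (nat \<Rightarrow> 'n) \<Rightarrow> 'b^'n" where "r k idx = A (x k idx) - y"
definition D :: "nat \<Rightarrow> real" where "D k = seq_mean k (\<lambda>idx. (norm (A (d k idx)))\<^sup>2)"

lemma x_0: "x 0 idx = x0" by (simp add: x_def)

lemma x_Suc:
  "x (Suc k) idx = x k idx - c *\<^sub>R (Ais (idx k) (A (d k idx) $ idx k) + (1 / real CARD('n)) *\<^sub>R As (r (k div M * M) idx))"
  by (simp add: x_def d_def r_def Let_def Ais_def As_def)

lemma x_Suc_noise: "x (Suc k) idx = (T (x k idx) + (c / real CARD('n)) *\<^sub>R As y) - c *\<^sub>R N (idx k) (d k idx)"
proof -
  have e: "As (A (x k idx)) = As (r (k div M * M) idx) + As (A (d k idx)) + As y"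
    by (simp add: r_def d_def A.diff As.diff)
  show ?thesis
    by (simp add: x_Suc T_def B_def N_def e algebra_simps)
qed

lemma r_Suc: "r (Suc k) idx = U (r k idx) - c *\<^sub>R A (N (idx k) (d k idx))"
  by (simp add: r_def x_Suc_noise U_def A.diff A.add A.scaleR As.diff T_def B_def algebra_simps)

lemma A_d: "A (d k idx) = r k idx - r (k div M * M) idx"
  by (simp add: d_def r_def A.diff)

lemma x_prefix: "depends_on_prefix k (x k)"
  unfolding x_def by (rule svrg_prefix)

lemma x_anchor_prefix: "depends_on_prefix k (x (k div M * M))"
  by (rule depends_on_prefix_mono[OF x_prefix]) simp

lemma d_prefix: "depends_on_prefix k (d k)"
  unfolding d_def by (intro depends_on_prefix_comp2[where h = minus] x_prefix x_anchor_prefix)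

lemma r_prefix: "depends_on_prefix k (r k)"
  unfolding r_def by (intro depends_on_prefix_comp[where h = "\<lambda>v. A v - y"] x_prefix)

lemma r_exact: "y = 0 \<Longrightarrow> r k idx = A (x k idx)"
  by (metis r_def diff_zero)

lemma D_nonneg: "0 \<le> D k" unfolding D_def by (intro seq_mean_nonneg) simp

text \<open>
For a process \<open>p\<close> that follows \<open>S\<close> up to the noise of the steps, where \<open>W m\<close> is the image of the
noise after \<open>m\<close> further applications of \<open>S\<close>, with mean square at most \<open>\<gamma> m \<parallel>A d\<parallel>\<^sup>2\<close>. The noise is
centred given the past, so the mean squares add up. The map \<open>S\<close> may be affine. The reference \<open>q\<close> has to be
known at time \<open>k0\<close>.
\<close>
lemma mean_expansion:
  fixes S :: "'h::real_inner \<Rightarrow> 'h" and W :: "nat \<Rightarrow> 'a \<Rightarrow> 'h"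
  assumes step: "\<And>m k idx. (S ^^ m) (p (Suc k) idx) = (S ^^ Suc m) (p k idx) - c *\<^sub>R W m (N (idx k) (d k idx))"
    and W: "\<And>m. linear (W m)"
    and \<gamma>: "\<And>m v. (\<Sum>i\<in>UNIV. (norm (W m (N i v)))\<^sup>2) / real CARD('n) \<le> \<gamma> m * (norm (A v))\<^sup>2"
    and p: "\<And>k. depends_on_prefix k (p k)" and q: "depends_on_prefix k0 q"
  shows "seq_mean (k0 + t) (\<lambda>idx. (norm ((S ^^ m) (p (k0 + t) idx) - q idx))\<^sup>2)
    \<le> seq_mean k0 (\<lambda>idx. (norm ((S ^^ (m + t)) (p k0 idx) - q idx))\<^sup>2)
      + c\<^sup>2 * (\<Sum>s<t. \<gamma> (m + (t - Suc s)) * D (k0 + s))"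
proof (induction t arbitrary: m)
  case (Suc t)
  let ?k = "k0 + t"
  have avg: "(\<Sum>i\<in>UNIV. (norm ((S ^^ m) (p (Suc ?k) (idx(?k := i))) - q (idx(?k := i))))\<^sup>2) / real CARD('n)
      \<le> (norm ((S ^^ Suc m) (p ?k idx) - q idx))\<^sup>2 + c\<^sup>2 * (\<gamma> m * (norm (A (d ?k idx)))\<^sup>2)" for idx
  proof -
    have e: "(S ^^ m) (p (Suc ?k) (idx(?k := i))) - q (idx(?k := i))
        = ((S ^^ Suc m) (p ?k idx) - q idx) - c *\<^sub>R W m (N i (d ?k idx))" for i
      unfolding step
      by (simp add: depends_on_prefix_upd[OF p] depends_on_prefix_upd[OF q] depends_on_prefix_upd[OF d_prefix])
    have z: "(\<Sum>i\<in>UNIV. W m (N i (d ?k idx))) = 0"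
      using linear_sum[OF W[of m], of "\<lambda>i. N i (d ?k idx)" UNIV] by (simp add: sum_N linear_0[OF W])
    show ?thesis unfolding e sum_centered_sq[OF z]
      by (intro add_left_mono mult_left_mono \<gamma>) simp
  qed
  have "seq_mean (k0 + Suc t) (\<lambda>idx. (norm ((S ^^ m) (p (k0 + Suc t) idx) - q idx))\<^sup>2)
    = seq_mean ?k (\<lambda>idx. (\<Sum>i\<in>UNIV. (norm ((S ^^ m) (p (Suc ?k) (idx(?k := i))) - q (idx(?k := i))))\<^sup>2) / real CARD('n))"
    by simp
  also have "\<dots> \<le> seq_mean ?k (\<lambda>idx. (norm ((S ^^ Suc m) (p ?k idx) - q idx))\<^sup>2 + c\<^sup>2 * (\<gamma> m * (norm (A (d ?k idx)))\<^sup>2))"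
    by (intro seq_mean_mono avg)
  also have "\<dots> = seq_mean ?k (\<lambda>idx. (norm ((S ^^ Suc m) (p ?k idx) - q idx))\<^sup>2) + c\<^sup>2 * (\<gamma> m * D ?k)"
    by (simp only: seq_mean_add seq_mean_cmult D_def)
  also have "\<dots> \<le> seq_mean k0 (\<lambda>idx. (norm ((S ^^ (Suc m + t)) (p k0 idx) - q idx))\<^sup>2)
      + c\<^sup>2 * (\<Sum>s<t. \<gamma> (Suc m + (t - Suc s)) * D (k0 + s)) + c\<^sup>2 * (\<gamma> m * D ?k)"
    using Suc.IH[of "Suc m"] by simp
  also have "(\<Sum>s<t. \<gamma> (Suc m + (t - Suc s)) * D (k0 + s)) = (\<Sum>s<t. \<gamma> (m + (Suc t - Suc s)) * D (k0 + s))"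
    by (intro sum.cong) (auto simp: Suc_diff_Suc)
  finally show ?case by (simp add: distrib_left)
qed simp

text \<open>
The mean square of the residual at the \<open>K\<close>-th anchor.
\<close>
definition rho :: "nat \<Rightarrow> real" where
  "rho K = seq_mean (K * M) (\<lambda>idx. (norm (r (K * M) idx))\<^sup>2)"

lemma rho_nonneg: "0 \<le> rho K" unfolding rho_def by (intro seq_mean_nonneg) simp

lemma r_expansion:
  assumes \<gamma>: "\<And>m v. (\<Sum>i\<in>UNIV. (norm (A ((T ^^ m) (N i v))))\<^sup>2) / real CARD('n) \<le> \<gamma> m * (norm (A v))\<^sup>2"
    and q: "depends_on_prefix k0 q"
  shows "seq_mean (k0 + t) (\<lambda>idx. (norm (r (k0 + t) idx - q idx))\<^sup>2)
    \<le> seq_mean k0 (\<lambda>idx. (norm ((U ^^ t) (r k0 idx) - q idx))\<^sup>2)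
      + c\<^sup>2 * (\<Sum>s<t. \<gamma> (t - Suc s) * D (k0 + s))"
proof -
  have "(U ^^ m) (r (Suc k) idx) = (U ^^ Suc m) (r k idx) - c *\<^sub>R A ((T ^^ m) (N (idx k) (d k idx)))" for m k idx
    using linear_diff[OF U.linear_pow[of m]] linear_scale[OF U.linear_pow[of m]]
    by (simp add: r_Suc A_T_pow funpow_swap1)
  moreover have "linear (\<lambda>v. A ((T ^^ m) v))" for m
    using linear_compose[OF T.linear_pow[of m] A.linear_axioms] by (simp add: o_def)
  ultimately show ?thesis
    using mean_expansion[of U r "\<lambda>m v. A ((T ^^ m) v)" \<gamma> k0 q t 0] \<gamma> q r_prefix by simp
qed

lemma x_expansion:
  assumes y: "y = 0"
    and \<eta>: "\<And>m v. (\<Sum>i\<in>UNIV. (norm ((T ^^ m) (N i v)))\<^sup>2) / real CARD('n) \<le> \<eta> m * (norm (A v))\<^sup>2"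
  shows "seq_mean (k0 + t) (\<lambda>idx. (norm ((T ^^ m) (x (k0 + t) idx)))\<^sup>2)
    \<le> seq_mean k0 (\<lambda>idx. (norm ((T ^^ (m + t)) (x k0 idx)))\<^sup>2)
      + c\<^sup>2 * (\<Sum>s<t. \<eta> (m + (t - Suc s)) * D (k0 + s))"
proof -
  have As_y: "As y = 0" using y As.zero by metis
  have "(T ^^ m) (x (Suc k) idx) = (T ^^ Suc m) (x k idx) - c *\<^sub>R (T ^^ m) (N (idx k) (d k idx))" for m k idx
    using linear_diff[OF T.linear_pow[of m]] linear_scale[OF T.linear_pow[of m]]
    by (simp add: x_Suc_noise As_y funpow_swap1)
  moreover have "depends_on_prefix k0 (\<lambda>_. 0 :: 'a)" by (simp add: depends_on_prefix_def)
  ultimately show ?thesis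
    using mean_expansion[of T x "\<lambda>m. T ^^ m" \<eta> k0 "\<lambda>_. 0" t m] \<eta> x_prefix T.linear_pow by simp
qed

lemma noise_energy_bound: "c\<^sup>2 * (L / real CARD('n)) * (norm (A v))\<^sup>2 \<le> (norm v)\<^sup>2"
proof -
  have "c\<^sup>2 * (L / real CARD('n)) * (norm (A v))\<^sup>2 = (c * L) * (c / real CARD('n) * (norm (A v))\<^sup>2)"
    by (simp add: power2_eq_square)
  also have "\<dots> \<le> 1 * (norm v)\<^sup>2"
    using cL c_A_bound c_pos n_pos L_nonneg by (intro mult_mono) auto
  finally show ?thesis by simp
qed

lemma rho_0: 
  assumes y: "y = 0"
  shows "rho 0 = (norm (A x0))\<^sup>2"
  by (simp add: rho_def r_exact[OF y] x_0)

lemma mean_norm_sq_step: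
  assumes y: "y = 0"
  shows "seq_mean (Suc k) (\<lambda>idx. (norm (x (Suc k) idx))\<^sup>2)
    \<le> seq_mean k (\<lambda>idx. (norm (x k idx))\<^sup>2) - c / real CARD('n) * seq_mean k (\<lambda>idx. (norm (r k idx))\<^sup>2) + c\<^sup>2 * (L / real CARD('n) * D k)"
proof -
  have "seq_mean (Suc k) (\<lambda>idx. (norm (x (Suc k) idx))\<^sup>2)
      \<le> seq_mean k (\<lambda>idx. (norm (T (x k idx)))\<^sup>2) + c\<^sup>2 * (L / real CARD('n) * D k)"
    using x_expansion[OF y mean_T_pow_N_bound, of k 1 0] by simp
  also have "seq_mean k (\<lambda>idx. (norm (T (x k idx)))\<^sup>2)
      \<le> seq_mean k (\<lambda>idx. (norm (x k idx))\<^sup>2 - c / real CARD('n) * (norm (r k idx))\<^sup>2)"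
    using norm_T_sq by (intro seq_mean_mono) (simp add: r_exact[OF y])
  also have "\<dots> = seq_mean k (\<lambda>idx. (norm (x k idx))\<^sup>2) - c / real CARD('n) * seq_mean k (\<lambda>idx. (norm (r k idx))\<^sup>2)"
    by (simp only: seq_mean_diff seq_mean_cmult)
  finally show ?thesis by simp
qed

text \<open>
The bounds \<open>\<gamma> m\<close>, relative to \<open>\<parallel>A d\<parallel>\<^sup>2\<close>, for the variance that the noise of a step causes in the
residual \<open>m\<close> steps later, and the requirement that their sum over an epoch is small.
\<close>
context
  fixes \<gamma> :: "nat \<Rightarrow> real"
  assumes \<gamma>: "\<And>m v. (\<Sum>i\<in>UNIV. (norm (A ((T ^^ m) (N i v))))\<^sup>2) / real CARD('n) \<le> \<gamma> m * (norm (A v))\<^sup>2"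
    and \<gamma>_nonneg: "\<And>m. 0 \<le> \<gamma> m" and \<gamma>_sum: "c\<^sup>2 * (\<Sum>m<M. \<gamma> m) \<le> 1 / 3"
begin

text \<open>
Within an epoch, \<open>A d = r - r\<^sub>K\<^sub>M\<close> consists of the mean part \<open>(U\<^sup>t - I) r\<^sub>K\<^sub>M\<close>, whose mean square is at most \<open>\<Delta>\<close>, and of
noise that is at most a third of the largest preceding \<open>D\<close>; hence \<open>D \<le> 3 / 2 \<Delta>\<close>. The decrease
of \<open>\<parallel>U\<^sup>M r\<parallel>\<^sup>2\<close> by \<open>\<Delta>\<close> then outweighs the noise at the end of the epoch.
\<close>
lemma epoch:
  fixes K :: nat
  defines "k0 \<equiv> K * M"
  defines "\<Delta> \<equiv> seq_mean k0 (\<lambda>idx. (norm (r k0 idx - (U ^^ M) (r k0 idx)))\<^sup>2)"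
  shows "t < M \<Longrightarrow> D (k0 + t) \<le> 3 / 2 * \<Delta>" "rho (Suc K) \<le> rho K - \<Delta> / 2"
proof -
  have \<Delta>_nonneg: "0 \<le> \<Delta>" unfolding \<Delta>_def by (intro seq_mean_nonneg) simp
  have noise: "c\<^sup>2 * (\<Sum>s<t. \<gamma> (t - Suc s) * D (k0 + s)) \<le> \<Delta> / 2"
    if t: "t \<le> M" and D: "\<And>s. s < t \<Longrightarrow> D (k0 + s) \<le> 3 / 2 * \<Delta>" for t
  proof -
    have "(\<Sum>s<t. \<gamma> (t - Suc s) * D (k0 + s)) \<le> (\<Sum>s<t. \<gamma> (t - Suc s) * (3 / 2 * \<Delta>))"
      by (intro sum_mono mult_left_mono D \<gamma>_nonneg) simp
    also have "\<dots> = (\<Sum>m<t. \<gamma> m) * (3 / 2 * \<Delta>)"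
      by (simp only: sum_distrib_right[symmetric] sum.nat_diff_reindex)
    also have "\<dots> \<le> (\<Sum>m<M. \<gamma> m) * (3 / 2 * \<Delta>)"
      using t \<Delta>_nonneg by (intro mult_right_mono sum_mono2 \<gamma>_nonneg) auto
    finally have "c\<^sup>2 * (\<Sum>s<t. \<gamma> (t - Suc s) * D (k0 + s)) \<le> c\<^sup>2 * ((\<Sum>m<M. \<gamma> m) * (3 / 2 * \<Delta>))"
      by (rule mult_left_mono) simp
    also have "\<dots> \<le> (1 / 3) * (3 / 2 * \<Delta>)"
      unfolding mult.assoc[symmetric] using \<gamma>_sum \<Delta>_nonneg by (intro mult_right_mono) auto
    finally show ?thesis by simp
  qed
  show D: "D (k0 + t) \<le> 3 / 2 * \<Delta>" if "t < M" for t
    using that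
  proof (induction t rule: less_induct)
    case (less t)
    have "(k0 + t) div M * M = k0" using less.prems by (simp add: k0_def)
    hence "D (k0 + t) = seq_mean (k0 + t) (\<lambda>idx. (norm (r (k0 + t) idx - r k0 idx))\<^sup>2)"
      by (simp add: D_def A_d)
    also have "\<dots> \<le> seq_mean k0 (\<lambda>idx. (norm ((U ^^ t) (r k0 idx) - r k0 idx))\<^sup>2)
      + c\<^sup>2 * (\<Sum>s<t. \<gamma> (t - Suc s) * D (k0 + s))"
      by (rule r_expansion[OF \<gamma> r_prefix])
    also have "seq_mean k0 (\<lambda>idx. (norm ((U ^^ t) (r k0 idx) - r k0 idx))\<^sup>2) \<le> \<Delta>"
      unfolding \<Delta>_def using less.prems
      by (intro seq_mean_mono power_mono) (simp_all add: U.displacement_mono norm_minus_commute)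
    also have "c\<^sup>2 * (\<Sum>s<t. \<gamma> (t - Suc s) * D (k0 + s)) \<le> \<Delta> / 2"
      using less by (intro noise) auto
    finally show ?case by simp
  qed
  have "rho (Suc K) = seq_mean (k0 + M) (\<lambda>idx. (norm (r (k0 + M) idx - 0))\<^sup>2)"
    by (simp add: rho_def k0_def add.commute)
  also have "\<dots> \<le> seq_mean k0 (\<lambda>idx. (norm ((U ^^ M) (r k0 idx) - 0))\<^sup>2)
      + c\<^sup>2 * (\<Sum>s<M. \<gamma> (M - Suc s) * D (k0 + s))"
    by (rule r_expansion[OF \<gamma>]) (simp add: depends_on_prefix_def)
  also have "seq_mean k0 (\<lambda>idx. (norm ((U ^^ M) (r k0 idx) - 0))\<^sup>2)
      \<le> seq_mean k0 (\<lambda>idx. (norm (r k0 idx))\<^sup>2 - (norm (r k0 idx - (U ^^ M) (r k0 idx)))\<^sup>2)"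
    using U.pythagoras_le[of M] by (intro seq_mean_mono) (simp add: le_diff_eq)
  also have "\<dots> = rho K - \<Delta>"
    by (simp only: seq_mean_diff rho_def \<Delta>_def k0_def)
  also have "c\<^sup>2 * (\<Sum>s<M. \<gamma> (M - Suc s) * D (k0 + s)) \<le> \<Delta> / 2"
    using D by (intro noise) auto
  finally show "rho (Suc K) \<le> rho K - \<Delta> / 2" by simp
qed

lemma rho_decreasing: "K \<le> K' \<Longrightarrow> rho K' \<le> rho K"
proof (rule lift_Suc_antimono_le)
  fix K
  have "0 \<le> seq_mean (K * M) (\<lambda>idx. (norm (r (K * M) idx - (U ^^ M) (r (K * M) idx)))\<^sup>2)"
    by (intro seq_mean_nonneg) simp
  thus "rho (Suc K) \<le> rho K" using epoch(2)[of K] by linarith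
qed

lemma sum_D_epochs: "(\<Sum>s<j * M. D (K * M + s)) \<le> 3 * real M * (rho K - rho (K + j))"
proof (induction j)
  case (Suc j)
  define \<Delta> where "\<Delta> = seq_mean ((K + j) * M) (\<lambda>idx. (norm (r ((K + j) * M) idx - (U ^^ M) (r ((K + j) * M) idx)))\<^sup>2)"
  have "(\<Sum>s<Suc j * M. D (K * M + s)) = (\<Sum>s<j * M. D (K * M + s)) + (\<Sum>s<M. D ((K + j) * M + s))"
    using sum_lessThan_add[of "\<lambda>s. D (K * M + s)" "j * M" M] by (simp add: algebra_simps)
  also have "(\<Sum>s<M. D ((K + j) * M + s)) \<le> (\<Sum>s<M. 3 / 2 * \<Delta>)"
    unfolding \<Delta>_def by (intro sum_mono epoch(1)) simp
  also have "\<dots> = 3 * real M * (\<Delta> / 2)" by simp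
  also have "\<dots> \<le> 3 * real M * (rho (K + j) - rho (K + Suc j))"
    using epoch(2)[of "K + j"] by (intro mult_left_mono) (simp_all add: \<Delta>_def)
  finally show ?case using Suc by (simp add: right_diff_distrib)
qed simp

lemma sum_D: "(\<Sum>s<t. D (K * M + s)) \<le> 3 * real M * rho K"
proof -
  have "(\<Sum>s<t. D (K * M + s)) \<le> (\<Sum>s<t * M. D (K * M + s))"
    using M_pos by (intro sum_mono2 D_nonneg) (auto intro: order_less_le_trans)
  also note sum_D_epochs
  also have "3 * real M * (rho K - rho (K + t)) \<le> 3 * real M * rho K"
    using rho_nonneg by (intro mult_left_mono) auto
  finally show ?thesis .
qed

text \<open>
\<open>rho\<close> is decreasing, and by the energy inequality for \<open>T\<close> and the summability of \<open>D\<close> it is summable.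
\<close>
lemma rho_rate:
  assumes y: "y = 0"
  shows "real K * rho K \<le> real CARD('n) / c * (1 + 3 * real M) * (norm x0)\<^sup>2"
proof -
  define R where "R k = seq_mean k (\<lambda>idx. (norm (r k idx))\<^sup>2)" for k
  have R_nonneg: "0 \<le> R k" for k unfolding R_def by (intro seq_mean_nonneg) simp
  have energy: "c / real CARD('n) * (\<Sum>k<t. R k) \<le> (norm x0)\<^sup>2 - seq_mean t (\<lambda>idx. (norm (x t idx))\<^sup>2) + c\<^sup>2 * (L / real CARD('n)) * (\<Sum>s<t. D s)" for t
  proof (induction t)
    case (Suc t)
    thus ?case using mean_norm_sq_step[OF y, of t] by (simp add: R_def distrib_left)
  qed (simp add: x_0)
  have "real K * rho K = (\<Sum>j<K. rho K)" by simp
  also have "\<dots> \<le> (\<Sum>j<K. rho j)" by (intro sum_mono rho_decreasing) simp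
  also have "\<dots> = (\<Sum>k\<in>(\<lambda>j. j * M) ` {..<K}. R k)"
    using M_pos by (subst sum.reindex) (auto simp: inj_on_def rho_def R_def)
  also have "\<dots> \<le> (\<Sum>k<K * M. R k)"
    using M_pos by (intro sum_mono2 R_nonneg) auto
  finally have "c / real CARD('n) * (real K * rho K) \<le> c / real CARD('n) * (\<Sum>k<K * M. R k)"
    using c_pos by (intro mult_left_mono) auto
  also have "\<dots> \<le> (norm x0)\<^sup>2 + c\<^sup>2 * (L / real CARD('n)) * (\<Sum>s<K * M. D s)"
    using energy[of "K * M"] seq_mean_nonneg[of "\<lambda>idx. (norm (x (K * M) idx))\<^sup>2" "K * M"] by simp
  also have "\<dots> \<le> (norm x0)\<^sup>2 + c\<^sup>2 * (L / real CARD('n)) * (3 * real M * (norm (A x0))\<^sup>2)"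
    using sum_D[of 0 "K * M"] L_nonneg by (intro add_left_mono mult_left_mono) (simp_all add: rho_0[OF y])
  also have "\<dots> = (norm x0)\<^sup>2 + 3 * real M * (c\<^sup>2 * (L / real CARD('n)) * (norm (A x0))\<^sup>2)" by simp
  also have "\<dots> \<le> (norm x0)\<^sup>2 + 3 * real M * (norm x0)\<^sup>2"
    by (intro add_left_mono mult_left_mono noise_energy_bound) simp
  finally show ?thesis using c_pos n_pos by (simp add: field_simps)
qed

text \<open>
The noise of the first \<open>K\<close> epochs has been damped by \<open>T\<^sup>m\<close>. The later noise has total mean square at most
of the order of \<open>rho K\<close>.
\<close>
lemma mean_error_exact:
  assumes y: "y = 0" and K: "0 < K"
  shows "seq_mean (K * M + m) (\<lambda>idx. (norm (x (K * M + m) idx))\<^sup>2)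
    \<le> (norm ((T ^^ (K * M + m)) x0))\<^sup>2
      + 3 * real M * real CARD('n) * (norm x0)\<^sup>2 / real (m + 1)
      + 3 * real M * (1 + 3 * real M) * (norm x0)\<^sup>2 / real K"
proof -
  have le: "1 / (c * real (2 * (m + l) + 1)) \<le> 1 / (c * real (m + 1))" for l
    using c_pos by (intro divide_left_mono mult_left_mono) auto
  have scale': "c\<^sup>2 * (L / real CARD('n)) * (p * (real CARD('n) / c * q * b / k)) = (c * L) * (p * q * b / k)"
    for p q b k using c_pos n_pos by (simp add: power2_eq_square)
  have rho_K: "rho K \<le> real CARD('n) / c * (1 + 3 * real M) * (norm x0)\<^sup>2 / real K"
    using rho_rate[OF y, of K] K by (subst pos_le_divide_eq) (simp_all add: mult.commute)
  have scale: "c\<^sup>2 * (1 / (c * q) * (3 * real M * b)) = 3 * real M * real CARD('n) / q * (c / real CARD('n) * b)"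
    for q b using c_pos n_pos by (simp add: field_simps power2_eq_square)
  have "seq_mean (K * M + m) (\<lambda>idx. (norm (x (K * M + m) idx))\<^sup>2)
      \<le> seq_mean (K * M) (\<lambda>idx. (norm ((T ^^ m) (x (K * M) idx)))\<^sup>2)
        + c\<^sup>2 * (L / real CARD('n)) * (\<Sum>s<m. D (K * M + s))"
    using x_expansion[OF y mean_T_pow_N_bound, of "K * M" m 0] by (simp add: sum_distrib_left mult.assoc)
  also have "seq_mean (K * M) (\<lambda>idx. (norm ((T ^^ m) (x (K * M) idx)))\<^sup>2)
      \<le> (norm ((T ^^ (K * M + m)) x0))\<^sup>2
        + c\<^sup>2 * (\<Sum>s<K * M. 1 / (c * real (2 * (m + (K * M - Suc s)) + 1)) * D s)"
    using x_expansion[OF y mean_T_pow_N_decay, of 0 "K * M" m] by (simp add: x_0 add.commute)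
  also have "(\<Sum>s<K * M. 1 / (c * real (2 * (m + (K * M - Suc s)) + 1)) * D s) \<le> (\<Sum>s<K * M. 1 / (c * real (m + 1)) * D s)"
    by (intro sum_mono mult_right_mono D_nonneg le)
  also have "\<dots> = 1 / (c * real (m + 1)) * (\<Sum>s<K * M. D s)" by (simp add: sum_distrib_left)
  also have "\<dots> \<le> 1 / (c * real (m + 1)) * (3 * real M * (norm (A x0))\<^sup>2)"
    using sum_D[of 0 "K * M"] c_pos by (intro mult_left_mono) (simp_all add: rho_0[OF y])
  also have "c\<^sup>2 * (1 / (c * real (m + 1)) * (3 * real M * (norm (A x0))\<^sup>2))
      = 3 * real M * real CARD('n) / real (m + 1) * (c / real CARD('n) * (norm (A x0))\<^sup>2)"
    by (rule scale)
  also have "\<dots> \<le> 3 * real M * real CARD('n) / real (m + 1) * (norm x0)\<^sup>2"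
    by (intro mult_left_mono c_A_bound) simp
  also have "c\<^sup>2 * (L / real CARD('n)) * (\<Sum>s<m. D (K * M + s)) \<le> c\<^sup>2 * (L / real CARD('n)) * (3 * real M * rho K)"
    using L_nonneg by (intro mult_left_mono sum_D) simp
  also have "\<dots> \<le> c\<^sup>2 * (L / real CARD('n)) * (3 * real M * (real CARD('n) / c * (1 + 3 * real M) * (norm x0)\<^sup>2 / real K))"
    using L_nonneg by (intro mult_left_mono rho_K) simp_all
  also have "\<dots> = (c * L) * (3 * real M * (1 + 3 * real M) * (norm x0)\<^sup>2 / real K)"
    by (rule scale')
  also have "\<dots> \<le> 1 * (3 * real M * (1 + 3 * real M) * (norm x0)\<^sup>2 / real K)"
    using cL by (intro mult_right_mono) auto
  finally show ?thesis using c_pos by (simp add: mult_left_mono)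
qed

text \<open>
From a zero start, the mean iteration is Landweber iteration with data \<open>y\<close>, whose squared norm grows by at most
\<open>(c / n) \<parallel>y\<parallel>\<^sup>2\<close> in a step, and the variance stays bounded because the initial residual is \<open>- y\<close>.
\<close>
lemma mean_error_noise:
  assumes x0: "x0 = 0"
  shows "seq_mean k (\<lambda>idx. (norm (x k idx))\<^sup>2) \<le> c / real CARD('n) * (real k + 3 * real M) * (norm y)\<^sup>2"
proof -
  have x_start: "x 0 idx = 0" for idx by (metis x_0 x0)
  define S where "S v = T v + (c / real CARD('n)) *\<^sub>R As y" for v
  have pow: "(S ^^ m) (u - v) = (S ^^ m) u - (T ^^ m) v" for m u v
    by (induction m) (simp_all add: S_def linear_diff[OF T.lin])
  have "(S ^^ m) (x (Suc k) idx) = (S ^^ Suc m) (x k idx) - c *\<^sub>R (T ^^ m) (N (idx k) (d k idx))" for m k idx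
    using linear_scale[OF T.linear_pow[of m]]
    by (simp add: x_Suc_noise S_def[symmetric] pow funpow_swap1)
  moreover have "depends_on_prefix 0 (\<lambda>_. 0 :: 'a)" by (simp add: depends_on_prefix_def)
  ultimately have "seq_mean k (\<lambda>idx. (norm (x k idx))\<^sup>2)
     \<le> (norm ((S ^^ k) 0))\<^sup>2 + c\<^sup>2 * (L / real CARD('n)) * (\<Sum>s<k. D s)"
    using mean_expansion[of S x "\<lambda>m. T ^^ m" "\<lambda>_. L / real CARD('n)" 0 "\<lambda>_. 0" k 0] mean_T_pow_N_bound x_prefix T.linear_pow
    by (simp add: x_start sum_distrib_left mult.assoc)
  also have "(norm ((S ^^ k) 0))\<^sup>2 \<le> c / real CARD('n) * real k * (norm y)\<^sup>2"
  proof (induction k)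
    case (Suc k)
    define m where "m = (S ^^ k) 0"
    define s where "s = A m - y"
    have "S m = m - (c / real CARD('n)) *\<^sub>R As s"
      by (simp add: S_def T_def B_def s_def As.diff algebra_simps)
    hence "(norm (S m))\<^sup>2 = (norm m)\<^sup>2 - 2 * (c / real CARD('n)) * (m \<bullet> As s) + (c / real CARD('n))\<^sup>2 * (norm (As s))\<^sup>2"
      by (simp add: norm_diff_sq power_mult_distrib power_divide)
    also have "m \<bullet> As s = (norm s)\<^sup>2 + y \<bullet> s"
      unfolding inner_As[symmetric] by (simp add: s_def power2_norm_eq_inner inner_diff_left)
    also have "(c / real CARD('n))\<^sup>2 * (norm (As s))\<^sup>2 = (c / real CARD('n)) * (c / real CARD('n) * (norm (As s))\<^sup>2)"
      by (simp add: power2_eq_square)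
    also have "\<dots> \<le> (c / real CARD('n)) * (norm s)\<^sup>2"
      using c_pos by (intro mult_left_mono c_As_bound) auto
    also have "(norm m)\<^sup>2 - 2 * (c / real CARD('n)) * ((norm s)\<^sup>2 + y \<bullet> s) + (c / real CARD('n)) * (norm s)\<^sup>2
        = (norm m)\<^sup>2 + (c / real CARD('n)) * ((norm y)\<^sup>2 - (norm (s + y))\<^sup>2)"
      by (simp add: norm_add_sq inner_commute algebra_simps)
    also have "\<dots> \<le> (norm m)\<^sup>2 + (c / real CARD('n)) * (norm y)\<^sup>2"
      using c_pos by (intro add_left_mono mult_left_mono) auto
    finally show ?case using Suc by (simp add: m_def algebra_simps add_divide_distrib)
  qed simp
  also have "c\<^sup>2 * (L / real CARD('n)) * (\<Sum>s<k. D s) \<le> c\<^sup>2 * (L / real CARD('n)) * (3 * real M * (norm y)\<^sup>2)"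
    using sum_D[of 0 k] L_nonneg by (intro mult_left_mono) (simp_all add: rho_def r_def x_start A.zero)
  also have "\<dots> = (c * L) * (c / real CARD('n) * (3 * real M) * (norm y)\<^sup>2)"
    by (simp add: power2_eq_square)
  also have "\<dots> \<le> 1 * (c / real CARD('n) * (3 * real M) * (norm y)\<^sup>2)"
    using cL c_pos by (intro mult_right_mono) auto
  finally show ?thesis by (simp add: algebra_simps add_divide_distrib)
qed

end
end

section \<open>Pathwise analysis of the iteration\<close>

context svrg_process
begin

lemma Ais_step_nonexpansive: "norm (u - c *\<^sub>R Ais i (A u $ i)) \<le> norm u"
proof -
  have "(norm (u - c *\<^sub>R Ais i (A u $ i)))\<^sup>2
      = (norm u)\<^sup>2 - 2 * c * (norm (A u $ i))\<^sup>2 + c * (c * (norm (Ais i (A u $ i)))\<^sup>2)"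
    by (simp add: norm_diff_sq power_mult_distrib power2_eq_square[of c] inner_Ais[symmetric] power2_norm_eq_inner[of "A u $ i"])
  also have "c * (c * (norm (Ais i (A u $ i)))\<^sup>2) \<le> c * (c * (L * (norm (A u $ i))\<^sup>2))"
    using c_pos by (intro mult_left_mono Ais_bound) auto
  also have "\<dots> = c * (c * L) * (norm (A u $ i))\<^sup>2" by simp
  also have "\<dots> \<le> c * 1 * (norm (A u $ i))\<^sup>2"
    using cL c_pos by (intro mult_right_mono mult_left_mono) auto
  finally have "(norm (u - c *\<^sub>R Ais i (A u $ i)))\<^sup>2 \<le> (norm u)\<^sup>2 - c * (norm (A u $ i))\<^sup>2" by simp
  also have "\<dots> \<le> (norm u)\<^sup>2" using c_pos by simp
  finally show ?thesis by (rule power2_le_imp_le) simp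
qed

lemma epoch_step:
  assumes "t < M"
  shows "x (K * M + Suc t) idx - x (K * M) idx
    = (x (K * M + t) idx - x (K * M) idx)
      - c *\<^sub>R (Ais (idx (K * M + t)) (A (x (K * M + t) idx - x (K * M) idx) $ idx (K * M + t))
               + (1 / real CARD('n)) *\<^sub>R As (r (K * M) idx))"
proof -
  have "(K * M + t) div M = K" using assms by simp
  thus ?thesis using x_Suc[of "K * M + t" idx] by (simp add: d_def)
qed

lemma A_component_norm: "norm (A u $ i) \<le> sqrt L * norm u"
proof (rule power2_le_imp_le)
  show "(norm (A u $ i))\<^sup>2 \<le> (sqrt L * norm u)\<^sup>2"
    using L_bound[of u i] by (simp add: power_mult_distrib L_nonneg)
qed (simp add: L_nonneg)

text \<open>
For pathwise bounds the whole displacement within an epoch must be small, which costs a factor \<open>M\<close> in the step size. Here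
\<open>a\<close> is a bound for the operator norm of \<open>A\<close>.
\<close>
context
  fixes a :: real
  assumes a: "\<And>u. norm (A u) \<le> a * norm u" "0 \<le> a" "a \<le> real CARD('n) * sqrt L"
    and small: "c * real M * sqrt L * a \<le> 1 / 4"
begin

lemma As_norm: "norm (As v) \<le> a * norm v"
proof (rule power2_le_imp_le)
  show "(norm (As v))\<^sup>2 \<le> (a * norm v)\<^sup>2"
    unfolding As_def power_mult_distrib
  proof (rule adjoint_norm_bound[OF A])
    show "(norm (A u))\<^sup>2 \<le> a\<^sup>2 * (norm u)\<^sup>2" for u
      using power_mono[OF a(1) norm_ge_zero, of u 2] by (simp only: power_mult_distrib)
  qed (rule zero_le_power2)
qed (rule mult_nonneg_nonneg[OF a(2) norm_ge_zero])

context
  fixes K :: nat and idx :: "nat \<Rightarrow> 'n"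
begin

text \<open>
The anchor of the \<open>K\<close>-th epoch, its residual, and the displacement after \<open>t\<close> further steps.
\<close>
abbreviation (input) "z \<equiv> x (K * M) idx"
abbreviation (input) "res \<equiv> r (K * M) idx"
abbreviation (input) "dd t \<equiv> x (K * M + t) idx - x (K * M) idx"

lemma epoch_displacement:
  assumes "t \<le> M"
  shows "norm (dd t) \<le> c * real t * (a / real CARD('n) * norm res)"
  using assms
proof (induction t)
  case (Suc t)
  have "dd (Suc t) = (dd t - c *\<^sub>R Ais (idx (K * M + t)) (A (dd t) $ idx (K * M + t))) - (c / real CARD('n)) *\<^sub>R As res"
    using epoch_step[of t K idx] Suc.prems by (simp add: scaleR_add_right)
  also have "norm \<dots> \<le> norm (dd t) + norm ((c / real CARD('n)) *\<^sub>R As res)"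
    using Ais_step_nonexpansive[of "dd t"] by (intro order_trans[OF norm_triangle_ineq4]) simp
  also have "norm ((c / real CARD('n)) *\<^sub>R As res) \<le> c / real CARD('n) * (a * norm res)"
    using c_pos As_norm[of res] by (simp add: mult_left_mono divide_right_mono)
  finally show ?case using Suc by (simp add: algebra_simps add_divide_distrib)
qed simp

lemma epoch_displacement_component:
  assumes "t \<le> M"
  shows "norm (A (dd t) $ i) \<le> norm res / (4 * real CARD('n))"
proof -
  have "norm (A (dd t) $ i) \<le> sqrt L * norm (dd t)" by (rule A_component_norm)
  also have "\<dots> \<le> sqrt L * (c * real t * (a / real CARD('n) * norm res))"
    by (intro mult_left_mono epoch_displacement assms) (simp add: L_nonneg)
  also have "\<dots> \<le> sqrt L * (c * real M * (a / real CARD('n) * norm res))"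
    using assms c_pos a L_nonneg by (intro mult_left_mono mult_right_mono) auto
  also have "\<dots> = (c * real M * sqrt L * a) * (norm res / real CARD('n))" by simp
  also have "\<dots> \<le> 1 / 4 * (norm res / real CARD('n))" by (intro mult_right_mono small) simp
  finally show ?thesis by simp
qed

lemma epoch_inner:
  assumes "t \<le> M"
  shows "z \<bullet> dd t \<le> c * real t / real CARD('n) * (norm (A z) * norm res / 4 - A z \<bullet> res)"
  using assms
proof (induction t)
  case (Suc t)
  let ?i = "idx (K * M + t)"
  have "z \<bullet> dd (Suc t) = z \<bullet> dd t - c * ((A z $ ?i) \<bullet> (A (dd t) $ ?i)) - c / real CARD('n) * (A z \<bullet> res)"
    using Suc.prems unfolding epoch_step[OF Suc_le_lessD[OF Suc.prems], of K idx]
    by (simp add: inner_diff_right[of _ "_ - _"] inner_add_right inner_Ais[symmetric] inner_As[symmetric] algebra_simps)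
  moreover have "- ((A z $ ?i) \<bullet> (A (dd t) $ ?i)) \<le> norm (A z) * (norm res / (4 * real CARD('n)))"
  proof -
    have "- ((A z $ ?i) \<bullet> (A (dd t) $ ?i)) \<le> norm (A z $ ?i) * norm (A (dd t) $ ?i)"
      using Cauchy_Schwarz_ineq2[of "A z $ ?i" "A (dd t) $ ?i"] by linarith
    also have "\<dots> \<le> norm (A z) * (norm res / (4 * real CARD('n)))"
      using Suc.prems by (intro mult_mono norm_component_le epoch_displacement_component) auto
    finally show ?thesis .
  qed
  hence "c * - ((A z $ ?i) \<bullet> (A (dd t) $ ?i)) \<le> c * (norm (A z) * (norm res / (4 * real CARD('n))))"
    using c_pos by (intro mult_left_mono) auto
  ultimately show ?case using Suc by (simp add: algebra_simps add_divide_distrib diff_divide_distrib)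
qed simp

text \<open>
If the displacement were exactly \<open>- (c t / n) A\<^sup>* res\<close>, then the linear term of \<open>\<parallel>z + dd t\<parallel>\<^sup>2\<close> would be
\<open>- (2 c t / n) \<langle>A z, res\<rangle>\<close>. The correction involves \<open>\<langle>A\<^sub>i z, A\<^sub>i d\<rangle>\<close> with \<open>\<parallel>A\<^sub>i z\<parallel> \<le> \<parallel>A z\<parallel>\<close> and
\<open>\<parallel>A\<^sub>i d\<parallel> \<le> \<parallel>res\<parallel> / (4 n)\<close>, and is therefore absorbed.
\<close>
lemma epoch_energy:
  assumes t: "t \<le> M"
  shows "(norm (x (K * M + t) idx))\<^sup>2
     \<le> (norm z)\<^sup>2 - c * real t / (4 * real CARD('n)) * (norm res)\<^sup>2 + 2 * c * real t / real CARD('n) * (norm y)\<^sup>2"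
proof -
  define q where "q = c * real t / real CARD('n)"
  have q: "0 \<le> q" using c_pos by (simp add: q_def)
  have "(norm (dd t))\<^sup>2 \<le> (c * real t * (a / real CARD('n) * norm res)) * (c * real M * (a / real CARD('n) * norm res))"
    unfolding power2_eq_square
    using epoch_displacement[OF t] t c_pos a
    by (intro mult_mono order_trans[OF epoch_displacement[OF t]] mult_right_mono mult_left_mono) auto
  also have "\<dots> = q * (norm res)\<^sup>2 * ((c * real M * a) * (a / real CARD('n)))"
    by (simp add: q_def power2_eq_square)
  also have "\<dots> \<le> q * (norm res)\<^sup>2 * ((c * real M * a) * sqrt L)"
    using a c_pos n_pos q by (intro mult_left_mono) (auto simp: field_simps)
  also have "\<dots> \<le> q * (norm res)\<^sup>2 * (1 / 4)"
    using small q by (intro mult_left_mono) (auto simp: mult_ac)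
  finally have d2: "(norm (dd t))\<^sup>2 \<le> q * ((norm res)\<^sup>2 / 4)" by simp
  have "2 * (z \<bullet> dd t) \<le> q * (norm (A z) * norm res / 2 - 2 * (A z \<bullet> res))"
    using epoch_inner[OF t] by (simp add: q_def algebra_simps)
  moreover have "(norm (x (K * M + t) idx))\<^sup>2 = (norm z)\<^sup>2 + 2 * (z \<bullet> dd t) + (norm (dd t))\<^sup>2"
    using norm_add_sq[of z "dd t"] by simp
  ultimately have main: "(norm (x (K * M + t) idx))\<^sup>2
      \<le> (norm z)\<^sup>2 + q * (norm (A z) * norm res / 2 - 2 * (A z \<bullet> res) + (norm res)\<^sup>2 / 4)"
    using d2 by (simp add: algebra_simps)
  have Az: "A z = res + y" by (simp add: r_def)
  have "norm (A z) * norm res \<le> (norm res + norm y) * norm res"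
    unfolding Az by (intro mult_right_mono norm_triangle_ineq) simp
  hence "norm (A z) * norm res \<le> (norm res)\<^sup>2 + norm y * norm res"
    by (simp add: power2_eq_square distrib_right)
  moreover have "A z \<bullet> res \<ge> (norm res)\<^sup>2 - norm y * norm res"
    unfolding Az using Cauchy_Schwarz_ineq2[of y res]
    by (simp add: inner_add_left power2_norm_eq_inner abs_le_iff)
  moreover have "(norm res - 5 / 4 * norm y)\<^sup>2 = (norm res)\<^sup>2 - 5 / 2 * (norm y * norm res) + 25 / 16 * (norm y)\<^sup>2"
    by (simp add: power2_eq_square algebra_simps)
  ultimately have "norm (A z) * norm res / 2 - 2 * (A z \<bullet> res) + (norm res)\<^sup>2 / 4
      \<le> - ((norm res)\<^sup>2 / 4) + 2 * (norm y)\<^sup>2"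
    using zero_le_power2[of "norm y"] zero_le_power2[of "norm res - 5 / 4 * norm y"] by linarith
  hence "q * (norm (A z) * norm res / 2 - 2 * (A z \<bullet> res) + (norm res)\<^sup>2 / 4)
      \<le> q * (- ((norm res)\<^sup>2 / 4) + 2 * (norm y)\<^sup>2)"
    using q by (rule mult_left_mono)
  with main show ?thesis by (simp add: q_def algebra_simps)
qed

text \<open>
The displacement lies in the range of the adjoint, with a preimage controlled by the residual.
\<close>
lemma epoch_dual:
  assumes "t \<le> M" "y = 0"
  shows "\<exists>u. dd t = As u \<and> norm u \<le> c * real t * (5 / (4 * real CARD('n))) * norm res"
  using assms(1)
proof (induction t)
  case 0
  show ?case by (intro exI[of _ 0]) (simp add: As.zero)
next
  case (Suc t)
  let ?i = "idx (K * M + t)"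
  obtain u where u: "dd t = As u" "norm u \<le> c * real t * (5 / (4 * real CARD('n))) * norm res"
    using Suc by auto
  define e where "e = (\<chi> j. if j = ?i then A (dd t) $ ?i else 0)"
  have As_e: "As e = Ais ?i (A (dd t) $ ?i)"
  proof -
    have "As e = (\<Sum>j\<in>UNIV. if j = ?i then Ais ?i (A (dd t) $ ?i) else 0)"
      unfolding As_eq_sum by (intro sum.cong) (auto simp: e_def linear_0[OF linear_Ais])
    thus ?thesis by simp
  qed
  have "(norm e)\<^sup>2 = (\<Sum>j\<in>UNIV. if j = ?i then (norm (A (dd t) $ ?i))\<^sup>2 else 0)"
    unfolding norm_vec_sq by (intro sum.cong) (auto simp: e_def)
  hence norm_e: "norm e = norm (A (dd t) $ ?i)" by simp
  define u' where "u' = u - c *\<^sub>R (e + (1 / real CARD('n)) *\<^sub>R res)"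
  have "dd (Suc t) = As u'"
    using epoch_step[of t K idx] Suc.prems
    by (simp add: u'_def As.diff As.scaleR As.add As_e u(1))
  moreover have "norm u' \<le> c * real (Suc t) * (5 / (4 * real CARD('n))) * norm res"
  proof -
    have "norm u' \<le> norm u + norm (c *\<^sub>R (e + (1 / real CARD('n)) *\<^sub>R res))"
      unfolding u'_def by (rule norm_triangle_ineq4)
    also have "\<dots> \<le> norm u + c * (norm e + norm res / real CARD('n))"
      using c_pos norm_triangle_ineq[of e "(1 / real CARD('n)) *\<^sub>R res"] by simp
    also have "\<dots> \<le> norm u + c * (norm res / (4 * real CARD('n)) + norm res / real CARD('n))"
      using c_pos Suc.prems epoch_displacement_component[of t ?i] norm_e
      by (intro add_left_mono mult_left_mono add_right_mono) auto
    also have "\<dots> = norm u + c * (5 / (4 * real CARD('n))) * norm res" by simp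
    finally show ?thesis using u(2) by (simp add: algebra_simps add_divide_distrib)
  qed
  ultimately show ?case by blast
qed

end

lemma pathwise_norm_sq_bound: "(norm (x k idx))\<^sup>2 \<le> (norm x0)\<^sup>2 + 2 * c * real k / real CARD('n) * (norm y)\<^sup>2"
proof -
  have step: "(norm (x (K * M + t) idx))\<^sup>2 \<le> (norm (x (K * M) idx))\<^sup>2 + 2 * c * real t / real CARD('n) * (norm y)\<^sup>2"
    if "t \<le> M" for K t
  proof -
    have "0 \<le> c * real t / (4 * real CARD('n)) * (norm (r (K * M) idx))\<^sup>2" using c_pos by simp
    thus ?thesis using epoch_energy[OF that, of K idx] by linarith
  qed
  have epochs: "(norm (x (K * M) idx))\<^sup>2 \<le> (norm x0)\<^sup>2 + 2 * c * real (K * M) / real CARD('n) * (norm y)\<^sup>2" for K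
  proof (induction K)
    case (Suc K)
    thus ?case using step[of M K] by (simp add: algebra_simps add_divide_distrib)
  qed (simp add: x_0)
  have "(norm (x k idx))\<^sup>2 = (norm (x (k div M * M + k mod M) idx))\<^sup>2" by simp
  also have "\<dots> \<le> (norm (x (k div M * M) idx))\<^sup>2 + 2 * c * real (k mod M) / real CARD('n) * (norm y)\<^sup>2"
    using M_pos by (intro step) (simp add: less_imp_le)
  also have "\<dots> \<le> (norm x0)\<^sup>2 + 2 * c * (real (k div M * M) + real (k mod M)) / real CARD('n) * (norm y)\<^sup>2"
    using epochs[of "k div M"] by (simp add: algebra_simps add_divide_distrib)
  also have "real (k div M * M) + real (k mod M) = real k"
    unfolding of_nat_add[symmetric] by simp
  finally show ?thesis .
qed

text \<open>
The premise on \<open>p\<close> says that a square-summable sequence \<open>s\<close> with the given bound cannot keep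
\<open>s\<^sub>K (W + C \<Sum>\<^sub>j\<^sub><\<^sub>K s\<^sub>j)\<close> above \<open>\<epsilon>\<^sup>2\<close> for \<open>p\<close> epochs. Such a \<open>p\<close> does not depend on the operator or the indices.
\<close>
lemma pathwise_exact:
  assumes y: "y = 0" and w: "x0 = As w" "norm w \<le> W" and E: "(norm x0)\<^sup>2 \<le> E" and "0 < \<epsilon>"
    and p: "\<And>s. (\<And>K. 0 \<le> s K) \<Longrightarrow> (\<Sum>K<p. (s K)\<^sup>2) \<le> 4 * real CARD('n) / (c * real M) * E \<Longrightarrow>
       \<exists>K<p. s K * (W + 5 * c * real M / (4 * real CARD('n)) * (\<Sum>j<K. s j)) < \<epsilon>\<^sup>2"
    and k: "p * M \<le> k"
  shows "norm (x k idx) < \<epsilon>"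
proof -
  define s where "s K = norm (A (x (K * M) idx))" for K
  have r: "r j idx = A (x j idx)" for j by (rule r_exact[OF y])
  have y0: "norm y = 0" by (metis norm_zero y)
  have energy: "(norm (x (K * M + t) idx))\<^sup>2 \<le> (norm (x (K * M) idx))\<^sup>2 - c * real t / (4 * real CARD('n)) * (s K)\<^sup>2"
    if "t \<le> M" for K t
    using epoch_energy[OF that, of K idx] by (simp add: r y0 s_def)
  have dec: "norm (x (K * M + t) idx) \<le> norm (x (K * M) idx)" if "t \<le> M" for K t
  proof (rule power2_le_imp_le)
    have "0 \<le> c * real t / (4 * real CARD('n)) * (s K)\<^sup>2" using c_pos by simp
    thus "(norm (x (K * M + t) idx))\<^sup>2 \<le> (norm (x (K * M) idx))\<^sup>2" using energy[OF that, of K] by linarith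
  qed simp
  have "c * real M / (4 * real CARD('n)) * (\<Sum>K<n. (s K)\<^sup>2) \<le> (norm x0)\<^sup>2 - (norm (x (n * M) idx))\<^sup>2" for n
  proof (induction n)
    case (Suc n)
    thus ?case using energy[of M n] by (simp add: distrib_left add.commute)
  qed (simp add: x_0)
  hence "c * real M / (4 * real CARD('n)) * (\<Sum>K<p. (s K)\<^sup>2) \<le> E"
    using E by (smt (verit) zero_le_power2)
  hence "(\<Sum>K<p. (s K)\<^sup>2) \<le> 4 * real CARD('n) / (c * real M) * E"
    using c_pos M_pos by (simp add: field_simps)
  moreover have "0 \<le> s K" for K by (simp add: s_def)
  ultimately obtain K where K: "K < p" "s K * (W + 5 * c * real M / (4 * real CARD('n)) * (\<Sum>j<K. s j)) < \<epsilon>\<^sup>2"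
    using p by blast
  have dual: "\<exists>u. x (K * M) idx = As u \<and> norm u \<le> W + 5 * c * real M / (4 * real CARD('n)) * (\<Sum>j<K. s j)" for K
  proof (induction K)
    case 0
    have "x (0 * M) idx = As w" by (metis mult_0 x_0 w(1))
    thus ?case using w(2) by (intro exI[of _ w]) simp
  next
    case (Suc K)
    then obtain u where u: "x (K * M) idx = As u" "norm u \<le> W + 5 * c * real M / (4 * real CARD('n)) * (\<Sum>j<K. s j)"
      by blast
    obtain v where v: "x (K * M + M) idx - x (K * M) idx = As v"
        "norm v \<le> c * real M * (5 / (4 * real CARD('n))) * norm (r (K * M) idx)"
      using epoch_dual[of M K idx] y by blast
    have "x (Suc K * M) idx = As (u + v)"
      using u(1) v(1) by (simp add: As.add add.commute algebra_simps)
    moreover have "norm (u + v) \<le> W + 5 * c * real M / (4 * real CARD('n)) * (\<Sum>j<Suc K. s j)"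
      using norm_triangle_ineq[of u v] u(2) v(2) by (simp add: r s_def distrib_left)
    ultimately show ?case by blast
  qed
  obtain u where u: "x (K * M) idx = As u" "norm u \<le> W + 5 * c * real M / (4 * real CARD('n)) * (\<Sum>j<K. s j)"
    using dual by blast
  have "(norm (x (K * M) idx))\<^sup>2 = A (x (K * M) idx) \<bullet> u"
    by (simp add: inner_As power2_norm_eq_inner flip: u(1))
  also have "\<dots> \<le> s K * norm u" unfolding s_def by (rule norm_cauchy_schwarz)
  also have "\<dots> \<le> s K * (W + 5 * c * real M / (4 * real CARD('n)) * (\<Sum>j<K. s j))"
    by (intro mult_left_mono u(2)) (simp add: s_def)
  also note K(2)
  finally have K_small: "norm (x (K * M) idx) < \<epsilon>"
    using \<open>0 < \<epsilon>\<close> by (simp add: power2_less_imp_less)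
  have mono: "norm (x (K' * M) idx) \<le> norm (x (K * M) idx)" if "K \<le> K'" for K'
    using that
  proof (induction K' rule: dec_induct)
    case (step K')
    thus ?case using dec[of M K'] by (simp add: add.commute)
  qed simp
  have "K \<le> k div M"
    using K(1) k M_pos by (metis div_le_mono div_mult_self_is_m less_imp_le order_trans)
  have "norm (x k idx) = norm (x (k div M * M + k mod M) idx)" by simp
  also have "\<dots> \<le> norm (x (k div M * M) idx)" using M_pos by (intro dec) (simp add: less_imp_le)
  also have "\<dots> \<le> norm (x (K * M) idx)" by (rule mono) fact
  finally show ?thesis using K_small by simp
qed

end
end

text \<open>
By the Cauchy-Schwarz inequality \<open>(W + C \<Sum>\<^sub>j\<^sub><\<^sub>K s\<^sub>j)\<^sup>2 \<le> G (K + 1)\<close>, so the negation would force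
\<open>s\<^sub>K\<^sup>2 \<ge> \<epsilon>\<^sup>2 / (G (K + 1))\<close> for all \<open>K < N\<close>. That \<open>N\<close> depends only on the four constants is what makes the
convergence uniform.
\<close>
lemma divergence_by_harmonic_sum:
  fixes W C E \<epsilon> :: real
  assumes "0 \<le> W" "0 \<le> C" "0 \<le> E" "0 < \<epsilon>"
  obtains N :: nat where "\<And>s. (\<And>K. 0 \<le> s K) \<Longrightarrow> (\<Sum>K<N. (s K)\<^sup>2) \<le> E \<Longrightarrow>
       \<exists>K<N. s K * (W + C * (\<Sum>j<K. s j)) < \<epsilon>"
proof -
  define G where "G = 2 * W\<^sup>2 + 2 * C\<^sup>2 * E + 1"
  have G: "0 < G" using assms by (simp add: G_def add_nonneg_pos)
  have "\<forall>\<^sub>F N in sequentially. G * E / \<epsilon>\<^sup>2 < harm N"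
    using filterlim_at_top_dense[THEN iffD1, OF harm_at_top] by blast
  then obtain N where N: "G * E / \<epsilon>\<^sup>2 < (harm N :: real)"
    by (auto simp: eventually_sequentially)
  have "\<exists>K<N. s K * (W + C * (\<Sum>j<K. s j)) < \<epsilon>"
    if s: "\<And>K. 0 \<le> s K" and E: "(\<Sum>K<N. (s K)\<^sup>2) \<le> E" for s :: "nat \<Rightarrow> real"
  proof (rule ccontr)
    assume "\<not> ?thesis"
    hence low: "\<epsilon> \<le> s K * (W + C * (\<Sum>j<K. s j))" if "K < N" for K
      by (meson leI that)
    have "\<epsilon>\<^sup>2 / G * inverse (real (Suc K)) \<le> (s K)\<^sup>2" if "K < N" for K
    proof -
      have "(\<Sum>j<K. s j)\<^sup>2 \<le> (\<Sum>j<K. (s j)\<^sup>2) * (\<Sum>j<K. 1\<^sup>2)"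
        using Cauchy_Schwarz_ineq_sum[of s "\<lambda>_. 1" "{..<K}"] by simp
      also have "\<dots> \<le> E * real K"
      proof -
        have "(\<Sum>j<K. (s j)\<^sup>2) \<le> (\<Sum>j<N. (s j)\<^sup>2)" using that by (intro sum_mono2) auto
        thus ?thesis using E by (simp add: mult_right_mono)
      qed
      finally have S: "(\<Sum>j<K. s j)\<^sup>2 \<le> E * real K" .
      have "(W + C * (\<Sum>j<K. s j))\<^sup>2 \<le> 2 * W\<^sup>2 + 2 * (C * (\<Sum>j<K. s j))\<^sup>2"
        using zero_le_power2[of "W - C * (\<Sum>j<K. s j)"] by (simp add: power2_eq_square algebra_simps)
      also have "(C * (\<Sum>j<K. s j))\<^sup>2 \<le> C\<^sup>2 * (E * real K)"
        unfolding power_mult_distrib by (intro mult_left_mono S) simp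
      also have "2 * W\<^sup>2 + 2 * (C\<^sup>2 * (E * real K)) \<le> G * real (Suc K)"
        using assms(3) by (simp add: G_def algebra_simps add_nonneg_nonneg)
      finally have W: "(W + C * (\<Sum>j<K. s j))\<^sup>2 \<le> G * real (Suc K)" by simp
      have "\<epsilon>\<^sup>2 \<le> (s K * (W + C * (\<Sum>j<K. s j)))\<^sup>2"
        using low[OF that] assms(4) by (intro power_mono) auto
      also have "\<dots> \<le> (s K)\<^sup>2 * (G * real (Suc K))"
        unfolding power_mult_distrib by (intro mult_left_mono W) simp
      finally have "\<epsilon>\<^sup>2 / (G * real (Suc K)) \<le> (s K)\<^sup>2"
        using G by (subst pos_divide_le_eq) auto
      thus ?thesis by (simp only: divide_divide_eq_left divide_inverse mult.assoc inverse_mult_distrib)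
    qed
    hence "(\<Sum>K<N. \<epsilon>\<^sup>2 / G * inverse (real (Suc K))) \<le> (\<Sum>K<N. (s K)\<^sup>2)"
      by (intro sum_mono) auto
    hence "\<epsilon>\<^sup>2 / G * harm N \<le> E"
      using E by (simp add: harm_altdef sum_distrib_left)
    thus False using N G assms(4) by (simp add: field_simps)
  qed
  thus ?thesis using that by blast
qed

section \<open>Truncation of a singular value decomposition\<close>

lemma norm_sq_sum_orthonormal:
  fixes v :: "'i \<Rightarrow> 'h::real_inner"
  assumes "finite F" "\<And>i j. i \<in> F \<Longrightarrow> j \<in> F \<Longrightarrow> v i \<bullet> v j = (if i = j then 1 else 0)"
  shows "(norm (\<Sum>i\<in>F. q i *\<^sub>R v i))\<^sup>2 = (\<Sum>i\<in>F. (q i)\<^sup>2)"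
proof -
  have "(norm (\<Sum>i\<in>F. q i *\<^sub>R v i))\<^sup>2 = (\<Sum>i\<in>F. \<Sum>j\<in>F. q i * (q j * (v i \<bullet> v j)))"
    by (simp add: power2_norm_eq_inner inner_sum_left inner_sum_right sum_distrib_left)
       (intro sum.cong refl, simp add: inner_commute)
  also have "\<dots> = (\<Sum>i\<in>F. \<Sum>j\<in>F. if i = j then (q i)\<^sup>2 else 0)"
    using assms(2) by (intro sum.cong refl) (auto simp: power2_eq_square)
  also have "\<dots> = (\<Sum>i\<in>F. (q i)\<^sup>2)" using assms(1) by simp
  finally show ?thesis .
qed

lemma bessel_inequality:
  fixes v :: "'i \<Rightarrow> 'h::real_inner"
  assumes "finite F" "\<And>i j. i \<in> F \<Longrightarrow> j \<in> F \<Longrightarrow> v i \<bullet> v j = (if i = j then 1 else 0)"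
  shows "(\<Sum>i\<in>F. (v i \<bullet> x)\<^sup>2) \<le> (norm x)\<^sup>2"
proof -
  let ?p = "\<Sum>i\<in>F. (v i \<bullet> x) *\<^sub>R v i"
  have "x \<bullet> ?p = (\<Sum>i\<in>F. (v i \<bullet> x)\<^sup>2)"
    by (simp add: inner_sum_right power2_eq_square inner_commute)
  moreover have "(norm ?p)\<^sup>2 = (\<Sum>i\<in>F. (v i \<bullet> x)\<^sup>2)" by (rule norm_sq_sum_orthonormal[OF assms])
  moreover have "0 \<le> (norm (x - ?p))\<^sup>2" by simp
  ultimately show ?thesis by (simp add: norm_diff_sq)
qed

text \<open>
The remainder \<open>Adag x - A x\<close> is orthogonal to the range of \<open>A\<close> and bounded by the threshold \<open>\<tau>\<close>, and
the component of \<open>\<xi>\<close> that \<open>A\<^sup>*\<close> sees equals \<open>A u\<close> for some \<open>u\<close>, obtained by dividing by singular values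
that are at least \<open>\<tau>\<close>.
\<close>
lemma truncation_properties:
  fixes Adag A :: "'a::real_inner \<Rightarrow> 'b::real_inner"
  assumes trunc: "truncation a b \<delta> Adag A" and a: "0 < a" and \<delta>: "0 < \<delta>"
  defines "\<tau> \<equiv> a * \<delta> powr b"
  shows "bounded_linear A"
    and "(Adag x - A x) \<bullet> A z = 0"
    and "norm (Adag x - A x) \<le> \<tau> * norm x"
    and "\<exists>u. norm u \<le> norm \<xi> / \<tau> \<and> (\<forall>z. (\<xi> - A u) \<bullet> A z = 0)"
proof -
  have \<tau>: "0 < \<tau>" using a \<delta> by (simp add: \<tau>_def)
  obtain \<sigma> \<phi> \<psi> J where svd: "singular_value_decomposition Adag \<sigma> \<phi> \<psi>"
    and large: "\<And>j j'. j \<le> j' \<Longrightarrow> j' < J \<Longrightarrow> \<tau> \<le> \<sigma> j'"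
    and small: "\<And>j. J \<le> j \<Longrightarrow> \<sigma> j < \<tau>"
    and A: "A = (\<lambda>x. \<Sum>j<J. (\<sigma> j * (\<phi> j \<bullet> x)) *\<^sub>R \<psi> j)"
  proof -
    have "\<exists>\<sigma> \<phi> \<psi> J. singular_value_decomposition Adag \<sigma> \<phi> \<psi> \<and>
           (\<forall>j j'. j \<le> j' \<and> j' < J \<longrightarrow> \<sigma> j \<ge> \<sigma> j' \<and> \<sigma> j' \<ge> \<tau>) \<and> (\<forall>j\<ge>J. \<sigma> j < \<tau>) \<and>
           A = (\<lambda>x. \<Sum>j<J. (\<sigma> j * (\<phi> j \<bullet> x)) *\<^sub>R \<psi> j)"
      using trunc a by (simp add: truncation_def \<tau>_def)
    thus ?thesis using that by blast
  qed
  have \<sigma>_nonneg: "0 \<le> \<sigma> j" for j using svd by (simp add: singular_value_decomposition_def)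
  have \<sigma>_large: "\<tau> \<le> \<sigma> j" "0 < \<sigma> j" if "j < J" for j
    using large[of j j] that \<tau> by auto
  have \<phi>: "\<phi> i \<bullet> \<phi> j = (if i = j then 1 else 0)" and \<psi>: "\<psi> i \<bullet> \<psi> j = (if i = j then 1 else 0)"
    if "0 < \<sigma> i" "0 < \<sigma> j" for i j
    using svd that by (simp_all add: singular_value_decomposition_def)
  have sums: "(\<lambda>j. (\<sigma> j * (\<phi> j \<bullet> x)) *\<^sub>R \<psi> j) sums Adag x" for x
    using svd by (simp add: singular_value_decomposition_def)
  show "bounded_linear A"
    unfolding A by (intro bounded_linear_intros)
  have A_\<psi>: "A x \<bullet> \<psi> i = \<sigma> i * (\<phi> i \<bullet> x)" if "i < J" for x i
  proof -
    have "A x \<bullet> \<psi> i = (\<Sum>j<J. if j = i then \<sigma> i * (\<phi> i \<bullet> x) else 0)"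
      unfolding A inner_sum_left using that \<sigma>_large
      by (intro sum.cong) (auto simp: \<psi>)
    thus ?thesis using that by simp
  qed
  have Adag_\<psi>: "Adag x \<bullet> \<psi> i = \<sigma> i * (\<phi> i \<bullet> x)" if "i < J" for x i
  proof -
    have "(\<lambda>j. (\<sigma> j * (\<phi> j \<bullet> x)) *\<^sub>R \<psi> j \<bullet> \<psi> i) sums (Adag x \<bullet> \<psi> i)"
      by (rule bounded_linear.sums[OF bounded_linear_inner_left sums])
    moreover have "(\<sigma> j * (\<phi> j \<bullet> x)) *\<^sub>R \<psi> j \<bullet> \<psi> i = (if j = i then \<sigma> i * (\<phi> i \<bullet> x) else 0)" for j
    proof (cases "\<sigma> j = 0")
      case False
      thus ?thesis using \<sigma>_nonneg[of j] \<sigma>_large(2)[OF that] by (auto simp: \<psi>)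
    qed auto
    ultimately have "(\<lambda>j. if j = i then \<sigma> i * (\<phi> i \<bullet> x) else 0) sums (Adag x \<bullet> \<psi> i)" by simp
    thus ?thesis using sums_single[of i "\<lambda>_. \<sigma> i * (\<phi> i \<bullet> x)"] sums_unique2 by fast
  qed
  have ortho: "v \<bullet> A z = 0" if "\<And>i. i < J \<Longrightarrow> v \<bullet> \<psi> i = 0" for v z
    unfolding A inner_sum_right using that by simp
  show "(Adag x - A x) \<bullet> A z = 0"
    by (rule ortho) (simp add: inner_diff_left A_\<psi> Adag_\<psi>)
  show "norm (Adag x - A x) \<le> \<tau> * norm x"
  proof (rule LIMSEQ_le_const2)
    show "(\<lambda>N. norm ((\<Sum>j<N. (\<sigma> j * (\<phi> j \<bullet> x)) *\<^sub>R \<psi> j) - A x)) \<longlonglongrightarrow> norm (Adag x - A x)"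
      using sums[of x] by (intro tendsto_intros) (simp add: sums_def)
    have "norm ((\<Sum>j<N. (\<sigma> j * (\<phi> j \<bullet> x)) *\<^sub>R \<psi> j) - A x) \<le> \<tau> * norm x" if "J \<le> N" for N
    proof (rule power2_le_imp_le)
      \<comment> \<open>Orthonormality is available for positive singular values only.\<close>
      define F where "F = {j\<in>{J..<N}. 0 < \<sigma> j}"
      have "(\<Sum>j<N. (\<sigma> j * (\<phi> j \<bullet> x)) *\<^sub>R \<psi> j) - A x = (\<Sum>j\<in>{J..<N}. (\<sigma> j * (\<phi> j \<bullet> x)) *\<^sub>R \<psi> j)"
        unfolding A using sum_diff_nat_ivl[of 0 J N "\<lambda>j. (\<sigma> j * (\<phi> j \<bullet> x)) *\<^sub>R \<psi> j"] that
        by (simp add: atLeast0LessThan)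
      also have "\<dots> = (\<Sum>j\<in>F. (\<sigma> j * (\<phi> j \<bullet> x)) *\<^sub>R \<psi> j)"
        using \<sigma>_nonneg by (intro sum.mono_neutral_right) (auto simp: F_def order.order_iff_strict)
      finally have "(norm ((\<Sum>j<N. (\<sigma> j * (\<phi> j \<bullet> x)) *\<^sub>R \<psi> j) - A x))\<^sup>2 = (\<Sum>j\<in>F. (\<sigma> j * (\<phi> j \<bullet> x))\<^sup>2)"
        using norm_sq_sum_orthonormal[of F \<psi>] by (simp add: F_def \<psi>)
      also have "\<dots> \<le> (\<Sum>j\<in>F. \<tau>\<^sup>2 * (\<phi> j \<bullet> x)\<^sup>2)"
        unfolding power_mult_distrib using small \<sigma>_nonneg
        by (intro sum_mono mult_right_mono power_mono) (auto simp: F_def less_imp_le)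
      also have "\<dots> \<le> \<tau>\<^sup>2 * (norm x)\<^sup>2"
        unfolding sum_distrib_left[symmetric]
        by (intro mult_left_mono bessel_inequality) (auto simp: F_def \<phi>)
      finally show "(norm ((\<Sum>j<N. (\<sigma> j * (\<phi> j \<bullet> x)) *\<^sub>R \<psi> j) - A x))\<^sup>2 \<le> (\<tau> * norm x)\<^sup>2"
        by (simp add: power_mult_distrib)
    qed (use \<tau> in simp)
    thus "\<exists>N. \<forall>n\<ge>N. norm ((\<Sum>j<n. (\<sigma> j * (\<phi> j \<bullet> x)) *\<^sub>R \<psi> j) - A x) \<le> \<tau> * norm x" by blast
  qed
  show "\<exists>u. norm u \<le> norm \<xi> / \<tau> \<and> (\<forall>z. (\<xi> - A u) \<bullet> A z = 0)"
  proof (intro exI conjI allI)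
    define u where "u = (\<Sum>j<J. ((\<psi> j \<bullet> \<xi>) / \<sigma> j) *\<^sub>R \<phi> j)"
    have \<phi>_u: "\<phi> i \<bullet> u = (\<psi> i \<bullet> \<xi>) / \<sigma> i" if "i < J" for i
    proof -
      have "\<phi> i \<bullet> u = (\<Sum>j<J. if j = i then (\<psi> i \<bullet> \<xi>) / \<sigma> i else 0)"
        unfolding u_def inner_sum_right using that \<sigma>_large by (intro sum.cong) (auto simp: \<phi>)
      thus ?thesis using that by simp
    qed
    show "(\<xi> - A u) \<bullet> A z = 0" for z
    proof (rule ortho)
      fix i assume i: "i < J"
      have "\<sigma> i \<noteq> 0" using \<sigma>_large(2)[OF i] by simp
      thus "(\<xi> - A u) \<bullet> \<psi> i = 0"
        using inner_commute[of \<xi> "\<psi> i"] by (simp add: inner_diff_left A_\<psi>[OF i] \<phi>_u[OF i])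
    qed
    show "norm u \<le> norm \<xi> / \<tau>"
    proof (rule power2_le_imp_le)
      have "(norm u)\<^sup>2 = (\<Sum>j<J. ((\<psi> j \<bullet> \<xi>) / \<sigma> j)\<^sup>2)"
        unfolding u_def by (rule norm_sq_sum_orthonormal) (auto simp: \<phi> \<sigma>_large)
      also have "\<dots> \<le> (\<Sum>j<J. (\<psi> j \<bullet> \<xi>)\<^sup>2 / \<tau>\<^sup>2)"
      proof (rule sum_mono)
        fix j assume "j \<in> {..<J}"
        hence "\<tau> \<le> \<sigma> j" "0 < \<sigma> j" using \<sigma>_large by auto
        thus "((\<psi> j \<bullet> \<xi>) / \<sigma> j)\<^sup>2 \<le> (\<psi> j \<bullet> \<xi>)\<^sup>2 / \<tau>\<^sup>2"
          unfolding power_divide using \<tau> by (intro divide_left_mono power_mono mult_pos_pos) auto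
      qed
      also have "\<dots> = (\<Sum>j<J. (\<psi> j \<bullet> \<xi>)\<^sup>2) / \<tau>\<^sup>2" by (simp add: sum_divide_distrib)
      also have "\<dots> \<le> (norm \<xi>)\<^sup>2 / \<tau>\<^sup>2"
        by (intro divide_right_mono bessel_inequality) (auto simp: \<psi> \<sigma>_large)
      finally show "(norm u)\<^sup>2 \<le> (norm \<xi> / \<tau>)\<^sup>2" by (simp add: power_divide)
    qed (use \<tau> in simp)
  qed
qed

section \<open>The step size conditions\<close>

text \<open>
If \<open>A\<close> is zero, then \<open>1 / L_const A = 0\<close> by the convention for division by zero, which is incompatible with a positive \<open>c\<close>.
\<close>
lemma svrg_process_L_const:
  fixes A :: "'a::{real_inner,complete_space} \<Rightarrow> ('b::real_inner)^('n::finite)"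
  assumes A: "bounded_linear A" and c: "0 < c" "c \<le> 1 / L_const A" and M: "1 \<le> M"
  shows "svrg_process A c (L_const A) M"
proof -
  have L_pos: "0 < L_const A" using c by (metis order_less_le_trans zero_less_divide_1_iff)
  have bound: "(norm (A x $ i))\<^sup>2 \<le> L_const A * (norm x)\<^sup>2" for x i
  proof -
    have "bounded_linear (\<lambda>x. A x $ i)" using bounded_linear_compose[OF bounded_linear_vec_nth A] by simp
    hence "norm (A x $ i) \<le> onorm (\<lambda>x. A x $ i) * norm x" by (rule onorm)
    hence "(norm (A x $ i))\<^sup>2 \<le> (onorm (\<lambda>x. A x $ i))\<^sup>2 * (norm x)\<^sup>2"
      by (metis norm_ge_zero power_mono power_mult_distrib)
    also have "\<dots> \<le> L_const A * (norm x)\<^sup>2"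
      unfolding L_const_def by (intro mult_right_mono Max_ge) auto
    finally show ?thesis .
  qed
  have "c * L_const A \<le> 1" using c(2) L_pos by (simp add: pos_le_divide_eq)
  show ?thesis
  proof (intro svrg_process.intro block_operator.intro svrg_process_axioms.intro)
    show "0 < M" using M by simp
  qed (fact A c(1) less_imp_le[OF L_pos] \<open>c * L_const A \<le> 1\<close> bound)+
qed

context svrg_process
begin

lemma onorm_A_le: "onorm A \<le> real CARD('n) * sqrt L"
proof (rule onorm_bound)
  fix v
  have "(norm (A v))\<^sup>2 \<le> real CARD('n) * L * (norm v)\<^sup>2" by (rule A_bound)
  also have "\<dots> \<le> (real CARD('n))\<^sup>2 * L * (norm v)\<^sup>2"
    using n_ge_1 L_nonneg by (intro mult_right_mono) (auto simp: power2_eq_square)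
  also have "\<dots> = (real CARD('n) * sqrt L * norm v)\<^sup>2"
    using L_nonneg by (simp add: power_mult_distrib)
  finally show "norm (A v) \<le> real CARD('n) * sqrt L * norm v"
    by (rule power2_le_imp_le) (simp add: L_nonneg)
qed (simp add: L_nonneg)

text \<open>
The two branches belong to the two terms of the maximum in \<^const>\<open>C0_bar\<close>: the weights
\<open>\<gamma> m\<close> come from \<open>\<parallel>A T\<^sup>m\<parallel> \<le> \<parallel>A\<parallel>\<close> and from \<open>\<parallel>A T\<^sup>m\<parallel>\<^sup>2 \<le> n / (c (2 m + 1))\<close>.
\<close>
lemma noise_weights_exist:
  assumes "L = L_const A" "c < C0_bar A M"
  obtains \<gamma> where "\<And>m v. (\<Sum>i\<in>UNIV. (norm (A ((T ^^ m) (N i v))))\<^sup>2) / real CARD('n) \<le> \<gamma> m * (norm (A v))\<^sup>2"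
    "\<And>m. 0 \<le> \<gamma> m" "c\<^sup>2 * (\<Sum>m<M. \<gamma> m) \<le> 1 / 3"
proof -
  define Q where "Q = 3 * onorm A * sqrt (5 * L / real CARD('n) * real M)"
  define Q' where "Q' = 9 * L * (15 + 7 * ln (real M))"
  have onorm_nonneg: "0 \<le> onorm A" by (rule onorm_pos_le[OF A])
  have ln_nonneg: "0 \<le> ln (real M)" using M_pos by simp
  have "c < 1 / Q \<or> c < 1 / Q'"
    using assms by (auto simp: C0_bar_def Q_def Q'_def less_max_iff_disj)
  thus ?thesis
  proof
    assume c: "c < 1 / Q"
    have "0 < Q" using c c_pos by (metis order_less_trans zero_less_divide_1_iff)
    hence "c * Q < 1" using c by (simp add: field_simps)
    hence "(c * Q)\<^sup>2 < 1" using c_pos \<open>0 < Q\<close> by (simp add: power_less_one_iff abs_square_less_1)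
    moreover have "(c * Q)\<^sup>2 = 45 * (c\<^sup>2 * (real M * ((onorm A)\<^sup>2 * L / real CARD('n))))"
      using L_nonneg by (simp add: Q_def power_mult_distrib)
    ultimately have small: "c\<^sup>2 * (real M * ((onorm A)\<^sup>2 * L / real CARD('n))) \<le> 1 / 3" by simp
    show ?thesis
    proof (rule that[of "\<lambda>_. (onorm A)\<^sup>2 * L / real CARD('n)"])
      show "(\<Sum>i\<in>UNIV. (norm (A ((T ^^ m) (N i v))))\<^sup>2) / real CARD('n)
          \<le> (onorm A)\<^sup>2 * L / real CARD('n) * (norm (A v))\<^sup>2" for m v
      proof (rule mean_A_T_pow_N_bound)
        fix u
        have "norm (A ((T ^^ m) u)) \<le> onorm A * norm ((T ^^ m) u)" by (rule onorm[OF A])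
        also have "\<dots> \<le> onorm A * norm u" by (intro mult_left_mono T.norm_pow_le onorm_nonneg)
        finally show "(norm (A ((T ^^ m) u)))\<^sup>2 \<le> (onorm A)\<^sup>2 * (norm u)\<^sup>2"
          by (metis norm_ge_zero power_mono power_mult_distrib)
      qed simp
    qed (use small L_nonneg in simp_all)
  next
    assume c: "c < 1 / Q'"
    have "0 < Q'" using c c_pos by (metis order_less_trans zero_less_divide_1_iff)
    hence cQ: "c * Q' < 1" using c by (simp add: field_simps)
    have harm: "(\<Sum>m<M. 1 / real (2 * m + 1)) \<le> 1 + ln (real M)"
    proof -
      obtain M' where M': "M = Suc M'" using M_pos gr0_implies_Suc by blast
      have "(\<Sum>m<M. 1 / real (2 * m + 1)) \<le> (\<Sum>m<M. inverse (real (Suc m)))"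
        by (intro sum_mono) (simp add: inverse_eq_divide divide_left_mono)
      also have "\<dots> = harm M" by (simp add: harm_altdef)
      also have "\<dots> \<le> 1 + ln (real M)"
        using decseqD[OF decseq_harm_diff_ln, of 0 M'] by (simp add: M' harm_expand)
      finally show ?thesis .
    qed
    show ?thesis
    proof (rule that[of "\<lambda>m. real CARD('n) / (c * real (2 * m + 1)) * L / real CARD('n)"])
      show "(\<Sum>i\<in>UNIV. (norm (A ((T ^^ m) (N i v))))\<^sup>2) / real CARD('n)
          \<le> real CARD('n) / (c * real (2 * m + 1)) * L / real CARD('n) * (norm (A v))\<^sup>2" for m v
        using c_pos by (intro mean_A_T_pow_N_bound A_T_pow_bound) auto
      show "0 \<le> real CARD('n) / (c * real (2 * m + 1)) * L / real CARD('n)" for m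
        using c_pos L_nonneg by simp
      have "c\<^sup>2 * (\<Sum>m<M. real CARD('n) / (c * real (2 * m + 1)) * L / real CARD('n))
          = (c * L) * (\<Sum>m<M. 1 / real (2 * m + 1))"
      proof -
        have "c\<^sup>2 * (real CARD('n) / (c * q) * L / real CARD('n)) = c * L * (1 / q)" for q
          using c_pos by (simp add: power2_eq_square)
        thus ?thesis by (simp only: sum_distrib_left)
      qed
      also have "\<dots> \<le> (c * L) * (1 + ln (real M))"
        using c_pos L_nonneg by (intro mult_left_mono harm) auto
      also have "\<dots> \<le> (c * L) * ((15 + 7 * ln (real M)) * 3)"
        using c_pos L_nonneg ln_nonneg by (intro mult_left_mono) auto
      also have "\<dots> = c * Q' / 3" by (simp add: Q'_def)
      also have "\<dots> \<le> 1 / 3" using cQ by simp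
      finally show "c\<^sup>2 * (\<Sum>m<M. real CARD('n) / (c * real (2 * m + 1)) * L / real CARD('n)) \<le> 1 / 3" .
    qed
  qed
qed

lemma C0_small:
  assumes "L = L_const A" "c < C0 A M"
  shows "c * real M * sqrt L * onorm A \<le> 1 / 4"
proof -
  define X where "X = sqrt L * real M * onorm A"
  define l where "l = ln (2 * (exp 1)\<^sup>2 * real CARD('n) * sqrt L / onorm A)"
  have c: "c < 1 / (14\<^sup>2 * X * l)"
    using assms by (simp add: C0_def X_def l_def mult.assoc)
  have onorm_nonneg: "0 \<le> onorm A" by (rule onorm_pos_le[OF A])
  have X_nonneg: "0 \<le> X" using onorm_nonneg L_nonneg by (simp add: X_def)
  have pos: "0 < 14\<^sup>2 * X * l" using c c_pos by (metis order_less_trans zero_less_divide_1_iff)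
  hence "X \<noteq> 0" by auto
  hence "0 < onorm A" using onorm_nonneg by (auto simp: X_def order.order_iff_strict)
  have "1 \<le> l"
  proof -
    have "1 \<le> real CARD('n) * sqrt L / onorm A"
      using onorm_A_le \<open>0 < onorm A\<close> by simp
    moreover have "exp 1 * 1 \<le> exp 1 * (2 * exp 1 :: real)"
      by (intro mult_left_mono) (use exp_ge_add_one_self[of 1] in auto)
    ultimately have "exp 1 * 1 \<le> (exp 1 * (2 * exp 1)) * (real CARD('n) * sqrt L / onorm A)"
      by (intro mult_mono) auto
    hence "exp 1 \<le> 2 * (exp 1)\<^sup>2 * real CARD('n) * sqrt L / onorm A"
      by (simp add: power2_eq_square mult_ac)
    thus ?thesis unfolding l_def by (metis exp_gt_zero ln_exp ln_le_cancel_iff order_less_le_trans)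
  qed
  have "196 * (c * X * l) < 1" using c pos by (simp add: field_simps)
  moreover have "c * X * 1 \<le> c * X * l"
    using \<open>1 \<le> l\<close> c_pos X_nonneg by (intro mult_left_mono) auto
  ultimately have "c * X \<le> 1 / 4" by linarith
  thus ?thesis by (simp add: X_def mult_ac)
qed

end

section \<open>Linearity of the iteration\<close>
lemma svrg_add:
  fixes A :: "'a::{real_inner,complete_space} \<Rightarrow> ('b::real_inner)^('n::finite)"
  assumes A: "bounded_linear A"
  shows "svrg A (y + y') c M (x0 + x0') idx k = svrg A y c M x0 idx k + svrg A y' c M x0' idx k"
proof (induction k rule: less_induct)
  case (less k)
  interpret A: bounded_linear A by (rule A)
  have As: "adjoint A (u + v) = adjoint A u + adjoint A v" for u v
    by (rule linear_add[OF linear_adjoint[OF A]])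
  have Ais: "adjoint (\<lambda>u. A u $ i) (u + v) = adjoint (\<lambda>u. A u $ i) u + adjoint (\<lambda>u. A u $ i) v" for i u v
    using bounded_linear_compose[OF bounded_linear_vec_nth A]
    by (intro linear_add[OF linear_adjoint]) simp
  show ?case
  proof (cases k)
    case (Suc k')
    have IH: "svrg A (y + y') c M (x0 + x0') idx j = svrg A y c M x0 idx j + svrg A y' c M x0' idx j"
      if "j \<le> k'" for j using less that Suc by simp
    have e1: "A (p + p' - (q + q')) $ i = A (p - q) $ i + A (p' - q') $ i" for p p' q q' i
      by (simp add: A.add A.diff)
    have e2: "A (q + q') - (y + y') = (A q - y) + (A q' - y')" for q q'
      by (simp add: A.add)
    show ?thesis unfolding Suc
      by (simp add: Let_def IH e1 e2 As Ais scaleR_add_right)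
  qed simp
qed

text \<open>
The data enter the iteration only through their image under the adjoint of \<open>A\<close>.
\<close>
lemma svrg_shift:
  fixes A :: "'a::{real_inner,complete_space} \<Rightarrow> ('b::real_inner)^('n::finite)"
  assumes A: "bounded_linear A" and y: "\<And>v. (y - A z - y') \<bullet> A v = 0"
  shows "svrg A y c M x0 idx k - z = svrg A y' c M (x0 - z) idx k"
proof (induction k rule: less_induct)
  case (less k)
  interpret A: bounded_linear A by (rule A)
  have As: "adjoint A (A (q - z) - y') = adjoint A (A q - y)" for q
  proof (rule adjointI[OF A])
    fix v
    have "A v \<bullet> (A (q - z) - y') = A v \<bullet> (A q - y) + (y - A z - y') \<bullet> A v"
      by (simp add: A.diff inner_diff_left inner_diff_right inner_commute)
    thus "A v \<bullet> (A (q - z) - y') = v \<bullet> adjoint A (A q - y)"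
      using y by (simp add: inner_adjoint[OF A])
  qed
  show ?case
  proof (cases k)
    case (Suc k')
    have IH: "svrg A y' c M (x0 - z) idx j = svrg A y c M x0 idx j - z" if "j \<le> k'" for j
      using less that Suc by simp
    show ?thesis unfolding Suc
      by (simp add: Let_def IH As)
  qed simp
qed

section \<open>Convergence uniformly in the operator\<close>

text \<open>
The index \<open>k1\<close> depends on the source element \<open>w\<close> but not on \<open>A\<close>; this is what allows \<open>A\<close> to vary with
the noise level.
\<close>
lemma mean_square_convergence_uniform:
  fixes c R \<epsilon> :: real and M :: nat and w :: "('b::real_inner)^('n::finite)"
  assumes c: "0 < c" and M: "1 \<le> M" and \<epsilon>: "0 < \<epsilon>"
  obtains k1 where "\<And>(A :: 'a::{real_inner,complete_space} \<Rightarrow> 'b^'n) x0 k.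
    bounded_linear A \<Longrightarrow> c \<le> 1 / L_const A \<Longrightarrow> c < C0_bar A M \<Longrightarrow> norm x0 \<le> R \<Longrightarrow>
    norm (x0 - adjoint A w) \<le> \<epsilon> \<Longrightarrow> k1 \<le> k \<Longrightarrow>
    seq_mean k (\<lambda>idx. (norm (svrg A 0 c M x0 idx k))\<^sup>2) \<le> (3 * \<epsilon>)\<^sup>2"
proof -
  define H where "H = 3 * real M * real CARD('n) * R\<^sup>2 + 3 * real M * (1 + 3 * real M) * R\<^sup>2"
  define Q where "Q = real CARD('n) * (norm w)\<^sup>2 / (c * \<epsilon>\<^sup>2) + H / (5 * \<epsilon>\<^sup>2) + 1"
  have H: "0 \<le> H" by (simp add: H_def)
  have Q_bounds: "1 \<le> Q" "real CARD('n) * (norm w)\<^sup>2 / (c * \<epsilon>\<^sup>2) \<le> Q" "H / (5 * \<epsilon>\<^sup>2) \<le> Q"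
    using c H by (simp_all add: Q_def)
  obtain K1 :: nat where K1: "Q \<le> real K1" using real_arch_simple by blast
  have "0 < K1" using K1 Q_bounds(1) by (cases K1) auto
  have "seq_mean k (\<lambda>idx. (norm (svrg A 0 c M x0 idx k))\<^sup>2) \<le> (3 * \<epsilon>)\<^sup>2"
    if A: "bounded_linear A" and cL: "c \<le> 1 / L_const A" and C0: "c < C0_bar A M" and R: "norm x0 \<le> R"
      and w: "norm (x0 - adjoint A w) \<le> \<epsilon>" and k: "2 * M * K1 \<le> k"
    for A :: "'a \<Rightarrow> 'b^'n" and x0 k
  proof -
    interpret svrg_process A c "L_const A" 0 x0 M
      by (rule svrg_process_L_const[OF A c cL M])
    obtain \<gamma> where \<gamma>: "\<And>m v. (\<Sum>i\<in>UNIV. (norm (A ((T ^^ m) (N i v))))\<^sup>2) / real CARD('n) \<le> \<gamma> m * (norm (A v))\<^sup>2"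
      "\<And>m. 0 \<le> \<gamma> m" "c\<^sup>2 * (\<Sum>m<M. \<gamma> m) \<le> 1 / 3"
      using noise_weights_exist[OF refl C0] by blast
    \<comment> \<open>Half of the steps make the residual small, the other half damp the noise collected so far.\<close>
    define K where "K = k div (2 * M)"
    define m where "m = k - K * M"
    have "2 * M * K \<le> k" unfolding K_def by (rule times_div_less_eq_dividend)
    hence KM: "K * M + m = k" "K * M \<le> m" by (simp_all add: m_def mult.commute)
    have "K1 \<le> K" unfolding K_def using M k by (simp add: less_eq_div_iff_mult_less_eq mult.commute)
    hence "0 < K" "Q \<le> real K" using \<open>0 < K1\<close> K1 by linarith+
    have "K * 1 \<le> K * M" using M by (intro mult_le_mono2)
    hence "K \<le> m" using KM(2) by linarith
    have "norm ((T ^^ k) x0) \<le> 2 * \<epsilon>"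
    proof -
      have "(norm ((T ^^ k) (As w)))\<^sup>2 \<le> real CARD('n) / (c * real (2 * k + 1)) * (norm w)\<^sup>2"
        by (rule T_pow_As_bound)
      also have "\<dots> \<le> real CARD('n) / (c * real K) * (norm w)\<^sup>2"
        using c \<open>0 < K\<close> \<open>K \<le> m\<close> KM
        by (intro mult_right_mono divide_left_mono mult_left_mono) auto
      also have "\<dots> \<le> \<epsilon>\<^sup>2"
      proof -
        have "real CARD('n) * (norm w)\<^sup>2 / (c * \<epsilon>\<^sup>2) \<le> real K" using Q_bounds(2) \<open>Q \<le> real K\<close> by linarith
        thus ?thesis using c \<epsilon> \<open>0 < K\<close> by (simp add: field_simps)
      qed
      finally have 1: "norm ((T ^^ k) (As w)) \<le> \<epsilon>" by (rule power2_le_imp_le) (use \<epsilon> in simp)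
      have 2: "norm ((T ^^ k) (x0 - As w)) \<le> \<epsilon>"
        using T.norm_pow_le[of k "x0 - As w"] w by (simp add: As_def)
      have "(T ^^ k) x0 = (T ^^ k) (As w) + (T ^^ k) (x0 - As w)"
        using linear_add[OF T.linear_pow, of k "As w" "x0 - As w"] by simp
      thus ?thesis using norm_triangle_ineq[of "(T ^^ k) (As w)" "(T ^^ k) (x0 - As w)"] 1 2 by simp
    qed
    hence "(norm ((T ^^ k) x0))\<^sup>2 \<le> (2 * \<epsilon>)\<^sup>2" by (intro power_mono) auto
    moreover have "3 * real M * real CARD('n) * (norm x0)\<^sup>2 / real (m + 1)
        + 3 * real M * (1 + 3 * real M) * (norm x0)\<^sup>2 / real K \<le> 5 * \<epsilon>\<^sup>2"
    proof -
      have R2: "(norm x0)\<^sup>2 \<le> R\<^sup>2" using R by (intro power_mono) auto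
      have "3 * real M * real CARD('n) * (norm x0)\<^sup>2 / real (m + 1) \<le> 3 * real M * real CARD('n) * R\<^sup>2 / real K"
        using R2 \<open>0 < K\<close> \<open>K \<le> m\<close> by (intro frac_le mult_left_mono) auto
      moreover have "3 * real M * (1 + 3 * real M) * (norm x0)\<^sup>2 / real K \<le> 3 * real M * (1 + 3 * real M) * R\<^sup>2 / real K"
        using R2 by (intro divide_right_mono mult_left_mono) auto
      moreover have "H / real K \<le> 5 * \<epsilon>\<^sup>2"
      proof -
        have "H / (5 * \<epsilon>\<^sup>2) \<le> real K" using Q_bounds(3) \<open>Q \<le> real K\<close> by linarith
        thus ?thesis using \<epsilon> \<open>0 < K\<close> by (simp add: field_simps)
      qed
      ultimately show ?thesis by (simp add: H_def add_divide_distrib)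
    qed
    moreover have "seq_mean k (\<lambda>idx. (norm (x k idx))\<^sup>2)
      \<le> (norm ((T ^^ k) x0))\<^sup>2 + (3 * real M * real CARD('n) * (norm x0)\<^sup>2 / real (m + 1)
        + 3 * real M * (1 + 3 * real M) * (norm x0)\<^sup>2 / real K)"
      using mean_error_exact[OF \<gamma> refl \<open>0 < K\<close>, of m] unfolding KM(1) by simp
    ultimately show ?thesis by (simp add: x_def power_mult_distrib)
  qed
  thus ?thesis by (rule that)
qed

lemma pathwise_convergence_uniform:
  fixes c R \<epsilon> :: real and M :: nat and w :: "('b::real_inner)^('n::finite)"
  assumes c: "0 < c" and M: "1 \<le> M" and \<epsilon>: "0 < \<epsilon>" and R_nonneg: "0 \<le> R"
  obtains k1 where "\<And>(A :: 'a::{real_inner,complete_space} \<Rightarrow> 'b^'n) x0 k idx.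
    bounded_linear A \<Longrightarrow> c \<le> 1 / L_const A \<Longrightarrow> c < C0 A M \<Longrightarrow> norm x0 \<le> R \<Longrightarrow>
    norm (x0 - adjoint A w) < \<epsilon> \<Longrightarrow> k1 \<le> k \<Longrightarrow> norm (svrg A 0 c M x0 idx k) < 2 * \<epsilon>"
proof -
  have nonneg: "0 \<le> norm w" "0 \<le> 5 * c * real M / (4 * real CARD('n))"
    "0 \<le> 4 * real CARD('n) / (c * real M) * (R + \<epsilon>)\<^sup>2" "0 < \<epsilon>\<^sup>2"
    using c \<epsilon> by simp_all
  obtain p :: nat where p: "\<And>s. (\<And>K. 0 \<le> s K) \<Longrightarrow> (\<Sum>K<p. (s K)\<^sup>2) \<le> 4 * real CARD('n) / (c * real M) * (R + \<epsilon>)\<^sup>2 \<Longrightarrow>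
       \<exists>K<p. s K * (norm w + 5 * c * real M / (4 * real CARD('n)) * (\<Sum>j<K. s j)) < \<epsilon>\<^sup>2"
    using divergence_by_harmonic_sum[OF nonneg] by metis
  have "norm (svrg A 0 c M x0 idx k) < 2 * \<epsilon>"
    if A: "bounded_linear A" and cL: "c \<le> 1 / L_const A" and C0: "c < C0 A M" and R: "norm x0 \<le> R"
      and w: "norm (x0 - adjoint A w) < \<epsilon>" and k: "p * M \<le> k"
    for A :: "'a \<Rightarrow> 'b^'n" and x0 k idx
  proof -
    interpret main: svrg_process A c "L_const A" 0 "adjoint A w" M
      by (rule svrg_process_L_const[OF A c cL M])
    interpret remainder: svrg_process A c "L_const A" 0 "x0 - adjoint A w" M
      by (rule svrg_process_L_const[OF A c cL M])
    note onorm_facts = onorm[OF A] onorm_pos_le[OF A] main.onorm_A_le main.C0_small[OF refl C0]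
    have "norm (svrg A 0 c M (adjoint A w) idx k) < \<epsilon>"
    proof -
      have "norm (adjoint A w) \<le> R + \<epsilon>"
        using norm_triangle_ineq4[of x0 "x0 - adjoint A w"] R w by simp
      hence "(norm (adjoint A w))\<^sup>2 \<le> (R + \<epsilon>)\<^sup>2" by (intro power_mono) auto
      thus ?thesis
        using main.pathwise_exact[OF onorm_facts refl _ order_refl _ \<epsilon> p k, where idx = idx]
        by (simp add: main.As_def main.x_def)
    qed
    moreover have "norm (svrg A 0 c M (x0 - adjoint A w) idx k) < \<epsilon>"
    proof -
      have "(norm (svrg A 0 c M (x0 - adjoint A w) idx k))\<^sup>2 \<le> (norm (x0 - adjoint A w))\<^sup>2"
        using remainder.pathwise_norm_sq_bound[OF onorm_facts, of k idx] by (simp add: remainder.x_def)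
      thus ?thesis using w by (meson norm_ge_zero order_le_less_trans power2_le_imp_le)
    qed
    moreover have "svrg A 0 c M x0 idx k = svrg A 0 c M (adjoint A w) idx k + svrg A 0 c M (x0 - adjoint A w) idx k"
      using svrg_add[OF A, of 0 0 c M "adjoint A w" "x0 - adjoint A w" idx k] by simp
    ultimately show ?thesis
      using norm_triangle_ineq[of "svrg A 0 c M (adjoint A w) idx k" "svrg A 0 c M (x0 - adjoint A w) idx k"] by simp
  qed
  thus ?thesis by (rule that)
qed

lemma svrg_mean_noise:
  fixes A :: "'a::{real_inner,complete_space} \<Rightarrow> ('b::real_inner)^('n::finite)"
  assumes "bounded_linear A" "0 < c" "c \<le> 1 / L_const A" "1 \<le> M" "c < C0_bar A M"
  shows "seq_mean k (\<lambda>idx. (norm (svrg A \<xi> c M 0 idx k))\<^sup>2) \<le> c / real CARD('n) * (real k + 3 * real M) * (norm \<xi>)\<^sup>2"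
proof -
  interpret svrg_process A c "L_const A" \<xi> 0 M
    using assms by (intro svrg_process_L_const)
  obtain \<gamma> where "\<And>m v. (\<Sum>i\<in>UNIV. (norm (A ((T ^^ m) (N i v))))\<^sup>2) / real CARD('n) \<le> \<gamma> m * (norm (A v))\<^sup>2"
      "\<And>m. 0 \<le> \<gamma> m" "c\<^sup>2 * (\<Sum>m<M. \<gamma> m) \<le> 1 / 3"
    using noise_weights_exist[OF refl assms(5)] by blast
  from mean_error_noise[OF this refl, of k] show ?thesis by (simp add: x_def)
qed

lemma svrg_pathwise_noise:
  fixes A :: "'a::{real_inner,complete_space} \<Rightarrow> ('b::real_inner)^('n::finite)"
  assumes A: "bounded_linear A" and "0 < c" "c \<le> 1 / L_const A" "1 \<le> M" "c < C0 A M"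
  shows "(norm (svrg A \<xi> c M 0 idx k))\<^sup>2 \<le> 2 * c * real k / real CARD('n) * (norm \<xi>)\<^sup>2"
proof -
  interpret svrg_process A c "L_const A" \<xi> 0 M
    using assms by (intro svrg_process_L_const)
  show ?thesis
    using pathwise_norm_sq_bound[OF onorm[OF A] onorm_pos_le[OF A] onorm_A_le C0_small[OF refl assms(5)], of k idx]
    by (simp add: x_def)
qed

lemma seq_mean_norm_add_sq:
  fixes f g :: "(nat \<Rightarrow> 'i::finite) \<Rightarrow> 'h::real_inner"
  shows "seq_mean k (\<lambda>idx. (norm (f idx + g idx))\<^sup>2)
    \<le> 2 * seq_mean k (\<lambda>idx. (norm (f idx))\<^sup>2) + 2 * seq_mean k (\<lambda>idx. (norm (g idx))\<^sup>2)"
proof -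
  have "(norm (u + v))\<^sup>2 \<le> 2 * (norm u)\<^sup>2 + 2 * (norm v)\<^sup>2" for u v :: 'h
    using zero_le_power2[of "norm (u - v)"] by (simp add: norm_add_sq norm_diff_sq)
  hence "seq_mean k (\<lambda>idx. (norm (f idx + g idx))\<^sup>2)
      \<le> seq_mean k (\<lambda>idx. 2 * (norm (f idx))\<^sup>2 + 2 * (norm (g idx))\<^sup>2)"
    by (intro seq_mean_mono)
  thus ?thesis by (simp only: seq_mean_add seq_mean_cmult)
qed

lemma minimum_norm_orthogonal:
  fixes Adag :: "'a::real_inner \<Rightarrow> 'b::real_vector"
  assumes "linear Adag" and min: "is_arg_min (\<lambda>x. norm (x - x0)) (\<lambda>x. Adag x = ydag) xdag" and z: "Adag z = 0"
  shows "(x0 - xdag) \<bullet> z = 0"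
proof (cases "z = 0")
  case False
  define t where "t = ((x0 - xdag) \<bullet> z) / (norm z)\<^sup>2"
  have "Adag (xdag + t *\<^sub>R z) = ydag"
    using min z by (simp add: is_arg_min_def linear_add[OF assms(1)] linear_scale[OF assms(1)])
  hence "norm (xdag - x0) \<le> norm (xdag + t *\<^sub>R z - x0)"
    using min by (auto simp: is_arg_min_def not_less)
  hence "(norm (x0 - xdag))\<^sup>2 \<le> (norm ((x0 - xdag) - t *\<^sub>R z))\<^sup>2"
    by (intro power_mono) (simp_all add: norm_minus_commute algebra_simps)
  hence "2 * (t * ((x0 - xdag) \<bullet> z)) \<le> t\<^sup>2 * (norm z)\<^sup>2"
    by (simp add: norm_diff_sq[of "x0 - xdag"] power_mult_distrib)
  also have "t\<^sup>2 * (norm z)\<^sup>2 = t * ((x0 - xdag) \<bullet> z)"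
    using False by (simp add: t_def power2_eq_square)
  finally have "((x0 - xdag) \<bullet> z)\<^sup>2 / (norm z)\<^sup>2 \<le> 0"
    by (simp add: t_def power2_eq_square)
  thus ?thesis using False by (simp add: divide_le_0_iff)
qed simp

section \<open>Reduction to the noise-free iteration\<close>
lemma norm_adjoint_diff_le:
  fixes Adag A :: "'a::{real_inner,complete_space} \<Rightarrow> 'b::real_inner"
  assumes Adag: "bounded_linear Adag" and A: "bounded_linear A"
    and "0 \<le> \<tau>" and close: "\<And>x. norm (Adag x - A x) \<le> \<tau> * norm x"
  shows "norm (adjoint Adag w - adjoint A w) \<le> \<tau> * norm w"
proof -
  define q where "q = adjoint Adag w - adjoint A w"
  have "(norm q)\<^sup>2 = (Adag q - A q) \<bullet> w"
    unfolding power2_norm_eq_inner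
    by (subst (2) q_def) (simp add: inner_diff_right inner_diff_left inner_adjoint[OF Adag] inner_adjoint[OF A])
  also have "\<dots> \<le> norm (Adag q - A q) * norm w" by (rule norm_cauchy_schwarz)
  also have "\<dots> \<le> \<tau> * norm q * norm w" by (intro mult_right_mono close) simp
  finally have *: "norm q * norm q \<le> norm q * (\<tau> * norm w)" by (simp add: power2_eq_square mult_ac)
  show ?thesis
  proof (cases "q = 0")
    case False
    thus ?thesis using * by (simp add: q_def)
  next
    case True
    have "0 \<le> \<tau> * norm w" using \<open>0 \<le> \<tau>\<close> by simp
    thus ?thesis using True by (simp add: q_def)
  qed
qed

text \<open>
Shifting by \<open>u\<close> with \<open>A\<^sup>* A u = A\<^sup>* \<xi>\<close> turns the noisy iteration for the truncated operator
into a noise-free one.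
\<close>
lemma rsvrg_reduction:
  fixes Adag A :: "'a::{real_inner,complete_space} \<Rightarrow> ('b::real_inner)^('n::finite)"
  assumes Adag: "bounded_linear Adag" and trunc: "truncation a b \<delta> Adag A" and a: "0 < a" and \<delta>: "0 < \<delta>"
    and x: "Adag xdag = ydag"
  obtains u where "bounded_linear A" "norm u \<le> norm \<xi> / (a * \<delta> powr b)"
    "\<And>w. norm (adjoint Adag w - adjoint A w) \<le> a * \<delta> powr b * norm w"
    "\<And>c M x0 idx k. svrg A (ydag + \<xi>) c M x0 idx k - xdag = u + svrg A 0 c M (x0 - xdag - u) idx k"
proof -
  note trunc_props = truncation_properties[OF trunc a \<delta>]
  interpret A: bounded_linear A by (rule trunc_props(1))
  obtain u where u: "norm u \<le> norm \<xi> / (a * \<delta> powr b)" "\<And>z. (\<xi> - A u) \<bullet> A z = 0"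
    using trunc_props(4)[of \<xi>] by blast
  have "(ydag + \<xi> - A (xdag + u) - 0) \<bullet> A v = 0" for v
  proof -
    have "ydag + \<xi> - A (xdag + u) - 0 = (Adag xdag - A xdag) + (\<xi> - A u)"
      by (simp add: x A.add)
    thus ?thesis using trunc_props(2)[of xdag v] u(2)[of v] by (simp only: inner_add_left)
  qed
  from svrg_shift[OF trunc_props(1) this]
  have "svrg A (ydag + \<xi>) c M x0 idx k - xdag = u + svrg A 0 c M (x0 - xdag - u) idx k" for c M x0 idx k
    by (simp add: algebra_simps)
  moreover have "norm (adjoint Adag w - adjoint A w) \<le> a * \<delta> powr b * norm w" for w
    using a by (intro norm_adjoint_diff_le[OF Adag trunc_props(1) _ trunc_props(3)]) simp
  ultimately show ?thesis using that trunc_props(1) u(1) by blast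
qed

theorem corollary2p3:
  fixes Adag :: "'a::{real_inner,complete_space} \<Rightarrow> ('b::{real_inner,complete_space})^('n::finite)"
    and Y :: "'n \<Rightarrow> 'b set"
    and A :: "real \<Rightarrow> 'a \<Rightarrow> 'b^'n"
    and x0 xdag :: 'a
    and ydag :: "'b^'n"
    and \<xi> :: "real \<Rightarrow> 'b^'n"
    and a b c0 :: real
    and M :: nat
    and P :: "'w measure"
    and I :: "nat \<Rightarrow> 'w \<Rightarrow> 'n"
    and e :: "real \<Rightarrow> (nat \<Rightarrow> 'n) \<Rightarrow> nat \<Rightarrow> 'a"
  assumes Y: "\<And>i. subspace (Y i)" "\<And>i. closed (Y i)"
    and Adag: "bounded_linear Adag" "\<And>x i. Adag x $ i \<in> Y i"
    and ydag: "ydag \<in> range Adag"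
    and xdag: "is_arg_min (\<lambda>x. norm (x - x0)) (\<lambda>x. Adag x = ydag) xdag"
    and noise: "\<And>\<delta> i. 0 < \<delta> \<Longrightarrow> \<delta> < 1 \<Longrightarrow> \<xi> \<delta> $ i \<in> Y i"
      "\<And>\<delta>. 0 < \<delta> \<Longrightarrow> \<delta> < 1 \<Longrightarrow> norm (\<xi> \<delta>) = \<delta>"
    and ab: "0 \<le> a" "0 < b"
    and A: "\<And>\<delta>. 0 < \<delta> \<Longrightarrow> \<delta> < 1 \<Longrightarrow> truncation a b \<delta> Adag (A \<delta>)"
    and M: "1 \<le> M"
    and c0: "0 < c0" "\<forall>\<^sub>F \<delta> in at_right 0. c0 \<le> 1 / L_const (A \<delta>)"
    and P: "prob_space P"
    and I_indep: "prob_space.indep_vars P (\<lambda>_. count_space UNIV) I UNIV"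
    and I_uniform: "\<And>k. distr P (count_space UNIV) (I k) = uniform_count_measure UNIV"
    and e: "\<And>\<delta> idx k. e \<delta> idx k = svrg (A \<delta>) (ydag + \<xi> \<delta>) c0 M x0 idx k - xdag"
  shows
    "(0 < a \<and> b < 1 \<longrightarrow>
        ((\<forall>\<^sub>F \<delta> in at_right 0. c0 < C0_bar (A \<delta>) M) \<longrightarrow>
          (\<forall>\<epsilon>>0. \<exists>k1. \<exists>\<delta>1>0. \<forall>k\<ge>k1. \<forall>\<delta>\<in>{0<..\<delta>1}.
             sqrt (prob_space.expectation P (\<lambda>\<omega>. (norm (e \<delta> (\<lambda>j. I j \<omega>) k))\<^sup>2)) < \<epsilon>)) \<and>
        ((\<forall>\<^sub>F \<delta> in at_right 0. c0 < C0 (A \<delta>) M) \<longrightarrow>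
          (\<forall>\<epsilon>>0. \<exists>k1. \<exists>\<delta>1>0. \<forall>idx. \<forall>k\<ge>k1. \<forall>\<delta>\<in>{0<..\<delta>1}. norm (e \<delta> idx k) < \<epsilon>)))
     \<and>
     (a = 0 \<longrightarrow>
        (\<forall>k :: real \<Rightarrow> nat.
          filterlim k at_top (at_right 0) \<and>
          ((\<lambda>\<delta>. sqrt (real (k \<delta>)) * \<delta>) \<longlongrightarrow> 0) (at_right 0) \<longrightarrow>
          ((\<forall>\<^sub>F \<delta> in at_right 0. c0 < C0_bar (A \<delta>) M) \<longrightarrow>
            ((\<lambda>\<delta>. sqrt (prob_space.expectation P (\<lambda>\<omega>. (norm (e \<delta> (\<lambda>j. I j \<omega>) (k \<delta>)))\<^sup>2)))
               \<longlongrightarrow> 0) (at_right 0)) \<and>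
          ((\<forall>\<^sub>F \<delta> in at_right 0. c0 < C0 (A \<delta>) M) \<longrightarrow>
            uniform_limit UNIV (\<lambda>\<delta> idx. norm (e \<delta> idx (k \<delta>))) (\<lambda>_. 0) (at_right 0))))"
proof -
  define e0 where "e0 = x0 - xdag"
  have Adag_xdag: "Adag xdag = ydag" using xdag by (simp add: is_arg_min_def)
  have approx: "\<exists>w. norm (e0 - adjoint Adag w) < \<eta>" if "0 < \<eta>" for \<eta>
    using approximation_by_range_adjoint[OF Adag(1) _ that, of e0]
      minimum_norm_orthogonal[OF bounded_linear.linear[OF Adag(1)] xdag]
    unfolding e0_def by metis
  have expect: "prob_space.expectation P (\<lambda>\<omega>. (norm (e \<delta> (\<lambda>j. I j \<omega>) k))\<^sup>2)
      = seq_mean k (\<lambda>idx. (norm (e \<delta> idx k))\<^sup>2)" for \<delta> k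
    unfolding e
    by (rule expectation_eq_seq_mean[OF P I_indep I_uniform])
       (rule depends_on_prefix_comp[OF svrg_prefix, where h = "\<lambda>v. (norm (v - xdag))\<^sup>2"])
  have positive: "\<forall>\<^sub>F \<delta> in at_right (0::real). 0 < \<delta> \<and> \<delta> < 1"
    unfolding eventually_at_right_field by (intro exI[of _ 1]) auto

  \<comment> \<open>The truncated iteration, for all small noise levels, as a small shift plus a noise-free iteration whose
    initial error is within \<open>3 \<eta>\<close> of the range of the adjoint.\<close>
  have start: "\<forall>\<^sub>F \<delta> in at_right 0. (0 < \<delta> \<and> \<delta> < 1) \<and> c0 \<le> 1 / L_const (A \<delta>) \<and>
      (\<exists>u. bounded_linear (A \<delta>) \<and> norm u \<le> \<eta> \<and> norm (e0 - u) \<le> norm e0 + 1 \<and>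
        norm (e0 - u - adjoint (A \<delta>) w) < 3 * \<eta> \<and>
        (\<forall>idx k. e \<delta> idx k = u + svrg (A \<delta>) 0 c0 M (e0 - u) idx k))"
    if a: "0 < a" and b: "b < 1" and \<eta>: "0 < \<eta>" and w: "norm (e0 - adjoint Adag w) < \<eta>" for \<eta> w
  proof -
    have "((\<lambda>\<delta>. a * \<delta> powr b * norm w) \<longlongrightarrow> a * 0 * norm w) (at_right 0)"
      using ab(2) positive
      by (intro tendsto_intros tendsto_zero_powrI) (auto elim: eventually_mono)
    hence 1: "\<forall>\<^sub>F \<delta> in at_right 0. a * \<delta> powr b * norm w < \<eta>"
      using \<eta> by (intro order_tendstoD(2)) auto
    have "((\<lambda>\<delta>::real. \<delta> powr (1 - b)) \<longlongrightarrow> 0) (at_right 0)"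
      using b positive
      by (intro tendsto_zero_powrI[OF tendsto_ident_at tendsto_const]) (auto elim: eventually_mono)
    hence "((\<lambda>\<delta>. \<delta> powr (1 - b) / a) \<longlongrightarrow> 0) (at_right 0)"
      by (rule tendsto_divide_zero)
    hence 2: "\<forall>\<^sub>F \<delta> in at_right 0. \<delta> powr (1 - b) / a < min \<eta> 1"
      using \<eta> by (intro order_tendstoD(2)) auto
    show ?thesis
      using 1 2 c0(2) positive
    proof eventually_elim
      case (elim \<delta>)
      hence \<delta>: "0 < \<delta>" "\<delta> < 1" by auto
      obtain u where u: "bounded_linear (A \<delta>)" "norm u \<le> norm (\<xi> \<delta>) / (a * \<delta> powr b)"
        "\<And>w. norm (adjoint Adag w - adjoint (A \<delta>) w) \<le> a * \<delta> powr b * norm w"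
        "\<And>c M x0 idx k. svrg (A \<delta>) (ydag + \<xi> \<delta>) c M x0 idx k - xdag = u + svrg (A \<delta>) 0 c M (x0 - xdag - u) idx k"
        using rsvrg_reduction[OF Adag(1) A[OF \<delta>] a \<delta>(1) Adag_xdag] by metis
      have "norm (\<xi> \<delta>) / (a * \<delta> powr b) = \<delta> powr (1 - b) / a"
        using \<delta> a by (simp add: noise(2) powr_diff)
      hence u_le: "norm u \<le> \<eta>" "norm u \<le> 1" using u(2) elim by auto
      have "norm (e0 - u - adjoint (A \<delta>) w)
          \<le> norm (e0 - adjoint Adag w) + norm u + norm (adjoint Adag w - adjoint (A \<delta>) w)"
      proof -
        have "e0 - u - adjoint (A \<delta>) w = (e0 - adjoint Adag w) - u + (adjoint Adag w - adjoint (A \<delta>) w)"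
          by simp
        thus ?thesis by (metis add_mono norm_triangle_le norm_triangle_ineq4 order_refl)
      qed
      hence "norm (e0 - u - adjoint (A \<delta>) w) < 3 * \<eta>"
        using w u_le u(3)[of w] elim by linarith
      moreover have "norm (e0 - u) \<le> norm e0 + 1"
        using norm_triangle_ineq4[of e0 u] u_le by linarith
      moreover have "e \<delta> idx k = u + svrg (A \<delta>) 0 c0 M (e0 - u) idx k" for idx k
        by (simp add: e u(4) e0_def)
      ultimately show ?case using u(1) u_le(1) elim by blast
    qed
  qed

  have I_mean: "\<exists>k1. \<exists>\<delta>1>0. \<forall>k\<ge>k1. \<forall>\<delta>\<in>{0<..\<delta>1}.
      sqrt (prob_space.expectation P (\<lambda>\<omega>. (norm (e \<delta> (\<lambda>j. I j \<omega>) k))\<^sup>2)) < \<epsilon>"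
    if a: "0 < a" and b: "b < 1" and C: "\<forall>\<^sub>F \<delta> in at_right 0. c0 < C0_bar (A \<delta>) M" and \<epsilon>: "0 < \<epsilon>" for \<epsilon>
  proof -
    define \<eta> where "\<eta> = \<epsilon> / 16"
    have \<eta>: "0 < \<eta>" "0 < 3 * \<eta>" using \<epsilon> by (simp_all add: \<eta>_def)
    obtain w where w: "norm (e0 - adjoint Adag w) < \<eta>" using approx[OF \<eta>(1)] by blast
    obtain k1 where k1: "\<And>(A :: 'a \<Rightarrow> 'b^'n) x0 k.
        bounded_linear A \<Longrightarrow> c0 \<le> 1 / L_const A \<Longrightarrow> c0 < C0_bar A M \<Longrightarrow> norm x0 \<le> norm e0 + 1 \<Longrightarrow>
        norm (x0 - adjoint A w) \<le> 3 * \<eta> \<Longrightarrow> k1 \<le> k \<Longrightarrow>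
        seq_mean k (\<lambda>idx. (norm (svrg A 0 c0 M x0 idx k))\<^sup>2) \<le> (3 * (3 * \<eta>))\<^sup>2"
      by (rule mean_square_convergence_uniform[OF c0(1) M \<eta>(2), where w = w and R = "norm e0 + 1"]) blast
    have "\<forall>\<^sub>F \<delta> in at_right 0. \<forall>k\<ge>k1. sqrt (prob_space.expectation P (\<lambda>\<omega>. (norm (e \<delta> (\<lambda>j. I j \<omega>) k))\<^sup>2)) < \<epsilon>"
      using start[OF a b \<eta>(1) w] C
    proof eventually_elim
      case (elim \<delta>)
      then obtain u where u: "bounded_linear (A \<delta>)" "norm u \<le> \<eta>" "norm (e0 - u) \<le> norm e0 + 1"
        "norm (e0 - u - adjoint (A \<delta>) w) < 3 * \<eta>"
        "\<And>idx k. e \<delta> idx k = u + svrg (A \<delta>) 0 c0 M (e0 - u) idx k" by blast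
      have "sqrt (seq_mean k (\<lambda>idx. (norm (e \<delta> idx k))\<^sup>2)) < \<epsilon>" if "k1 \<le> k" for k
      proof -
        have "seq_mean k (\<lambda>idx. (norm (svrg (A \<delta>) 0 c0 M (e0 - u) idx k))\<^sup>2) \<le> (3 * (3 * \<eta>))\<^sup>2"
          using u elim that by (intro k1) auto
        moreover have "(norm u)\<^sup>2 \<le> \<eta>\<^sup>2" using u(2) by (intro power_mono) auto
        moreover have "seq_mean k (\<lambda>idx. (norm (e \<delta> idx k))\<^sup>2)
            \<le> 2 * (norm u)\<^sup>2 + 2 * seq_mean k (\<lambda>idx. (norm (svrg (A \<delta>) 0 c0 M (e0 - u) idx k))\<^sup>2)"
          unfolding u(5) using seq_mean_norm_add_sq[of k "\<lambda>_. u"] by (simp add: seq_mean_const)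
        ultimately have "seq_mean k (\<lambda>idx. (norm (e \<delta> idx k))\<^sup>2) \<le> 2 * \<eta>\<^sup>2 + 2 * (3 * (3 * \<eta>))\<^sup>2"
          by linarith
        also have "\<dots> < (16 * \<eta>)\<^sup>2" using \<eta> by (simp add: power_mult_distrib)
        finally show ?thesis using \<epsilon> by (intro real_less_lsqrt) (auto simp: \<eta>_def)
      qed
      thus ?case by (simp add: expect)
    qed
    then obtain d where d: "0 < d" "\<And>\<delta> k. 0 < \<delta> \<Longrightarrow> \<delta> < d \<Longrightarrow> k1 \<le> k \<Longrightarrow>
        sqrt (prob_space.expectation P (\<lambda>\<omega>. (norm (e \<delta> (\<lambda>j. I j \<omega>) k))\<^sup>2)) < \<epsilon>"
      unfolding eventually_at_right_field by blast
    show ?thesis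
      by (rule exI[of _ k1], rule exI[of _ "d / 2"]) (use d in auto)
  qed

  have I_path: "\<exists>k1. \<exists>\<delta>1>0. \<forall>idx. \<forall>k\<ge>k1. \<forall>\<delta>\<in>{0<..\<delta>1}. norm (e \<delta> idx k) < \<epsilon>"
    if a: "0 < a" and b: "b < 1" and C: "\<forall>\<^sub>F \<delta> in at_right 0. c0 < C0 (A \<delta>) M" and \<epsilon>: "0 < \<epsilon>" for \<epsilon>
  proof -
    define \<eta> where "\<eta> = \<epsilon> / 7"
    have \<eta>: "0 < \<eta>" "0 < 3 * \<eta>" using \<epsilon> by (simp_all add: \<eta>_def)
    obtain w where w: "norm (e0 - adjoint Adag w) < \<eta>" using approx[OF \<eta>(1)] by blast
    have R: "0 \<le> norm e0 + 1" by simp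
    obtain k1 where k1: "\<And>(A :: 'a \<Rightarrow> 'b^'n) x0 k idx.
        bounded_linear A \<Longrightarrow> c0 \<le> 1 / L_const A \<Longrightarrow> c0 < C0 A M \<Longrightarrow> norm x0 \<le> norm e0 + 1 \<Longrightarrow>
        norm (x0 - adjoint A w) < 3 * \<eta> \<Longrightarrow> k1 \<le> k \<Longrightarrow> norm (svrg A 0 c0 M x0 idx k) < 2 * (3 * \<eta>)"
      by (rule pathwise_convergence_uniform[OF c0(1) M \<eta>(2) R, where w = w]) blast
    have "\<forall>\<^sub>F \<delta> in at_right 0. \<forall>idx. \<forall>k\<ge>k1. norm (e \<delta> idx k) < \<epsilon>"
      using start[OF a b \<eta>(1) w] C
    proof eventually_elim
      case (elim \<delta>)
      then obtain u where u: "bounded_linear (A \<delta>)" "norm u \<le> \<eta>" "norm (e0 - u) \<le> norm e0 + 1"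
        "norm (e0 - u - adjoint (A \<delta>) w) < 3 * \<eta>"
        "\<And>idx k. e \<delta> idx k = u + svrg (A \<delta>) 0 c0 M (e0 - u) idx k" by blast
      have "norm (e \<delta> idx k) < \<epsilon>" if "k1 \<le> k" for idx k
      proof -
        have "norm (svrg (A \<delta>) 0 c0 M (e0 - u) idx k) < 2 * (3 * \<eta>)"
          using u elim that by (intro k1) auto
        thus ?thesis
          using u(2) norm_triangle_ineq[of u "svrg (A \<delta>) 0 c0 M (e0 - u) idx k"]
          unfolding u(5) \<eta>_def by linarith
      qed
      thus ?case by blast
    qed
    then obtain d where d: "0 < d" "\<And>\<delta> idx k. 0 < \<delta> \<Longrightarrow> \<delta> < d \<Longrightarrow> k1 \<le> k \<Longrightarrow> norm (e \<delta> idx k) < \<epsilon>"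
      unfolding eventually_at_right_field by blast
    show ?thesis
      by (rule exI[of _ k1], rule exI[of _ "d / 2"]) (use d in auto)
  qed

  \<comment> \<open>Without truncation, the error is the noise-free error plus the propagated noise.\<close>
  have split: "e \<delta> idx k = svrg Adag 0 c0 M e0 idx k + svrg Adag (\<xi> \<delta>) c0 M 0 idx k"
    if "a = 0" "0 < \<delta>" "\<delta> < 1" for \<delta> idx k
  proof -
    have "A \<delta> = Adag" using A[OF that(2,3)] that(1) by (simp add: truncation_def)
    hence "e \<delta> idx k = svrg Adag (\<xi> \<delta>) c0 M e0 idx k"
      unfolding e e0_def by (simp only:) (rule svrg_shift[OF Adag(1)], simp add: Adag_xdag)
    thus ?thesis using svrg_add[OF Adag(1), of 0 "\<xi> \<delta>" c0 M e0 0 idx k] by simp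
  qed
  have const: "Q Adag" if "a = 0" "\<forall>\<^sub>F \<delta> in at_right 0. Q (A \<delta>)" for Q
  proof -
    have "\<forall>\<^sub>F \<delta> in at_right (0::real). Q Adag"
      using that(2) positive
    proof eventually_elim
      case (elim \<delta>)
      thus ?case using A[of \<delta>] that(1) by (simp add: truncation_def)
    qed
    thus ?thesis by simp
  qed

  have II_mean: "((\<lambda>\<delta>. sqrt (prob_space.expectation P (\<lambda>\<omega>. (norm (e \<delta> (\<lambda>j. I j \<omega>) (k \<delta>)))\<^sup>2))) \<longlongrightarrow> 0) (at_right 0)"
    if a: "a = 0" and k: "filterlim k at_top (at_right 0)" "((\<lambda>\<delta>. sqrt (real (k \<delta>)) * \<delta>) \<longlongrightarrow> 0) (at_right 0)"
      and C: "\<forall>\<^sub>F \<delta> in at_right 0. c0 < C0_bar (A \<delta>) M" for k :: "real \<Rightarrow> nat"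
  proof (rule order_tendstoI)
    fix \<epsilon> :: real assume "\<epsilon> < 0"
    thus "\<forall>\<^sub>F \<delta> in at_right 0. \<epsilon> < sqrt (prob_space.expectation P (\<lambda>\<omega>. (norm (e \<delta> (\<lambda>j. I j \<omega>) (k \<delta>)))\<^sup>2))"
      unfolding expect by (intro always_eventually allI) (simp add: seq_mean_nonneg less_le_trans)
  next
    fix \<epsilon> :: real assume \<epsilon>: "0 < \<epsilon>"
    have c0_Adag: "c0 \<le> 1 / L_const Adag" "c0 < C0_bar Adag M"
      using const[OF a, of "\<lambda>A. c0 \<le> 1 / L_const A"] const[OF a, of "\<lambda>A. c0 < C0_bar A M"] c0(2) C by auto
    define \<eta> where "\<eta> = \<epsilon> / 6"
    have \<eta>: "0 < \<eta>" using \<epsilon> by (simp add: \<eta>_def)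
    obtain w where w: "norm (e0 - adjoint Adag w) < \<eta>" using approx[OF \<eta>] by blast
    obtain k1 where k1: "\<And>(A :: 'a \<Rightarrow> 'b^'n) x0 k.
        bounded_linear A \<Longrightarrow> c0 \<le> 1 / L_const A \<Longrightarrow> c0 < C0_bar A M \<Longrightarrow> norm x0 \<le> norm e0 \<Longrightarrow>
        norm (x0 - adjoint A w) \<le> \<eta> \<Longrightarrow> k1 \<le> k \<Longrightarrow>
        seq_mean k (\<lambda>idx. (norm (svrg A 0 c0 M x0 idx k))\<^sup>2) \<le> (3 * \<eta>)\<^sup>2"
      by (rule mean_square_convergence_uniform[OF c0(1) M \<eta>, where w = w and R = "norm e0"]) blast
    have "((\<lambda>\<delta>. c0 / real CARD('n) * ((sqrt (real (k \<delta>)) * \<delta>)\<^sup>2 + 3 * real M * \<delta>\<^sup>2)) \<longlongrightarrow>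
        c0 / real CARD('n) * (0\<^sup>2 + 3 * real M * 0\<^sup>2)) (at_right 0)"
      by (intro tendsto_intros k(2))
    hence noise_small: "\<forall>\<^sub>F \<delta> in at_right 0. c0 / real CARD('n) * ((sqrt (real (k \<delta>)) * \<delta>)\<^sup>2 + 3 * real M * \<delta>\<^sup>2) < \<eta>\<^sup>2"
      using \<eta> by (intro order_tendstoD(2)) auto
    have "\<forall>\<^sub>F \<delta> in at_right 0. k1 \<le> k \<delta>" using k(1) by (simp add: filterlim_at_top)
    thus "\<forall>\<^sub>F \<delta> in at_right 0. sqrt (prob_space.expectation P (\<lambda>\<omega>. (norm (e \<delta> (\<lambda>j. I j \<omega>) (k \<delta>)))\<^sup>2)) < \<epsilon>"
      using noise_small positive
    proof eventually_elim
      case (elim \<delta>)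
      hence \<delta>: "0 < \<delta>" "\<delta> < 1" by auto
      have "seq_mean (k \<delta>) (\<lambda>idx. (norm (svrg Adag 0 c0 M e0 idx (k \<delta>)))\<^sup>2) \<le> (3 * \<eta>)\<^sup>2"
        using w elim(1) by (intro k1 Adag(1) c0_Adag) auto
      moreover have "seq_mean (k \<delta>) (\<lambda>idx. (norm (svrg Adag (\<xi> \<delta>) c0 M 0 idx (k \<delta>)))\<^sup>2) \<le> \<eta>\<^sup>2"
      proof -
        have "seq_mean (k \<delta>) (\<lambda>idx. (norm (svrg Adag (\<xi> \<delta>) c0 M 0 idx (k \<delta>)))\<^sup>2)
            \<le> c0 / real CARD('n) * (real (k \<delta>) + 3 * real M) * \<delta>\<^sup>2"
          using svrg_mean_noise[OF Adag(1) c0(1) c0_Adag(1) M c0_Adag(2), of "k \<delta>" "\<xi> \<delta>"] noise(2)[OF \<delta>] by simp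
        also have "\<dots> = c0 / real CARD('n) * ((sqrt (real (k \<delta>)) * \<delta>)\<^sup>2 + 3 * real M * \<delta>\<^sup>2)"
          by (simp add: power_mult_distrib algebra_simps)
        finally show ?thesis using elim(2) by linarith
      qed
      ultimately have "seq_mean (k \<delta>) (\<lambda>idx. (norm (e \<delta> idx (k \<delta>)))\<^sup>2) \<le> 2 * (3 * \<eta>)\<^sup>2 + 2 * \<eta>\<^sup>2"
        unfolding split[OF a \<delta>]
        using seq_mean_norm_add_sq[of "k \<delta>" "\<lambda>idx. svrg Adag 0 c0 M e0 idx (k \<delta>)" "\<lambda>idx. svrg Adag (\<xi> \<delta>) c0 M 0 idx (k \<delta>)"]
        by linarith
      also have "\<dots> < (6 * \<eta>)\<^sup>2" using \<eta> by (simp add: power_mult_distrib)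
      finally show ?case unfolding expect using \<epsilon> by (intro real_less_lsqrt) (auto simp: \<eta>_def)
    qed
  qed

  have II_path: "uniform_limit UNIV (\<lambda>\<delta> idx. norm (e \<delta> idx (k \<delta>))) (\<lambda>_. 0) (at_right 0)"
    if a: "a = 0" and k: "filterlim k at_top (at_right 0)" "((\<lambda>\<delta>. sqrt (real (k \<delta>)) * \<delta>) \<longlongrightarrow> 0) (at_right 0)"
      and C: "\<forall>\<^sub>F \<delta> in at_right 0. c0 < C0 (A \<delta>) M" for k :: "real \<Rightarrow> nat"
  proof (rule uniform_limitI)
    fix \<epsilon> :: real assume \<epsilon>: "0 < \<epsilon>"
    have c0_Adag: "c0 \<le> 1 / L_const Adag" "c0 < C0 Adag M"
      using const[OF a, of "\<lambda>A. c0 \<le> 1 / L_const A"] const[OF a, of "\<lambda>A. c0 < C0 A M"] c0(2) C by auto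
    define \<eta> where "\<eta> = \<epsilon> / 3"
    have \<eta>: "0 < \<eta>" using \<epsilon> by (simp add: \<eta>_def)
    obtain w where w: "norm (e0 - adjoint Adag w) < \<eta>" using approx[OF \<eta>] by blast
    obtain k1 where k1: "\<And>(A :: 'a \<Rightarrow> 'b^'n) x0 k idx.
        bounded_linear A \<Longrightarrow> c0 \<le> 1 / L_const A \<Longrightarrow> c0 < C0 A M \<Longrightarrow> norm x0 \<le> norm e0 \<Longrightarrow>
        norm (x0 - adjoint A w) < \<eta> \<Longrightarrow> k1 \<le> k \<Longrightarrow> norm (svrg A 0 c0 M x0 idx k) < 2 * \<eta>"
      by (rule pathwise_convergence_uniform[OF c0(1) M \<eta> norm_ge_zero[of e0], where w = w]) blast
    have "((\<lambda>\<delta>. 2 * c0 / real CARD('n) * (sqrt (real (k \<delta>)) * \<delta>)\<^sup>2) \<longlongrightarrow> 2 * c0 / real CARD('n) * 0\<^sup>2) (at_right 0)"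
      by (intro tendsto_intros k(2))
    hence noise_small: "\<forall>\<^sub>F \<delta> in at_right 0. 2 * c0 / real CARD('n) * (sqrt (real (k \<delta>)) * \<delta>)\<^sup>2 < \<eta>\<^sup>2"
      using \<eta> by (intro order_tendstoD(2)) auto
    have "\<forall>\<^sub>F \<delta> in at_right 0. k1 \<le> k \<delta>" using k(1) by (simp add: filterlim_at_top)
    thus "\<forall>\<^sub>F \<delta> in at_right 0. \<forall>idx\<in>UNIV. dist (norm (e \<delta> idx (k \<delta>))) 0 < \<epsilon>"
      using noise_small positive
    proof eventually_elim
      case (elim \<delta>)
      hence \<delta>: "0 < \<delta>" "\<delta> < 1" by auto
      have "norm (e \<delta> idx (k \<delta>)) < \<epsilon>" for idx
      proof -
        have "norm (svrg Adag 0 c0 M e0 idx (k \<delta>)) < 2 * \<eta>"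
          using w elim(1) by (intro k1 Adag(1) c0_Adag) auto
        moreover have "norm (svrg Adag (\<xi> \<delta>) c0 M 0 idx (k \<delta>)) < \<eta>"
        proof (rule power2_less_imp_less)
          have "(norm (svrg Adag (\<xi> \<delta>) c0 M 0 idx (k \<delta>)))\<^sup>2 \<le> 2 * c0 * real (k \<delta>) / real CARD('n) * \<delta>\<^sup>2"
            using svrg_pathwise_noise[OF Adag(1) c0(1) c0_Adag(1) M c0_Adag(2), of "\<xi> \<delta>" idx "k \<delta>"] noise(2)[OF \<delta>] by simp
          also have "\<dots> = 2 * c0 / real CARD('n) * (sqrt (real (k \<delta>)) * \<delta>)\<^sup>2"
            by (simp add: power_mult_distrib)
          finally show "(norm (svrg Adag (\<xi> \<delta>) c0 M 0 idx (k \<delta>)))\<^sup>2 < \<eta>\<^sup>2" using elim(2) by linarith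
        qed (use \<eta> in simp)
        ultimately show ?thesis
          unfolding split[OF a \<delta>]
          using norm_triangle_ineq[of "svrg Adag 0 c0 M e0 idx (k \<delta>)" "svrg Adag (\<xi> \<delta>) c0 M 0 idx (k \<delta>)"]
          by (simp add: \<eta>_def)
      qed
      thus ?case by simp
    qed
  qed

  show ?thesis
    using I_mean I_path II_mean II_path by blast
qed

end
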